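(* Let $D\subset\mathbb{R}^3$ be a bounded domain with $C^2$-smooth boundary $S$, and let $A\in H^2(D;\mathbb{R}^3)$ be a vector field. Put $a:=\nabla\times A$, $f:=\nabla\cdot A$ in $D$, and let $\phi:=A|_S$ be the boundary values of $A$ on $S$. Then $A$ is uniquely recovered from the data $a$, $f$, $\phi$ by solving a Dirichlet problem: $A$ is the unique solution $V\in H^2(D;\mathbb{R}^3)$ of $$-\nabla^2 V=\nabla\times a-\nabla f\quad\text{in }D,\qquad V|_S=\phi .$$
   Context: $H^2(D;\mathbb{R}^3)$ is the usual Sobolev space of vector fields on $D$ with components in $H^2(D)$. The symbols $\nabla\times$, $\nabla\cdot$, $\nabla$ and $\nabla^2$ denote curl, divergence, gradient and the componentwise Laplacian, taken in the weak sense. Restrictions to $S$ are understood in the sense of traces. *)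

theory Defs
  imports "HOL-Analysis.Analysis"
begin

section \<open>Smooth functions and domains with \<open>C\<^sup>2\<close> boundary\<close>

definition partial_deriv :: "'a::euclidean_space \<Rightarrow> ('a \<Rightarrow> real) \<Rightarrow> 'a \<Rightarrow> real" where
  "partial_deriv b f = (\<lambda>x. frechet_derivative f (at x) b)"

primrec cont_diff :: "nat \<Rightarrow> ('a::euclidean_space \<Rightarrow> real) \<Rightarrow> bool" where
  "cont_diff 0 f \<longleftrightarrow> continuous_on UNIV f"
| "cont_diff (Suc k) f \<longleftrightarrow>
     (\<forall>x. f differentiable (at x)) \<and> (\<forall>b\<in>Basis. cont_diff k (partial_deriv b f))"

definition smooth :: "('a::euclidean_space \<Rightarrow> real) \<Rightarrow> bool" where
  "smooth f \<longleftrightarrow> (\<forall>k. cont_diff k f)"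

definition test_function :: "'a::euclidean_space set \<Rightarrow> ('a \<Rightarrow> real) \<Rightarrow> bool" where
  "test_function D \<psi> \<longleftrightarrow>
     smooth \<psi> \<and> (\<exists>K. compact K \<and> K \<subseteq> D \<and> (\<forall>x. x \<notin> K \<longrightarrow> \<psi> x = 0))"

definition bounded_domain :: "'a::euclidean_space set \<Rightarrow> bool" where
  "bounded_domain D \<longleftrightarrow> open D \<and> connected D \<and> D \<noteq> {} \<and> bounded D"

text \<open>
  Near each boundary point, after an orthogonal change of coordinates \<open>T\<close>, the domain is the
  region strictly above the graph of a \<open>C\<^sup>2\<close> function of the first two coordinates; in
  particular it lies locally on one side of its boundary.
\<close>
definition C2_boundary :: "(real^3) set \<Rightarrow> bool" where
  "C2_boundary D \<longleftrightarrow>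
     (\<forall>p\<in>frontier D. \<exists>r>0. \<exists>T :: real^3 \<Rightarrow> real^3. \<exists>\<gamma> :: real^2 \<Rightarrow> real.
        orthogonal_transformation T \<and> cont_diff 2 \<gamma> \<and>
        D \<inter> ball p r = {x \<in> ball p r. T x $ 3 > \<gamma> (vector [T x $ 1, T x $ 2])})"


section \<open>Weak derivatives and Sobolev spaces\<close>

definition locally_integrable :: "'a::euclidean_space set \<Rightarrow> ('a \<Rightarrow> real) \<Rightarrow> bool" where
  "locally_integrable D u \<longleftrightarrow> (\<forall>K. compact K \<and> K \<subseteq> D \<longrightarrow> integrable (lebesgue_on K) u)"

definition has_weak_deriv ::
    "'a::euclidean_space set \<Rightarrow> 'a \<Rightarrow> ('a \<Rightarrow> real) \<Rightarrow> ('a \<Rightarrow> real) \<Rightarrow> bool" where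
  "has_weak_deriv D b u v \<longleftrightarrow>
     locally_integrable D u \<and> locally_integrable D v \<and>
     (\<forall>\<psi>. test_function D \<psi> \<longrightarrow>
        (LINT x|lebesgue_on D. u x * partial_deriv b \<psi> x) = - (LINT x|lebesgue_on D. v x * \<psi> x))"

text \<open>
  A representative of the weak derivative, which is unique up to null sets. It is unspecified
  if \<open>u\<close> has no weak derivative in direction \<open>b\<close>.
\<close>
definition weak_deriv :: "'a::euclidean_space set \<Rightarrow> 'a \<Rightarrow> ('a \<Rightarrow> real) \<Rightarrow> 'a \<Rightarrow> real" where
  "weak_deriv D b u = (SOME v. has_weak_deriv D b u v)"

text \<open>
  Nonnegative integrals are used for \<open>L\<^sup>2\<close> norms because, unlike the Bochner integral, they
  are infinite rather than \<open>0\<close> on nonnegative measurable functions that are not integrable.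
\<close>
definition L2_on :: "'a::euclidean_space set \<Rightarrow> ('a \<Rightarrow> real) \<Rightarrow> bool" where
  "L2_on D u \<longleftrightarrow>
     u \<in> borel_measurable (lebesgue_on D) \<and> (\<integral>\<^sup>+x. ennreal ((u x)\<^sup>2) \<partial>lebesgue_on D) < \<infinity>"

primrec sobolev :: "nat \<Rightarrow> 'a::euclidean_space set \<Rightarrow> ('a \<Rightarrow> real) \<Rightarrow> bool" where
  "sobolev 0 D u \<longleftrightarrow> L2_on D u"
| "sobolev (Suc k) D u \<longleftrightarrow>
     L2_on D u \<and> (\<forall>b\<in>Basis. \<exists>v. has_weak_deriv D b u v \<and> sobolev k D v)"

definition sobolev_vec :: "nat \<Rightarrow> (real^3) set \<Rightarrow> (real^3 \<Rightarrow> real^3) \<Rightarrow> bool" where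
  "sobolev_vec k D V \<longleftrightarrow> (\<forall>j. sobolev k D (\<lambda>x. V x $ j))"


section \<open>Weak differential operators in three dimensions\<close>

definition weak_partial :: "(real^3) set \<Rightarrow> 3 \<Rightarrow> (real^3 \<Rightarrow> real) \<Rightarrow> real^3 \<Rightarrow> real" where
  "weak_partial D i u = weak_deriv D (axis i 1) u"

definition weak_grad :: "(real^3) set \<Rightarrow> (real^3 \<Rightarrow> real) \<Rightarrow> real^3 \<Rightarrow> real^3" where
  "weak_grad D u x = (\<chi> i. weak_partial D i u x)"

definition weak_div :: "(real^3) set \<Rightarrow> (real^3 \<Rightarrow> real^3) \<Rightarrow> real^3 \<Rightarrow> real" where
  "weak_div D V x = (\<Sum>i\<in>UNIV. weak_partial D i (\<lambda>y. V y $ i) x)"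

definition weak_curl :: "(real^3) set \<Rightarrow> (real^3 \<Rightarrow> real^3) \<Rightarrow> real^3 \<Rightarrow> real^3" where
  "weak_curl D V x = vector
     [weak_partial D 2 (\<lambda>y. V y $ 3) x - weak_partial D 3 (\<lambda>y. V y $ 2) x,
      weak_partial D 3 (\<lambda>y. V y $ 1) x - weak_partial D 1 (\<lambda>y. V y $ 3) x,
      weak_partial D 1 (\<lambda>y. V y $ 2) x - weak_partial D 2 (\<lambda>y. V y $ 1) x]"

definition weak_laplacian :: "(real^3) set \<Rightarrow> (real^3 \<Rightarrow> real^3) \<Rightarrow> real^3 \<Rightarrow> real^3" where
  "weak_laplacian D V x =
     (\<chi> j. \<Sum>i\<in>UNIV. weak_partial D i (weak_partial D i (\<lambda>y. V y $ j)) x)"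


section \<open>Surface measure\<close>

text \<open>
  Two-dimensional Hausdorff measure, normalised by the area \<open>\<pi>/4 \<cdot> d\<^sup>2\<close> of a disc of diameter
  \<open>d\<close>, so that on a \<open>C\<^sup>1\<close> surface it is the surface measure. The covering sets are required to
  be bounded because \<^const>\<open>diameter\<close> is unspecified on unbounded sets.
\<close>
definition hausdorff2_pre :: "real \<Rightarrow> 'a::euclidean_space set \<Rightarrow> ennreal" where
  "hausdorff2_pre \<delta> E =
     (INF C \<in> {C :: nat \<Rightarrow> 'a set. E \<subseteq> (\<Union>n. C n) \<and> (\<forall>n. bounded (C n) \<and> diameter (C n) \<le> \<delta>)}.
        \<Sum>n. ennreal (pi / 4 * (diameter (C n))\<^sup>2))"

definition hausdorff2_outer :: "'a::euclidean_space set \<Rightarrow> ennreal" where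
  "hausdorff2_outer E = (SUP \<delta>\<in>{0<..}. hausdorff2_pre \<delta> E)"

text \<open>The \<sigma>-algebra consists of all Caratheodory measurable sets, so the measure is complete.\<close>
definition hausdorff2 :: "'a::euclidean_space measure" where
  "hausdorff2 =
     measure_of UNIV (lambda_system UNIV UNIV hausdorff2_outer) hausdorff2_outer"

lemma outer_measure_space_hausdorff2_outer:
  "outer_measure_space UNIV (hausdorff2_outer :: 'a::euclidean_space set \<Rightarrow> ennreal)"
proof -
  have mono: "hausdorff2_pre \<delta> E \<le> hausdorff2_pre \<delta> F" if "E \<subseteq> F" for \<delta> and E F :: "'a set"
    unfolding hausdorff2_pre_def using that by (intro INF_superset_mono) auto
  have empty: "hausdorff2_pre \<delta> ({} :: 'a set) = 0" if "\<delta> > 0" for \<delta>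
  proof -
    have "hausdorff2_pre \<delta> ({} :: 'a set) \<le> (\<Sum>n. ennreal (pi / 4 * (diameter ({} :: 'a set))\<^sup>2))"
      unfolding hausdorff2_pre_def using that by (intro INF_lower2[of "\<lambda>_. {}"]) auto
    then show ?thesis by simp
  qed
  have sub: "hausdorff2_pre \<delta> (\<Union>i. E i) \<le> (\<Sum>i. hausdorff2_pre \<delta> (E i))"
    for \<delta> and E :: "nat \<Rightarrow> 'a set"
  proof (rule ennreal_le_epsilon)
    fix e :: real
    assume e: "0 < e" and fin: "(\<Sum>i. hausdorff2_pre \<delta> (E i)) < top"
    have fin_i: "hausdorff2_pre \<delta> (E i) < top" for i
      using fin by (metis ennreal_suminf_lessD top.not_eq_extremum)
    have "\<exists>C. (E i \<subseteq> (\<Union>n. C n) \<and> (\<forall>n. bounded (C n) \<and> diameter (C n) \<le> \<delta>)) \<and>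
        (\<Sum>n. ennreal (pi / 4 * (diameter (C n))\<^sup>2)) < hausdorff2_pre \<delta> (E i) + ennreal (e * (1/2)^Suc i)"
      for i
    proof -
      have "hausdorff2_pre \<delta> (E i) < hausdorff2_pre \<delta> (E i) + ennreal (e * (1/2)^Suc i)"
        using fin_i[of i] e by (simp add: ennreal_zero_less_mult_iff)
      then show ?thesis
        by (subst (asm) hausdorff2_pre_def) (auto simp: INF_less_iff)
    qed
    then obtain C where
      C: "\<And>i. E i \<subseteq> (\<Union>n. C i n)" "\<And>i n. bounded (C i n)" "\<And>i n. diameter (C i n) \<le> \<delta>"
      and C_le: "\<And>i. (\<Sum>n. ennreal (pi / 4 * (diameter (C i n))\<^sup>2))
          < hausdorff2_pre \<delta> (E i) + ennreal (e * (1/2)^Suc i)"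
      by metis
    define F where "F k = (case prod_decode k of (i, n) \<Rightarrow> C i n)" for k
    have cover: "(\<Union>i. E i) \<subseteq> (\<Union>k. F k)"
    proof
      fix x assume "x \<in> (\<Union>i. E i)"
      then obtain i n where "x \<in> C i n" using C(1) by blast
      then have "x \<in> F (prod_encode (i, n))" by (simp add: F_def)
      then show "x \<in> (\<Union>k. F k)" by blast
    qed
    have "hausdorff2_pre \<delta> (\<Union>i. E i) \<le> (\<Sum>k. ennreal (pi / 4 * (diameter (F k))\<^sup>2))"
      unfolding hausdorff2_pre_def
      using cover C by (intro INF_lower) (auto simp: F_def split: prod.split)
    also have "\<dots> = (\<Sum>k. (\<lambda>(i, n). ennreal (pi / 4 * (diameter (C i n))\<^sup>2)) (prod_decode k))"
      by (simp add: F_def split_beta)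
    also have "\<dots> = (\<Sum>i. \<Sum>n. ennreal (pi / 4 * (diameter (C i n))\<^sup>2))"
      by (rule suminf_ennreal_2dimen) simp
    also have "\<dots> \<le> (\<Sum>i. hausdorff2_pre \<delta> (E i) + ennreal (e * (1/2)^Suc i))"
      using C_le by (intro suminf_le) (auto intro: less_imp_le)
    also have "\<dots> = (\<Sum>i. hausdorff2_pre \<delta> (E i)) + (\<Sum>i. ennreal (e * (1/2)^Suc i))"
      by (rule suminf_add[symmetric]) auto
    also have "(\<Sum>i. ennreal (e * (1/2)^Suc i)) = ennreal e"
      using e sums_mult[OF power_half_series, of e] by (intro suminf_ennreal_eq) auto
    finally show "hausdorff2_pre \<delta> (\<Union>i. E i) \<le> (\<Sum>i. hausdorff2_pre \<delta> (E i)) + ennreal e" .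
  qed
  have "hausdorff2_outer (\<Union>i. E i) \<le> (\<Sum>i. hausdorff2_outer (E i))" for E :: "nat \<Rightarrow> 'a set"
    unfolding hausdorff2_outer_def
  proof (rule SUP_least)
    fix \<delta> :: real assume "\<delta> \<in> {0<..}"
    then have "(\<Sum>i. hausdorff2_pre \<delta> (E i)) \<le> (\<Sum>i. SUP \<delta>\<in>{0<..}. hausdorff2_pre \<delta> (E i))"
      by (intro suminf_le SUP_upper) auto
    with sub[of \<delta> E]
    show "hausdorff2_pre \<delta> (\<Union>i. E i) \<le> (\<Sum>i. SUP \<delta>\<in>{0<..}. hausdorff2_pre \<delta> (E i))"
      by (rule order_trans)
  qed
  moreover have "hausdorff2_outer ({} :: 'a set) = 0"
    by (simp add: hausdorff2_outer_def empty)
  moreover have "hausdorff2_outer E \<le> hausdorff2_outer F" if "E \<subseteq> F" for E F :: "'a set"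
    unfolding hausdorff2_outer_def using mono[OF that] by (intro SUP_mono) auto
  ultimately show ?thesis
    by (auto simp: outer_measure_space_def positive_def increasing_def countably_subadditive_def)
qed

lemma
  shows space_hausdorff2: "space (hausdorff2 :: 'a::euclidean_space measure) = UNIV"
    and sets_hausdorff2:
      "sets (hausdorff2 :: 'a measure) = lambda_system UNIV UNIV hausdorff2_outer"
    and emeasure_hausdorff2:
      "E \<in> sets (hausdorff2 :: 'a measure) \<Longrightarrow> emeasure hausdorff2 E = hausdorff2_outer E"
proof -
  let ?L = "lambda_system UNIV UNIV (hausdorff2_outer :: 'a set \<Rightarrow> ennreal)"
  interpret sigma_algebra UNIV "UNIV :: 'a set set"
    using sigma_algebra_Pow[of "UNIV :: 'a set"] by simp
  have ms: "measure_space UNIV ?L hausdorff2_outer"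
    by (rule caratheodory_lemma[OF outer_measure_space_hausdorff2_outer])
  then have sa: "sigma_algebra UNIV ?L"
    and pos: "positive ?L hausdorff2_outer" and ca: "countably_additive ?L hausdorff2_outer"
    by (simp_all add: measure_space_def)
  show "space (hausdorff2 :: 'a measure) = UNIV"
    by (simp add: hausdorff2_def)
  show sets: "sets (hausdorff2 :: 'a measure) = ?L"
    by (simp add: hausdorff2_def sigma_algebra.sets_measure_of_eq[OF sa])
  show "emeasure hausdorff2 E = hausdorff2_outer E" if "E \<in> sets (hausdorff2 :: 'a measure)"
    unfolding hausdorff2_def
    using emeasure_measure_of_sigma[OF sa pos ca] that sets by blast
qed


section \<open>Traces and the Dirichlet problem\<close>

text \<open>
  The trace operator \<open>H\<^sup>1(D) \<rightarrow> L\<^sup>2(S)\<close>, \<open>S = \<partial>D\<close>, is the continuous extension of the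
  restriction map \<open>w \<mapsto> w|\<^sub>S\<close> from functions that are smooth up to the boundary. Its graph:
  \<open>g\<close> is the trace of \<open>u\<close> if some smooth \<open>w\<^sub>n\<close> converge to \<open>u\<close> in \<open>H\<^sup>1(D)\<close> while their
  restrictions to \<open>S\<close> converge to \<open>g\<close> in \<open>L\<^sup>2(S)\<close>.
\<close>
definition has_trace :: "(real^3) set \<Rightarrow> (real^3 \<Rightarrow> real) \<Rightarrow> (real^3 \<Rightarrow> real) \<Rightarrow> bool" where
  "has_trace D u g \<longleftrightarrow>
     sobolev 1 D u \<and>
     g \<in> borel_measurable (restrict_space hausdorff2 (frontier D)) \<and>
     (\<integral>\<^sup>+x\<in>frontier D. ennreal ((g x)\<^sup>2) \<partial>hausdorff2) < \<infinity> \<and>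
     (\<exists>w :: nat \<Rightarrow> real^3 \<Rightarrow> real.
        (\<forall>n. smooth (w n)) \<and>
        (\<lambda>n. \<integral>\<^sup>+x. ennreal ((w n x - u x)\<^sup>2) \<partial>lebesgue_on D) \<longlonglongrightarrow> 0 \<and>
        (\<forall>i. (\<lambda>n. \<integral>\<^sup>+x. ennreal ((partial_deriv (axis i 1) (w n) x - weak_partial D i u x)\<^sup>2)
               \<partial>lebesgue_on D) \<longlonglongrightarrow> 0) \<and>
        (\<lambda>n. \<integral>\<^sup>+x\<in>frontier D. ennreal ((w n x - g x)\<^sup>2) \<partial>hausdorff2) \<longlonglongrightarrow> 0)"

definition has_trace_vec :: "(real^3) set \<Rightarrow> (real^3 \<Rightarrow> real^3) \<Rightarrow> (real^3 \<Rightarrow> real^3) \<Rightarrow> bool" where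
  "has_trace_vec D V \<phi> \<longleftrightarrow> (\<forall>j. has_trace D (\<lambda>x. V x $ j) (\<lambda>x. \<phi> x $ j))"

definition solves_dirichlet ::
    "(real^3) set \<Rightarrow> (real^3 \<Rightarrow> real^3) \<Rightarrow> (real^3 \<Rightarrow> real^3) \<Rightarrow> (real^3 \<Rightarrow> real^3) \<Rightarrow> bool" where
  "solves_dirichlet D F \<phi> V \<longleftrightarrow>
     sobolev_vec 2 D V \<and>
     (AE x in lebesgue_on D. - weak_laplacian D V x = F x) \<and>
     has_trace_vec D V \<phi>"

end

theory Submission
  imports Defs
begin

text \<open>
  That \<open>A\<close> solves the Dirichlet problem is the identity \<open>- \<Delta> A = curl (curl A) - grad (div A)\<close>, which
  rests on the commutation of weak derivatives and on their uniqueness up to null sets.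

  For uniqueness let \<open>u\<close> be a component of the difference of two solutions, with gradient \<open>G\<close>. Integration
  by parts on the graphs describing the boundary bounds \<open>\<integral>\<^sub>D \<partial>\<^sub>b h\<close> by the \<open>L\<^sup>2\<close> norm of \<open>h\<close> on the boundary.
  Applied to the functions approximating \<open>u\<close>, this shows that the extension of \<open>u\<close> by \<open>0\<close> is weakly
  differentiable on the whole space. Near a point of the closure of \<open>D\<close> a cutoff \<open>\<xi> u\<close> of this extension can
  be mollified with a kernel supported off the origin, in a small ball in the inward direction; the result
  is a test function in \<open>D\<close>. In the limit, weak harmonicity yields \<open>\<integral> G \<bullet> \<nabla>(\<xi> u) = 0\<close>, and summing
  over a partition of unity gives \<open>\<integral> |G|\<^sup>2 = 0\<close>. Hence the mollifications of the extended \<open>u\<close> are constant with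
  compact support, so they vanish, and so does \<open>u\<close>.
\<close>

section \<open>Calculus of smooth functions\<close>

text \<open>The obstacle: the equation may be tested only with smooth functions of compact support
  in \<open>D\<close>, whereas the energy identity wants \<open>u\<close> itself as test function,
  and the zero trace is known only through smooth functions whose boundary values are small in
  \<open>L^2\<close> of the surface. Extension by 0 links the two: a jump across the boundary would
  leave a surface term, and the boundary estimate makes that term vanish in the limit. For the
  Hausdorff measure only one inequality against plane Lebesgue measure enters; a crude covering
  argument gives it, at the price of the factor \<open>16 / pi\<close>. A kernel centred at the
  origin would spread the support of \<open>\<xi> u\<close> across the boundary, hence the shifted
  kernels. The limit is taken only after integration against the fixed function \<open>G\<close>,
  where Fubini reduces it to continuity of translations in \<open>L^2\<close>, uniformly in shape
  and centre of the kernel. Functions on \<open>D\<close> are replaced by Borel representatives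
  vanishing off \<open>D\<close>, so that convolution and Fubini run over \<open>lborel\<close>
  while the statement speaks of \<open>lebesgue_on D\<close>.\<close>

lemma partial_deriv_eq:
  "(f has_derivative f') (at x) \<Longrightarrow> partial_deriv b f x = f' b"
  unfolding partial_deriv_def by (metis frechet_derivative_at)

lemma cont_diff_SucI:
  assumes "\<And>x. (f has_derivative f' x) (at x)" "\<And>b. b \<in> Basis \<Longrightarrow> cont_diff k (\<lambda>x. f' x b)"
  shows "cont_diff (Suc k) f"
proof -
  have "partial_deriv b f = (\<lambda>x. f' x b)" for b
    using partial_deriv_eq[OF assms(1)] by auto
  then show ?thesis using assms by (auto simp: differentiable_def)
qed

lemma cont_diff_Suc_has_derivative:
  assumes "cont_diff (Suc k) f"
  shows "(f has_derivative (\<lambda>h. partial_deriv h f x)) (at x)"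
  using assms by (simp add: partial_deriv_def frechet_derivative_works[symmetric])

lemma partial_deriv_scaleR:
  assumes "cont_diff (Suc k) f"
  shows "partial_deriv (t *\<^sub>R h) f x = t * partial_deriv h f x"
proof -
  have "linear (\<lambda>h. partial_deriv h f x)"
    using has_derivative_linear[OF cont_diff_Suc_has_derivative[OF assms]] .
  from linear_cmul[OF this, of t h] show ?thesis by simp
qed

lemma cont_diff_Suc_imp: "cont_diff (Suc k) f \<Longrightarrow> cont_diff k f"
proof (induction k arbitrary: f)
  case 0
  then show ?case
    by (auto simp: continuous_on_eq_continuous_within intro!: differentiable_imp_continuous_within)
qed auto

lemma cont_diff_le: "cont_diff m f \<Longrightarrow> k \<le> m \<Longrightarrow> cont_diff k f"
  by (induction m) (use cont_diff_Suc_imp le_Suc_eq in blast)+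

lemma cont_diff_continuous: "cont_diff k f \<Longrightarrow> continuous_on A f"
  using cont_diff_le[of k f 0] by (auto intro: continuous_on_subset)

lemma cont_diff_const [simp]: "cont_diff k (\<lambda>x. c)"
proof (induction k arbitrary: c)
  case (Suc k)
  then show ?case by (intro cont_diff_SucI[where f' = "\<lambda>_ _. 0"]) auto
qed auto

lemma cont_diff_add:
  "cont_diff k f \<Longrightarrow> cont_diff k g \<Longrightarrow> cont_diff k (\<lambda>x. f x + g x)"
proof (induction k arbitrary: f g)
  case (Suc k)
  show ?case
    by (rule cont_diff_SucI)
      (rule has_derivative_add[OF Suc.prems[THEN cont_diff_Suc_has_derivative]],
        use Suc.prems in \<open>auto intro!: Suc.IH\<close>)
qed (auto intro: continuous_intros)

lemma cont_diff_mult: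
  "cont_diff k f \<Longrightarrow> cont_diff k g \<Longrightarrow> cont_diff k (\<lambda>x. f x * g x)"
proof (induction k arbitrary: f g)
  case (Suc k)
  have fg: "cont_diff k f" "cont_diff k g" using cont_diff_Suc_imp Suc.prems by blast+
  show ?case
    by (intro cont_diff_SucI[OF has_derivative_mult[OF Suc.prems[THEN cont_diff_Suc_has_derivative]]])
      (use Suc.prems fg in \<open>auto intro!: cont_diff_add Suc.IH\<close>)
qed (auto intro: continuous_intros)

text \<open>The induction generalises the outer function alone: the chain rule yields
  \<open>partial_deriv 1 h\<close> composed with the same \<open>q\<close>, to which the induction
  hypothesis applies, times a partial derivative of \<open>q\<close>.\<close>

lemma cont_diff_compose:
  fixes q :: "'a::euclidean_space \<Rightarrow> real" and h :: "real \<Rightarrow> real"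
  shows "cont_diff k h \<Longrightarrow> cont_diff k q \<Longrightarrow> cont_diff k (\<lambda>x. h (q x))"
proof (induction k arbitrary: h)
  case 0
  then show ?case by (auto intro: continuous_on_compose2)
next
  case (Suc k)
  have q: "cont_diff k q" using cont_diff_Suc_imp Suc.prems by blast
  have h: "partial_deriv c h x = c * partial_deriv 1 h x" for c x
    using partial_deriv_scaleR[OF Suc.prems(1), of c 1 x] by simp
  have D: "((\<lambda>x. h (q x)) has_derivative (\<lambda>d. partial_deriv d q x * partial_deriv 1 h (q x))) (at x)" for x
  proof -
    have 1: "(q has_derivative (\<lambda>d. partial_deriv d q x)) (at x)"
      and 2: "(h has_derivative (\<lambda>d. partial_deriv d h (q x))) (at (q x))"
      using Suc.prems by (blast intro: cont_diff_Suc_has_derivative)+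
    have "(\<lambda>d. partial_deriv (partial_deriv d q x) h (q x)) = (\<lambda>d. partial_deriv d q x * partial_deriv 1 h (q x))"
      by (intro ext h)
    then show ?thesis by (rule has_derivative_eq_rhs[OF has_derivative_compose[OF 1 2]])
  qed
  have "cont_diff k (\<lambda>x. partial_deriv 1 h (q x))"
    using Suc.prems(1) by (intro Suc.IH[of "partial_deriv 1 h"] q) auto
  then show ?case
    using Suc.prems(2) by (intro cont_diff_SucI[OF D] cont_diff_mult) auto
qed

lemma cont_diff_affine:
  fixes f :: "'a::euclidean_space \<Rightarrow> real"
  assumes "cont_diff k f"
  shows "cont_diff k (\<lambda>x. f (c *\<^sub>R x + d))"
  using assms
proof (induction k arbitrary: f)
  case 0
  then show ?case by (auto intro!: continuous_on_compose2[of UNIV f] continuous_intros)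
next
  case (Suc k)
  have D: "((\<lambda>x. f (c *\<^sub>R x + d)) has_derivative (\<lambda>h. partial_deriv (c *\<^sub>R h) f (c *\<^sub>R x + d))) (at x)" for x
    by (rule has_derivative_compose[where g=f and f="\<lambda>x. c *\<^sub>R x + d",
        OF _ cont_diff_Suc_has_derivative[OF Suc.prems]]) (auto intro!: derivative_eq_intros)
  have eq: "partial_deriv (c *\<^sub>R h) f x = c * partial_deriv h f x" for h x
    by (rule partial_deriv_scaleR[OF Suc.prems])
  have "cont_diff k (\<lambda>x. partial_deriv (c *\<^sub>R b) f (c *\<^sub>R x + d))" if "b \<in> Basis" for b
    unfolding eq using Suc.IH[of "partial_deriv b f"] Suc.prems that by (intro cont_diff_mult) auto
  then show ?case by (rule cont_diff_SucI[OF D])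
qed

lemma cont_diff_bounded_linear:
  assumes "bounded_linear f" shows "cont_diff k f"
proof (cases k)
  case 0
  then show ?thesis using assms by (simp add: linear_continuous_on)
next
  case (Suc m)
  show ?thesis unfolding Suc
    by (rule cont_diff_SucI[where f' = "\<lambda>_. f"]) (use assms in \<open>auto simp: bounded_linear_imp_has_derivative\<close>)
qed

lemma smooth_const [simp]: "smooth (\<lambda>x. c)"
  by (simp add: smooth_def)

lemma smooth_add: "smooth f \<Longrightarrow> smooth g \<Longrightarrow> smooth (\<lambda>x. f x + g x)"
  by (simp add: smooth_def cont_diff_add)

lemma smooth_mult: "smooth f \<Longrightarrow> smooth g \<Longrightarrow> smooth (\<lambda>x. f x * g x)"
  by (simp add: smooth_def cont_diff_mult)

lemma smooth_diff: "smooth f \<Longrightarrow> smooth g \<Longrightarrow> smooth (\<lambda>x. f x - g x)"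
  using smooth_add[of f "\<lambda>x. -1 * g x"] smooth_mult[of "\<lambda>_. -1" g] by simp

lemma smooth_sum: "(\<And>i. i \<in> I \<Longrightarrow> smooth (f i)) \<Longrightarrow> smooth (\<lambda>x. \<Sum>i\<in>I. f i x)"
  by (induction I rule: infinite_finite_induct) (auto intro: smooth_add)

lemma smooth_compose: "smooth h \<Longrightarrow> smooth q \<Longrightarrow> smooth (\<lambda>x. (h :: real \<Rightarrow> real) (q x))"
  by (simp add: smooth_def cont_diff_compose)

lemma smooth_affine: "smooth f \<Longrightarrow> smooth (\<lambda>x. f (c *\<^sub>R x + d))"
  by (simp add: smooth_def cont_diff_affine)

lemma smooth_bounded_linear: "bounded_linear f \<Longrightarrow> smooth f"
  by (simp add: smooth_def cont_diff_bounded_linear)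

lemma smooth_continuous: "smooth f \<Longrightarrow> continuous_on A f"
  unfolding smooth_def using cont_diff_continuous by blast

lemma smooth_has_derivative: "smooth f \<Longrightarrow> (f has_derivative (\<lambda>h. partial_deriv h f x)) (at x)"
  unfolding smooth_def using cont_diff_Suc_has_derivative by blast

lemma smooth_partial_deriv: "smooth f \<Longrightarrow> b \<in> Basis \<Longrightarrow> smooth (partial_deriv b f)"
  unfolding smooth_def by (metis cont_diff.simps(2))

lemma partial_deriv_add:
  "smooth f \<Longrightarrow> smooth g \<Longrightarrow> partial_deriv b (\<lambda>x. f x + g x) x = partial_deriv b f x + partial_deriv b g x"
  by (rule partial_deriv_eq[OF has_derivative_add[OF smooth_has_derivative smooth_has_derivative]])

lemma partial_deriv_diff:
  "smooth f \<Longrightarrow> smooth g \<Longrightarrow> partial_deriv b (\<lambda>x. f x - g x) x = partial_deriv b f x - partial_deriv b g x"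
  by (rule partial_deriv_eq[OF has_derivative_diff[OF smooth_has_derivative smooth_has_derivative]])

lemma partial_deriv_mult:
  "smooth f \<Longrightarrow> smooth g \<Longrightarrow>
    partial_deriv b (\<lambda>x. f x * g x) x = f x * partial_deriv b g x + partial_deriv b f x * g x"
  by (rule partial_deriv_eq[OF has_derivative_mult[OF smooth_has_derivative smooth_has_derivative]])

lemma partial_deriv_eq_0:
  assumes "open S" "x \<in> S" "\<And>y. y \<in> S \<Longrightarrow> f y = 0"
  shows "partial_deriv b f x = 0"
proof -
  have "(f has_derivative (\<lambda>_. 0)) (at x)"
    by (rule has_derivative_transform_within_open[OF has_derivative_const[of 0] assms(1,2)])
      (use assms(3) in auto)
  from partial_deriv_eq[OF this] show ?thesis by simp
qed

text \<open>Second differences are symmetric in the two directions; divided by \<open>t * t\<close>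
  they tend to the mixed derivative in either order, by the mean value theorem and continuity of the
  second derivatives.\<close>

lemma partial_deriv_commute:
  fixes f :: "'a::euclidean_space \<Rightarrow> real"
  assumes f: "cont_diff 2 f" and b: "b \<in> Basis" and c: "c \<in> Basis"
  shows "partial_deriv b (partial_deriv c f) x = partial_deriv c (partial_deriv b f) x"
proof -
  have f1: "cont_diff (Suc 0) f" and f2: "\<And>b. b \<in> Basis \<Longrightarrow> cont_diff (Suc 0) (partial_deriv b f)"
    using f cont_diff_Suc_imp[of "Suc 0" f] by (auto simp: numeral_2_eq_2)
  have line: "((\<lambda>s. h (y + s *\<^sub>R d)) has_real_derivative partial_deriv d h (y + s *\<^sub>R d)) (at s)"
    if "cont_diff (Suc 0) h" for h :: "'a \<Rightarrow> real" and y d s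
  proof -
    have "((\<lambda>s. h (y + s *\<^sub>R d)) has_derivative (\<lambda>t. partial_deriv (t *\<^sub>R d) h (y + s *\<^sub>R d))) (at s)"
      by (rule has_derivative_compose[where g=h and f="\<lambda>s. y + s *\<^sub>R d",
        OF _ cont_diff_Suc_has_derivative[OF that]]) (auto intro!: derivative_eq_intros)
    moreover have "partial_deriv (t *\<^sub>R d) h z = partial_deriv d h z * t" for t z
      using partial_deriv_scaleR[OF that, of t d z] by simp
    ultimately show ?thesis by (simp add: has_field_derivative_def)
  qed
  define \<Delta> where "\<Delta> b c t = f (x + t *\<^sub>R b + t *\<^sub>R c) - f (x + t *\<^sub>R b) - f (x + t *\<^sub>R c) + f x" for b c t
  \<comment> \<open>The mean value theorem is used twice: along \<open>b\<close> for the increment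
    \<open>P\<close> of \<open>f\<close> in direction \<open>c\<close>, then along \<open>c\<close>
    for \<open>partial_deriv b f\<close>.\<close>
  have mvt: "\<exists>\<xi> \<eta>. 0 < \<xi> \<and> \<xi> < t \<and> 0 < \<eta> \<and> \<eta> < t \<and>
      \<Delta> b c t = t * t * partial_deriv c (partial_deriv b f) (x + \<xi> *\<^sub>R b + \<eta> *\<^sub>R c)"
    if t: "t > 0" and bc: "b \<in> Basis" "c \<in> Basis" for b c t
  proof -
    define P where "P s = f (x + t *\<^sub>R c + s *\<^sub>R b) - f (x + s *\<^sub>R b)" for s
    have "(P has_real_derivative
        partial_deriv b f (x + t *\<^sub>R c + s *\<^sub>R b) - partial_deriv b f (x + s *\<^sub>R b)) (at s)" for s
      unfolding P_def by (intro DERIV_diff line f1)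
    from MVT2[OF t this] obtain \<xi> where \<xi>: "0 < \<xi>" "\<xi> < t"
      "P t - P 0 = t * (partial_deriv b f (x + t *\<^sub>R c + \<xi> *\<^sub>R b) - partial_deriv b f (x + \<xi> *\<^sub>R b))"
      by auto
    have "((\<lambda>s. partial_deriv b f (x + \<xi> *\<^sub>R b + s *\<^sub>R c)) has_real_derivative
        partial_deriv c (partial_deriv b f) (x + \<xi> *\<^sub>R b + s *\<^sub>R c)) (at s)" for s
      by (intro line f2 bc)
    from MVT2[OF t this] obtain \<eta> where \<eta>: "0 < \<eta>" "\<eta> < t"
      "partial_deriv b f (x + \<xi> *\<^sub>R b + t *\<^sub>R c) - partial_deriv b f (x + \<xi> *\<^sub>R b) =
        t * partial_deriv c (partial_deriv b f) (x + \<xi> *\<^sub>R b + \<eta> *\<^sub>R c)"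
      by auto
    have "\<Delta> b c t = P t - P 0" by (simp add: \<Delta>_def P_def algebra_simps)
    then show ?thesis
      using \<xi> \<eta> by (intro exI[of _ \<xi>] exI[of _ \<eta>]) (simp add: algebra_simps)
  qed
  have lim: "((\<lambda>t. \<Delta> b c t / (t * t)) \<longlongrightarrow> partial_deriv c (partial_deriv b f) x) (at_right 0)"
    if bc: "b \<in> Basis" "c \<in> Basis" for b c
  proof (rule tendstoI)
    fix e :: real assume "e > 0"
    have "isCont (partial_deriv c (partial_deriv b f)) x"
      using f bc by (auto simp: numeral_2_eq_2 continuous_on_eq_continuous_at)
    then obtain d where d: "d > 0"
      "\<And>y. dist y x < d \<Longrightarrow> dist (partial_deriv c (partial_deriv b f) y) (partial_deriv c (partial_deriv b f) x) < e"
      using \<open>e > 0\<close> unfolding continuous_at_eps_delta by blast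
    have "dist (\<Delta> b c t / (t * t)) (partial_deriv c (partial_deriv b f) x) < e" if t: "0 < t" "t < d / 2" for t
    proof -
      obtain \<xi> \<eta> where \<xi>: "0 < \<xi>" "\<xi> < t" "0 < \<eta>" "\<eta> < t" and
        eq: "\<Delta> b c t = t * t * partial_deriv c (partial_deriv b f) (x + \<xi> *\<^sub>R b + \<eta> *\<^sub>R c)"
        using mvt[OF t(1) bc] by blast
      have "dist (x + \<xi> *\<^sub>R b + \<eta> *\<^sub>R c) x \<le> norm (\<xi> *\<^sub>R b) + norm (\<eta> *\<^sub>R c)"
        using norm_triangle_ineq[of "\<xi> *\<^sub>R b" "\<eta> *\<^sub>R c"] by (simp add: dist_norm add.assoc)
      also have "\<dots> < d" using \<xi> t bc by simp
      finally show ?thesis using d(2) eq t(1) by simp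
    qed
    then show "\<forall>\<^sub>F t in at_right 0. dist (\<Delta> b c t / (t * t)) (partial_deriv c (partial_deriv b f) x) < e"
      using d(1) by (auto simp: eventually_at_right_field intro!: exI[of _ "d/2"])
  qed
  have "\<Delta> c b = \<Delta> b c" by (auto simp: \<Delta>_def fun_eq_iff algebra_simps)
  then show ?thesis
    using tendsto_unique[OF _ lim[OF b c] lim[OF c b, unfolded \<open>\<Delta> c b = \<Delta> b c\<close>]] by simp
qed

section \<open>Convolution and cutoff functions\<close>

text \<open>The powers of \<open>1 / s\<close> are included so that the family is closed under
  differentiation: the derivative of \<open>exp_bump m\<close> is a combination of two members. The
  case \<open>m = 0\<close> is the standard smooth function that is flat at the origin.\<close>

definition exp_bump :: "nat \<Rightarrow> real \<Rightarrow> real" where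
  "exp_bump m s = (if s > 0 then (1 / s) ^ m * exp (- 1 / s) else 0)"

lemma exp_bump_has_derivative:
  "(exp_bump m has_real_derivative exp_bump (m + 2) s - m * exp_bump (m + 1) s) (at s)"
proof -
  consider "s < 0" | "s > 0" | "s = 0" by linarith
  then show ?thesis
  proof cases
    case 1
    have "((\<lambda>_. 0) has_real_derivative 0) (at s)" by simp
    then have "(exp_bump m has_real_derivative 0) (at s)"
      by (rule has_field_derivative_transform_within_open[where S="{..<0}"])
        (use 1 in \<open>auto simp: exp_bump_def\<close>)
    then show ?thesis using 1 by (simp add: exp_bump_def)
  next
    case 2
    define v where "v = 1 / s"
    have vs: "x / (s * s) = x * (v * v)" for x by (simp add: v_def)
    have v: "((\<lambda>s. 1 / s) has_real_derivative - (v * v)) (at s)"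
      using 2 by (auto intro!: derivative_eq_intros simp: v_def)
    have "((\<lambda>s. (1 / s) ^ m * exp (- (1 / s))) has_real_derivative
        v ^ m * (exp (- v) * (v * v)) + real m * (- (v * v) * v ^ (m - Suc 0)) * exp (- v)) (at s)"
      using 2 by (auto intro!: derivative_eq_intros v simp: v_def[symmetric] vs algebra_simps)
    moreover have "v ^ m * (exp (- v) * (v * v)) + real m * (- (v * v) * v ^ (m - Suc 0)) * exp (- v)
        = exp_bump (m + 2) s - m * exp_bump (m + 1) s"
      using 2 unfolding exp_bump_def minus_divide_left[symmetric] v_def[symmetric]
      by (cases m) (simp_all add: algebra_simps)
    ultimately have "((\<lambda>s. (1 / s) ^ m * exp (- 1 / s)) has_real_derivative
        exp_bump (m + 2) s - m * exp_bump (m + 1) s) (at s)"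
      by simp
    then show ?thesis
      by (rule has_field_derivative_transform_within_open[where S="{0<..}"])
        (use 2 in \<open>auto simp: exp_bump_def\<close>)
  next
    case 3
    \<comment> \<open>From the right the quotient is \<open>(1 / h) ^ Suc m * exp (- 1 / h)\<close>;
      with \<open>x = 1 / h\<close> this is a power of \<open>x\<close> divided by
      \<open>exp x\<close>.\<close>
    have "((\<lambda>h. (exp_bump m h - exp_bump m 0) / (h - 0)) \<longlongrightarrow> 0) (at_right 0)"
    proof -
      have "((\<lambda>x::real. x ^ Suc m / exp x) \<longlongrightarrow> 0) at_top"
        by (rule tendsto_power_div_exp_0)
      then have "((\<lambda>h::real. inverse h ^ Suc m / exp (inverse h)) \<longlongrightarrow> 0) (at_right 0)"
        by (rule filterlim_compose) (rule filterlim_inverse_at_top_right)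
      then show ?thesis
        by (rule Lim_transform_eventually)
          (auto simp: eventually_at_right_field exp_bump_def exp_minus field_simps intro!: exI[of _ 1])
    qed
    moreover have "((\<lambda>h. (exp_bump m h - exp_bump m 0) / (h - 0)) \<longlongrightarrow> 0) (at_left 0)"
      by (rule Lim_transform_eventually[OF tendsto_const])
        (auto simp: eventually_at_left_field exp_bump_def intro!: exI[of _ "-1"])
    ultimately have "((\<lambda>h. (exp_bump m h - exp_bump m 0) / (h - 0)) \<longlongrightarrow> 0) (at 0)"
      using filterlim_split_at by blast
    then show ?thesis using 3 by (simp add: has_field_derivative_iff exp_bump_def)
  qed
qed

lemma smooth_exp_bump: "smooth (exp_bump m)"
proof -
  have "cont_diff k (exp_bump m)" for k
  proof (induction k arbitrary: m)
    case 0
    show ?case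
      using exp_bump_has_derivative by (auto simp: continuous_on_eq_continuous_at intro: DERIV_isCont)
  next
    case (Suc k)
    have D: "(exp_bump m has_derivative (\<lambda>h. (exp_bump (m + 2) s + - real m * exp_bump (m + 1) s) * h)) (at s)" for s
      using exp_bump_has_derivative[of m s] by (simp add: has_field_derivative_def)
    show ?case
      using Suc.IH by (intro cont_diff_SucI[OF D] cont_diff_mult cont_diff_add cont_diff_const) auto
  qed
  then show ?thesis by (simp add: smooth_def)
qed

section \<open>Compactly supported functions and the vanishing integral of a derivative\<close>

lemma continuous_compact_support_integrable:
  fixes f :: "'a::euclidean_space \<Rightarrow> real"
  assumes "continuous_on UNIV f" "compact K" "\<And>x. x \<notin> K \<Longrightarrow> f x = 0"
  shows "integrable lborel f"
proof -
  have "integrable lborel (\<lambda>x. indicator K x *\<^sub>R f x)"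
    using assms by (intro borel_integrable_compact) (auto intro: continuous_on_subset)
  also have "(\<lambda>x. indicator K x *\<^sub>R f x) = f"
    using assms(3) by (auto simp: indicator_def fun_eq_iff)
  finally show ?thesis .
qed

lemma continuous_compact_support_bounded:
  fixes f :: "'a::euclidean_space \<Rightarrow> real"
  assumes "continuous_on UNIV f" "compact K" "\<And>x. x \<notin> K \<Longrightarrow> f x = 0"
  obtains B where "B > 0" "\<And>x. \<bar>f x\<bar> \<le> B"
proof -
  have "bounded (f ` K)"
    using assms by (intro compact_imp_bounded compact_continuous_image) (auto intro: continuous_on_subset)
  then obtain B where "\<forall>y\<in>f ` K. norm y \<le> B" by (auto simp: bounded_iff)
  then have "\<bar>f x\<bar> \<le> max B 1" for x
    using assms(3)[of x] by (cases "x \<in> K") (auto simp: le_max_iff_disj)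
  then show ?thesis by (intro that[of "max B 1"]) auto
qed

text \<open>The restriction \<open>\<bar>c\<bar> = 1\<close> keeps the Jacobian factor equal to 1;
  \<open>c = 1\<close> gives translations, and \<open>c = -1\<close> gives the substitution of
  \<open>z - x\<close> for \<open>x\<close> in convolutions.\<close>

lemma lborel_integral_affine:
  fixes f :: "'a::euclidean_space \<Rightarrow> real"
  assumes "\<bar>c\<bar> = 1" "f \<in> borel_measurable borel"
  shows "(\<integral>x. f (t + c *\<^sub>R x) \<partial>lborel) = (\<integral>x. f x \<partial>lborel)"
    and "integrable lborel (\<lambda>x. f (t + c *\<^sub>R x)) \<longleftrightarrow> integrable lborel f"
proof -
  have *: "lborel = distr lborel borel (\<lambda>x::'a. t + c *\<^sub>R x)"
    using lborel_affine[of c t] assms(1) by (auto simp: density_1)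
  show "(\<integral>x. f (t + c *\<^sub>R x) \<partial>lborel) = (\<integral>x. f x \<partial>lborel)"
    using assms(2) by (subst (2) *, subst integral_distr) auto
  show "integrable lborel (\<lambda>x. f (t + c *\<^sub>R x)) \<longleftrightarrow> integrable lborel f"
    using assms(2) by (subst (2) *, subst integrable_distr_eq) auto
qed

lemma cont_diff_1D:
  assumes "cont_diff 1 f"
  shows "(f has_derivative (\<lambda>h. partial_deriv h f x)) (at x)"
    and "b \<in> Basis \<Longrightarrow> continuous_on A (partial_deriv b f)"
    and "((\<lambda>s. f (y + s *\<^sub>R d)) has_real_derivative partial_deriv d f (y + s *\<^sub>R d)) (at s)"
    and "partial_deriv d f x = (\<Sum>b\<in>Basis. (d \<bullet> b) * partial_deriv b f x)"
proof -
  have f: "cont_diff (Suc 0) f" using assms by simp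
  show D: "(f has_derivative (\<lambda>h. partial_deriv h f x)) (at x)" for x
    by (rule cont_diff_Suc_has_derivative[OF f])
  show "b \<in> Basis \<Longrightarrow> continuous_on A (partial_deriv b f)"
    using f by (auto intro: continuous_on_subset)
  have "((\<lambda>s. f (y + s *\<^sub>R d)) has_derivative (\<lambda>t. partial_deriv (t *\<^sub>R d) f (y + s *\<^sub>R d))) (at s)"
    by (rule has_derivative_compose[where g=f and f="\<lambda>s. y + s *\<^sub>R d", OF _ D])
      (auto intro!: derivative_eq_intros)
  then show "((\<lambda>s. f (y + s *\<^sub>R d)) has_real_derivative partial_deriv d f (y + s *\<^sub>R d)) (at s)"
    by (simp add: has_field_derivative_def partial_deriv_scaleR[OF f] mult.commute[of _ "partial_deriv d f _"])
  have lin: "linear (\<lambda>h. partial_deriv h f x)" using D by (rule has_derivative_linear)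
  have "partial_deriv d f x = partial_deriv (\<Sum>b\<in>Basis. (d \<bullet> b) *\<^sub>R b) f x"
    by (simp add: euclidean_representation)
  also have "\<dots> = (\<Sum>b\<in>Basis. (d \<bullet> b) * partial_deriv b f x)"
    using linear_sum[OF lin, of "\<lambda>b. (d \<bullet> b) *\<^sub>R b" Basis] by (simp add: partial_deriv_scaleR[OF f])
  finally show "partial_deriv d f x = (\<Sum>b\<in>Basis. (d \<bullet> b) * partial_deriv b f x)" .
qed

lemma partial_deriv_outside_support:
  assumes "compact K" "\<And>x. x \<notin> K \<Longrightarrow> f x = 0" "x \<notin> K"
  shows "partial_deriv b f x = 0"
  by (rule partial_deriv_eq_0[of "- K"]) (use assms compact_imp_closed in auto)

text \<open>Translation invariance makes the integral of each difference quotient of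
  \<open>f\<close> vanish, and the quotients converge to the partial derivative under a common
  integrable bound.\<close>

lemma integral_partial_deriv_eq_0:
  fixes f :: "'a::euclidean_space \<Rightarrow> real"
  assumes f: "cont_diff 1 f" and K: "compact K" "\<And>x. x \<notin> K \<Longrightarrow> f x = 0" and b: "b \<in> Basis"
  shows "(\<integral>x. partial_deriv b f x \<partial>lborel) = 0"
proof -
  define t where "t n = 1 / real (Suc n)" for n
  have t: "0 < t n" "t n \<le> 1" for n by (auto simp: t_def)
  have cont: "continuous_on UNIV f" by (rule cont_diff_continuous[OF f])
  have meas [measurable]: "f \<in> borel_measurable borel"
    using cont by (rule borel_measurable_continuous_onI)
  have int: "integrable lborel f"
    using cont K by (rule continuous_compact_support_integrable)
  have out: "partial_deriv b f x = 0" if "x \<notin> K" for x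
    using K that by (intro partial_deriv_outside_support)
  obtain B where B: "B > 0" "\<And>x. \<bar>partial_deriv b f x\<bar> \<le> B"
    using continuous_compact_support_bounded[OF cont_diff_1D(2)[OF f b] K(1) out] by blast
  obtain R where R: "\<And>x. x \<in> K \<Longrightarrow> norm x \<le> R"
    using K(1) compact_imp_bounded bounded_iff by metis
  define q where "q n x = (f (x + t n *\<^sub>R b) - f x) / t n" for n x
  have mvt: "\<exists>s. 0 < s \<and> s < t n \<and> q n x = partial_deriv b f (x + s *\<^sub>R b)" for n x
    using MVT2[OF t(1) cont_diff_1D(3)[OF f], of n x b] t(1)[of n] by (auto simp: q_def field_simps)
  have "(\<lambda>n. \<integral>x. q n x \<partial>lborel) \<longlonglongrightarrow> (\<integral>x. partial_deriv b f x \<partial>lborel)"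
  proof (rule integral_dominated_convergence[where w = "\<lambda>x. indicator (cball 0 (R + 1)) x *\<^sub>R B"])
    show "partial_deriv b f \<in> borel_measurable lborel"
      using cont_diff_1D(2)[OF f b] by (simp add: borel_measurable_continuous_onI)
    show "q n \<in> borel_measurable lborel" for n
      unfolding q_def by measurable
    show "integrable lborel (\<lambda>x::'a. indicator (cball 0 (R + 1)) x *\<^sub>R B)"
      by (intro borel_integrable_compact) auto
    show "AE x in lborel. (\<lambda>n. q n x) \<longlonglongrightarrow> partial_deriv b f x"
    proof (rule AE_I2)
      fix x
      have "((\<lambda>s. f (x + s *\<^sub>R b)) has_real_derivative partial_deriv b f x) (at 0)"
        using cont_diff_1D(3)[OF f, of x b 0] by simp
      then have "((\<lambda>h. (f (x + h *\<^sub>R b) - f x) / h) \<longlongrightarrow> partial_deriv b f x) (at 0)"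
        by (simp add: DERIV_def)
      moreover have "filterlim t (at 0) sequentially"
        unfolding filterlim_at using t LIMSEQ_inverse_real_of_nat
        by (auto simp: t_def[abs_def] inverse_eq_divide less_imp_neq)
      ultimately show "(\<lambda>n. q n x) \<longlonglongrightarrow> partial_deriv b f x"
        unfolding q_def by (rule filterlim_compose)
    qed
    \<comment> \<open>By the mean value theorem a quotient is a derivative at a point at distance at
      most 1 from \<open>x\<close>, since \<open>t n \<le> 1\<close>; hence it is bounded by
      \<open>B\<close> and vanishes off the ball of radius \<open>R + 1\<close>.\<close>
    show "AE x in lborel. norm (q n x) \<le> indicator (cball 0 (R + 1)) x *\<^sub>R B" for n
    proof (rule AE_I2)
      fix x
      obtain s where s: "0 < s" "s < t n" "q n x = partial_deriv b f (x + s *\<^sub>R b)" using mvt by blast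
      show "norm (q n x) \<le> indicator (cball 0 (R + 1)) x *\<^sub>R B"
      proof (cases "x \<in> cball 0 (R + 1)")
        case False
        have "norm (s *\<^sub>R b) \<le> 1" using s t(2)[of n] b by simp
        then have "norm (x + s *\<^sub>R b) > R"
          using False norm_triangle_ineq4[of "x + s *\<^sub>R b" "s *\<^sub>R b"] by simp
        then have "x + s *\<^sub>R b \<notin> K" using R by force
        then show ?thesis using False s(3) out by simp
      qed (use B s in simp)
    qed
  qed
  moreover have "(\<integral>x. q n x \<partial>lborel) = 0" for n
  proof -
    have "integrable lborel (\<lambda>x. f (x + t n *\<^sub>R b))" "(\<integral>x. f (x + t n *\<^sub>R b) \<partial>lborel) = (\<integral>x. f x \<partial>lborel)"
      using lborel_integral_affine[OF _ meas, of 1 "t n *\<^sub>R b"] int by (simp_all add: add.commute)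
    then show ?thesis unfolding q_def using int by simp
  qed
  ultimately show ?thesis by (simp add: LIMSEQ_const_iff)
qed

section \<open>Convolution and differentiation under the integral sign\<close>

definition convol :: "('a::euclidean_space \<Rightarrow> real) \<Rightarrow> ('a \<Rightarrow> real) \<Rightarrow> 'a \<Rightarrow> real" where
  "convol g k z = (\<integral>x. g x * k (z - x) \<partial>lborel)"

lemma integrable_mult_bounded:
  fixes g h :: "'a::euclidean_space \<Rightarrow> real"
  assumes "integrable lborel g" "h \<in> borel_measurable borel" "\<And>x. \<bar>h x\<bar> \<le> B"
  shows "integrable lborel (\<lambda>x. g x * h x)"
proof (rule Bochner_Integration.integrable_bound[where f = "\<lambda>x. B * g x"])
  have "B \<ge> 0" using assms(3)[of undefined] by linarith
  then show "AE x in lborel. norm (g x * h x) \<le> norm (B * g x)"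
    using assms(3) by (auto simp: abs_mult mult.commute[of B] intro!: mult_left_mono)
  have [measurable]: "g \<in> borel_measurable borel" using assms(1) by auto
  show "(\<lambda>x. g x * h x) \<in> borel_measurable lborel" using assms(2) by simp
qed (use assms(1) in simp)

lemma convol_integrand_integrable:
  fixes g k :: "'a::euclidean_space \<Rightarrow> real"
  assumes g: "integrable lborel g"
    and k: "continuous_on UNIV k" "compact K" "\<And>x. x \<notin> K \<Longrightarrow> k x = 0"
  shows "integrable lborel (\<lambda>x. g x * k (z - x))"
proof -
  obtain B where "\<And>x. \<bar>k x\<bar> \<le> B" using continuous_compact_support_bounded[OF k] by metis
  moreover have "continuous_on UNIV (\<lambda>x. k (z - x))"
    by (rule continuous_on_compose2[OF k(1)]) (auto intro!: continuous_intros)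
  ultimately show ?thesis
    using g by (intro integrable_mult_bounded) (auto intro: borel_measurable_continuous_onI)
qed

lemma continuous_compact_support_uniform:
  fixes k :: "'a::euclidean_space \<Rightarrow> real"
  assumes k: "continuous_on UNIV k" "compact K" "\<And>x. x \<notin> K \<Longrightarrow> k x = 0" and e: "e > 0"
  obtains d where "d > 0" "\<And>x y. dist x y < d \<Longrightarrow> \<bar>k x - k y\<bar> < e"
proof -
  obtain R where R: "\<And>x. x \<in> K \<Longrightarrow> norm x \<le> R"
    using k(2) compact_imp_bounded bounded_iff by metis
  have "uniformly_continuous_on (cball 0 (R + 1)) k"
    using k(1) by (intro compact_uniformly_continuous) (auto intro: continuous_on_subset)
  then obtain d where d: "d > 0"
    "\<And>x y. x \<in> cball 0 (R + 1) \<Longrightarrow> y \<in> cball 0 (R + 1) \<Longrightarrow> dist x y < d \<Longrightarrow> dist (k x) (k y) < e"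
    using e unfolding uniformly_continuous_on_def by (metis dist_commute)
  have "\<bar>k x - k y\<bar> < e" if "dist x y < min d 1" for x y
  proof (cases "x \<in> cball 0 (R + 1) \<and> y \<in> cball 0 (R + 1)")
    case True
    then show ?thesis using d(2)[of x y] that by (simp add: dist_real_def)
  next
    case False
    have "\<bar>norm x - norm y\<bar> < 1" using that norm_triangle_ineq3[of x y] by (simp add: dist_norm)
    then have "norm x > R" "norm y > R" using False by auto
    then have "x \<notin> K" "y \<notin> K" using R by force+
    then show ?thesis using e k(3) by simp
  qed
  then show ?thesis using d(1) by (intro that[of "min d 1"]) auto
qed

lemma convol_continuous:
  fixes g k :: "'a::euclidean_space \<Rightarrow> real"
  assumes g: "integrable lborel g"
    and k: "continuous_on UNIV k" "compact K" "\<And>x. x \<notin> K \<Longrightarrow> k x = 0"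
  shows "continuous_on UNIV (convol g k)"
  unfolding continuous_on_iff
proof (intro ballI allI impI)
  fix x :: 'a and e :: real assume "e > 0"
  \<comment> \<open>The summand 1 keeps \<open>N\<close> positive when \<open>g\<close> vanishes, so
    that \<open>e / N\<close> is a legitimate tolerance; the same device recurs below.\<close>
  define N where "N = (\<integral>x. \<bar>g x\<bar> \<partial>lborel) + 1"
  have N: "N > 0" unfolding N_def by (intro add_nonneg_pos integral_nonneg) auto
  obtain d where d: "d > 0" "\<And>x y. dist x y < d \<Longrightarrow> \<bar>k x - k y\<bar> < e / N"
    using continuous_compact_support_uniform[OF k, of "e / N"] \<open>e > 0\<close> N by auto
  have "dist (convol g k y) (convol g k x) < e" if "dist y x < d" for y
  proof -
    have "\<bar>convol g k y - convol g k x\<bar> = \<bar>\<integral>z. g z * k (y - z) - g z * k (x - z) \<partial>lborel\<bar>"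
      unfolding convol_def
      by (subst Bochner_Integration.integral_diff) (auto intro!: convol_integrand_integrable[OF g k])
    also have "\<dots> \<le> (\<integral>z. \<bar>g z\<bar> * (e / N) \<partial>lborel)"
    proof (intro integral_abs_bound[THEN order_trans] integral_mono)
      show "integrable lborel (\<lambda>z. \<bar>g z * k (y - z) - g z * k (x - z)\<bar>)"
        by (intro integrable_abs Bochner_Integration.integrable_diff convol_integrand_integrable[OF g k])
      show "\<bar>g z * k (y - z) - g z * k (x - z)\<bar> \<le> \<bar>g z\<bar> * (e / N)" for z
        using mult_left_mono[OF less_imp_le[OF d(2)[of "y - z" "x - z"]], of "\<bar>g z\<bar>"] that
        by (simp add: dist_norm abs_mult right_diff_distrib[symmetric])
    qed (use g in auto)
    also have "\<dots> = (N - 1) * (e / N)" by (simp add: N_def)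
    also have "\<dots> < e" using N \<open>e > 0\<close> by (simp add: field_simps)
    finally show ?thesis by (simp add: dist_real_def)
  qed
  then show "\<exists>d>0. \<forall>x'\<in>UNIV. dist x' x < d \<longrightarrow> dist (convol g k x') (convol g k x) < e"
    using d(1) by auto
qed

text \<open>All derivatives fall on the kernel. The first-order Taylor remainder of \<open>k\<close>
  is bounded uniformly in the base point, because its partial derivatives are uniformly continuous,
  and this bound is integrated against \<open>g\<close>.\<close>

lemma convol_has_derivative:
  fixes g k :: "'a::euclidean_space \<Rightarrow> real"
  assumes g: "integrable lborel g"
    and k: "cont_diff 1 k" "compact K" "\<And>x. x \<notin> K \<Longrightarrow> k x = 0"
  shows "(convol g k has_derivative (\<lambda>h. convol g (partial_deriv h k) z)) (at z)"
proof -
  have kc: "continuous_on UNIV k" by (rule cont_diff_continuous[OF k(1)])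
  have out: "partial_deriv b k x = 0" if "x \<notin> K" for x b
    using k that by (intro partial_deriv_outside_support)
  have cont: "continuous_on UNIV (partial_deriv h k)" for h
    using cont_diff_1D(2)[OF k(1)] by (subst cont_diff_1D(4)[OF k(1), abs_def]) (auto intro!: continuous_intros)
  note ii = convol_integrand_integrable[OF g _ k(2)]
  define N where "N = (\<integral>x. \<bar>g x\<bar> \<partial>lborel) + 1"
  have N: "N > 0" unfolding N_def by (intro add_nonneg_pos integral_nonneg) auto
  have lin: "linear (\<lambda>h. convol g (partial_deriv h k) z)"
  proof (rule linearI)
    show "convol g (partial_deriv (h1 + h2) k) z = convol g (partial_deriv h1 k) z + convol g (partial_deriv h2 k) z"
      for h1 h2
    proof -
      have "partial_deriv (h1 + h2) k x = partial_deriv h1 k x + partial_deriv h2 k x" for x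
        using linear_add[OF has_derivative_linear[OF cont_diff_1D(1)[OF k(1), of x]]] by simp
      then show ?thesis
        unfolding convol_def using ii[OF cont out] by (simp add: distrib_left)
    qed
    show "convol g (partial_deriv (r *\<^sub>R h) k) z = r *\<^sub>R convol g (partial_deriv h k) z" for r h
    proof -
      have "partial_deriv (r *\<^sub>R h) k x = r * partial_deriv h k x" for x
        using linear_cmul[OF has_derivative_linear[OF cont_diff_1D(1)[OF k(1), of x]]] by simp
      then show ?thesis
        unfolding convol_def by (simp add: mult.left_commute)
    qed
  qed
  show ?thesis
    unfolding has_derivative_at_alt
  proof (intro conjI allI impI)
    show "bounded_linear (\<lambda>h. convol g (partial_deriv h k) z)"
      using lin by (rule linear_conv_bounded_linear[THEN iffD1])
    fix e :: real assume e: "e > 0"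
    \<comment> \<open>Each of the \<open>DIM('a)\<close> partial derivatives may vary by
      \<open>e / M\<close>, which adds up to \<open>e / N\<close> in the remainder.\<close>
    define M where "M = real DIM('a) * N"
    have M: "M > 0" using N by (simp add: M_def)
    have "\<exists>d>0. \<forall>x y. dist x y < d \<longrightarrow> \<bar>partial_deriv b k x - partial_deriv b k y\<bar> < e / M" if "b \<in> Basis" for b
      using continuous_compact_support_uniform[OF cont k(2) out, of "e / M"] e M
      by (metis divide_pos_pos)
    then obtain \<delta> where \<delta>: "\<And>b. b \<in> Basis \<Longrightarrow> \<delta> b > 0"
      "\<And>b x y. b \<in> Basis \<Longrightarrow> dist x y < \<delta> b \<Longrightarrow> \<bar>partial_deriv b k x - partial_deriv b k y\<bar> < e / M"
      by metis
    define d where "d = Min (\<delta> ` Basis)"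
    have d: "d > 0" "\<And>b. b \<in> Basis \<Longrightarrow> d \<le> \<delta> b" using \<delta>(1) by (auto simp: d_def)
    have est: "\<bar>k y - k x - partial_deriv (y - x) k x\<bar> \<le> (e / N) * norm (y - x)" if "dist x y < d" for x y
    proof -
      obtain s where s: "0 < s" "s < 1" "k y - k x = partial_deriv (y - x) k (x + s *\<^sub>R (y - x))"
        using MVT2[of 0 1, OF _ cont_diff_1D(3)[OF k(1), of x "y - x"]] by auto
      have "dist (x + s *\<^sub>R (y - x)) x < d"
        using s that by (simp add: dist_norm norm_minus_commute)
          (metis mult_left_le_one_le norm_ge_zero order.strict_trans1 less_imp_le)
      then have "\<bar>partial_deriv b k (x + s *\<^sub>R (y - x)) - partial_deriv b k x\<bar> \<le> e / M" if "b \<in> Basis" for b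
        using \<delta>(2)[OF that] d(2)[OF that] by (meson less_le_trans less_imp_le)
      then have "(\<Sum>b\<in>Basis. \<bar>(y - x) \<bullet> b\<bar> * \<bar>partial_deriv b k (x + s *\<^sub>R (y - x)) - partial_deriv b k x\<bar>)
          \<le> (\<Sum>b::'a\<in>Basis. norm (y - x) * (e / M))"
        by (intro sum_mono mult_mono Basis_le_norm) auto
      also have "\<dots> = (e / N) * norm (y - x)" using N by (simp add: M_def field_simps)
      finally show ?thesis
        unfolding s(3) cont_diff_1D(4)[OF k(1), of "y - x"] sum_subtractf[symmetric] right_diff_distrib[symmetric]
        by (intro sum_abs[THEN order_trans]) (simp add: abs_mult)
    qed
    have "norm (convol g k y - convol g k z - convol g (partial_deriv (y - z) k) z) \<le> e * norm (y - z)"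
      if "norm (y - z) < d" for y
    proof -
      let ?r = "\<lambda>x. g x * k (y - x) - g x * k (z - x) - g x * partial_deriv (y - z) k (z - x)"
      have r: "integrable lborel ?r"
        by (intro Bochner_Integration.integrable_diff ii[OF kc k(3)] ii[OF cont out])
      have "convol g k y - convol g k z - convol g (partial_deriv (y - z) k) z = (\<integral>x. ?r x \<partial>lborel)"
        unfolding convol_def using ii[OF kc k(3)] ii[OF cont out]
        by (simp add: Bochner_Integration.integral_diff)
      also have "norm \<dots> \<le> (\<integral>x. \<bar>g x\<bar> * ((e / N) * norm (y - z)) \<partial>lborel)"
      proof (subst real_norm_def, intro integral_abs_bound[THEN order_trans] integral_mono)
        fix x
        have "?r x = g x * (k (y - x) - k (z - x) - partial_deriv (y - z) k (z - x))"
          by (simp add: algebra_simps)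
        moreover have "\<bar>k (y - x) - k (z - x) - partial_deriv (y - z) k (z - x)\<bar> \<le> (e / N) * norm (y - z)"
          using est[of "z - x" "y - x"] that by (simp add: dist_norm norm_minus_commute)
        ultimately show "\<bar>?r x\<bar> \<le> \<bar>g x\<bar> * ((e / N) * norm (y - z))"
          using mult_left_mono[of _ "(e / N) * norm (y - z)" "\<bar>g x\<bar>"] by (simp only: abs_mult abs_ge_zero)
      qed (use g r in auto)
      also have "\<dots> = (N - 1) * ((e / N) * norm (y - z))" by (simp add: N_def)
      also have "\<dots> \<le> e * norm (y - z)" using N e by (simp add: field_simps)
      finally show ?thesis .
    qed
    then show "\<exists>d>0. \<forall>y. norm (y - z) < d \<longrightarrow>
        norm (convol g k y - convol g k z - convol g (partial_deriv (y - z) k) z) \<le> e * norm (y - z)"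
      using d(1) by blast
  qed
qed

lemma cont_diff_convol:
  fixes g k :: "'a::euclidean_space \<Rightarrow> real"
  assumes g: "integrable lborel g"
    and "cont_diff n k" and K: "compact K" "\<And>x. x \<notin> K \<Longrightarrow> k x = 0"
  shows "cont_diff n (convol g k)"
  using assms(2) K(2)
proof (induction n arbitrary: k)
  case 0
  then show ?case using convol_continuous[OF g _ K(1)] by simp
next
  case (Suc n)
  have "cont_diff 1 k" using Suc.prems(1) by (rule cont_diff_le) simp
  moreover have "cont_diff n (convol g (partial_deriv b k))" if "b \<in> Basis" for b
    using Suc.prems that K(1) by (intro Suc.IH) (auto intro: partial_deriv_outside_support)
  ultimately show ?case
    using convol_has_derivative[OF g _ K(1)] Suc.prems(2) by (intro cont_diff_SucI) auto
qed

lemma smooth_convol: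
  assumes "integrable lborel g" "smooth k" "compact K" "\<And>x. x \<notin> K \<Longrightarrow> k x = 0"
  shows "smooth (convol g k)"
  using assms unfolding smooth_def by (blast intro: cont_diff_convol)

text \<open>The centre is free because near the boundary kernels sit away from the origin, so that
  convolution pushes supports into the domain; the ball is closed so that it serves as a compact
  support for \<open>k\<close>.\<close>

definition mollifier :: "'a::euclidean_space \<Rightarrow> real \<Rightarrow> ('a \<Rightarrow> real) \<Rightarrow> bool" where
  "mollifier c r k \<longleftrightarrow>
     smooth k \<and> (\<forall>x. k x \<ge> 0) \<and> (\<forall>x. x \<notin> cball c r \<longrightarrow> k x = 0) \<and> (\<integral>x. k x \<partial>lborel) = 1"

lemma mollifier_exists:
  fixes c :: "'a::euclidean_space"
  assumes r: "r > 0"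
  obtains k where "mollifier c r k"
proof -
  \<comment> \<open>\<open>exp_bump 0\<close> of a quantity that is positive exactly on the open
    ball; the result is divided by its integral at the end.\<close>
  define k where "k x = exp_bump 0 (r\<^sup>2 - (x - c) \<bullet> (x - c))" for x
  have "smooth (\<lambda>x::'a. r\<^sup>2 - (\<Sum>b\<in>Basis. (x \<bullet> b - c \<bullet> b) * (x \<bullet> b - c \<bullet> b)))"
    by (intro smooth_diff smooth_sum smooth_mult smooth_const smooth_bounded_linear bounded_linear_inner_left)
  then have q: "smooth (\<lambda>x::'a. r\<^sup>2 - (x - c) \<bullet> (x - c))"
    by (subst euclidean_inner) (simp add: inner_diff_left)
  have k: "smooth k" unfolding k_def by (rule smooth_compose[OF smooth_exp_bump q])
  have pos: "k x > 0" if "x \<in> ball c r" for x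
  proof -
    have "(norm (x - c))\<^sup>2 < r\<^sup>2"
      using that by (intro power_strict_mono) (auto simp: dist_norm norm_minus_commute)
    then show ?thesis by (simp add: k_def exp_bump_def power2_norm_eq_inner)
  qed
  have out: "k x = 0" if "x \<notin> cball c r" for x
  proof -
    have "r\<^sup>2 < (norm (x - c))\<^sup>2"
      using that r by (intro power_strict_mono) (auto simp: dist_norm norm_minus_commute)
    then show ?thesis by (simp add: k_def exp_bump_def power2_norm_eq_inner)
  qed
  have nn: "k x \<ge> 0" for x by (simp add: k_def exp_bump_def)
  have int: "integrable lborel k"
    using smooth_continuous[OF k] out by (intro continuous_compact_support_integrable[of _ "cball c r"]) auto
  have "(\<integral>x. k x \<partial>lborel) \<noteq> 0"
  proof
    assume "(\<integral>x. k x \<partial>lborel) = 0"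
    then have "AE x in lborel. k x = 0"
      using integral_nonneg_eq_0_iff_AE[OF int] nn by simp
    then have "AE x in lborel. x \<notin> ball c r"
      using pos by (auto elim!: eventually_mono) (metis less_irrefl)
    then have "emeasure lborel (ball c r) = 0"
      by (subst (asm) AE_iff_measurable[OF _ refl]) (auto simp: ball_def)
    then show False using r by (simp add: emeasure_ball less_imp_neq[OF unit_ball_vol_pos, symmetric])
  qed
  moreover have "(\<integral>x. k x \<partial>lborel) \<ge> 0" using nn by simp
  ultimately have "mollifier c r (\<lambda>x. (1 / (\<integral>x. k x \<partial>lborel)) * k x)"
    unfolding mollifier_def using nn out
    by (intro conjI smooth_mult[OF smooth_const k]) auto
  then show ?thesis using that by blast
qed

text \<open>The indicator of a closed neighbourhood \<open>M\<close> of \<open>K\<close> is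
  mollified. Thickening by \<open>r\<close> from \<open>K\<close> to \<open>M\<close> gives the
  value 1 on \<open>K\<close>; thickening again from \<open>M\<close> to \<open>L\<close> makes room
  for the support.\<close>

lemma smooth_cutoff_exists:
  fixes K U :: "'a::euclidean_space set"
  assumes K: "compact K" and U: "open U" "K \<subseteq> U"
  obtains \<eta> L where "smooth \<eta>" "compact L" "L \<subseteq> U" "\<And>x. x \<notin> L \<Longrightarrow> \<eta> x = 0"
    "\<And>x. x \<in> K \<Longrightarrow> \<eta> x = 1" "\<And>x. 0 \<le> \<eta> x" "\<And>x. \<eta> x \<le> 1"
proof -
  obtain d where d: "d > 0" "(\<Union>x\<in>K. cball x d) \<subseteq> U"
    using compact_subset_open_imp_cball_epsilon_subset[OF K U] by blast
  \<comment> \<open>Two thickenings by \<open>r\<close> must stay within distance \<open>d\<close>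
    of \<open>K\<close>.\<close>
  define r where "r = d / 3"
  have r: "r > 0" using d by (simp add: r_def)
  obtain k :: "'a \<Rightarrow> real" where k: "mollifier 0 r k" using mollifier_exists[OF r] by blast
  have ko: "k x = 0" if "x \<notin> cball 0 r" for x using k that by (auto simp: mollifier_def)
  have kc: "continuous_on UNIV k" and kn: "\<And>x. k x \<ge> 0" and k1: "(\<integral>x. k x \<partial>lborel) = 1"
    using k smooth_continuous by (auto simp: mollifier_def)
  have km: "k \<in> borel_measurable borel" using kc by (rule borel_measurable_continuous_onI)
  have ki: "integrable lborel k"
    using kc ko by (intro continuous_compact_support_integrable[of _ "cball 0 r"]) auto
  have k': "integrable lborel (\<lambda>x. k (z - x))" "(\<integral>x. k (z - x) \<partial>lborel) = 1" for z
    using lborel_integral_affine[OF _ km, of "-1" z] ki k1 by simp_all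
  define M where "M = {x + y | x y. x \<in> K \<and> y \<in> cball 0 r}"
  define L where "L = {x + y | x y. x \<in> M \<and> y \<in> cball 0 r}"
  have M: "compact M" unfolding M_def using K by (intro compact_sums) auto
  have L: "compact L" unfolding L_def using M by (intro compact_sums) auto
  define \<eta> where "\<eta> = convol (indicator M) k"
  have [measurable]: "M \<in> sets borel" using M by (simp add: borel_closed compact_imp_closed)
  have Mi: "integrable lborel (indicator M :: 'a \<Rightarrow> real)"
    using emeasure_compact_finite[OF M] by (simp add: integrable_indicator_iff)
  have "smooth \<eta>" unfolding \<eta>_def
    using k by (intro smooth_convol[OF Mi _ compact_cball[of 0 r]] ko) (auto simp: mollifier_def)
  moreover have "L \<subseteq> U"
  proof
    fix z assume "z \<in> L"
    then obtain x y1 y2 where "x \<in> K" "norm y1 \<le> r" "norm y2 \<le> r" "z = x + y1 + y2"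
      by (auto simp: L_def M_def)
    moreover have "norm (y1 + y2) \<le> d"
      using norm_triangle_ineq[of y1 y2] calculation d(1) by (simp add: r_def)
    moreover have "dist x z = norm (y1 + y2)"
      unfolding dist_commute[of x z] using calculation by (simp add: dist_norm add.assoc)
    ultimately have "z \<in> cball x d" by simp
    then show "z \<in> U" using d(2) \<open>x \<in> K\<close> by blast
  qed
  moreover have "\<eta> z = 0" if "z \<notin> L" for z
  proof -
    have "indicator M x * k (z - x) = 0" for x
    proof (cases "x \<in> M")
      case True
      then have "z - x \<notin> cball 0 r" using that by (force simp: L_def)
      then show ?thesis using ko by simp
    qed simp
    then show ?thesis by (simp only: \<eta>_def convol_def Bochner_Integration.integral_zero)
  qed
  moreover have "\<eta> z = 1" if "z \<in> K" for z
  proof -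
    have "indicator M x * k (z - x) = k (z - x)" for x
    proof (cases "x \<in> M")
      case False
      have "z - x \<notin> cball 0 r"
      proof
        assume "z - x \<in> cball 0 r"
        then have "x = z + (x - z)" "x - z \<in> cball 0 r" by (auto simp: norm_minus_commute)
        then have "x \<in> M" unfolding M_def using that by blast
        then show False using False by simp
      qed
      then show ?thesis using ko False by simp
    qed simp
    then show ?thesis by (simp only: \<eta>_def convol_def k'(2))
  qed
  moreover have "0 \<le> \<eta> z" for z unfolding \<eta>_def convol_def using kn by simp
  moreover have "\<eta> z \<le> 1" for z
  proof -
    have "\<eta> z \<le> (\<integral>x. k (z - x) \<partial>lborel)" unfolding \<eta>_def convol_def
      using kn k'(1) by (intro integral_mono convol_integrand_integrable[OF Mi kc compact_cball[of 0 r] ko])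
        (auto simp: indicator_def)
    then show ?thesis using k'(2) by simp
  qed
  ultimately show ?thesis using L that by blast
qed

section \<open>Square integrable functions\<close>

text \<open>Borel measurable functions on the whole space take the place of \<open>L2_on D\<close>,
  so that products, translations and Fubini are available for \<open>lborel\<close>; functions on
  \<open>D\<close> enter after extension by 0.\<close>

definition sq_integrable :: "('a::euclidean_space \<Rightarrow> real) \<Rightarrow> bool" where
  "sq_integrable f \<longleftrightarrow> f \<in> borel_measurable borel \<and> integrable lborel (\<lambda>x. (f x)\<^sup>2)"

lemma sq_integrable_measurable: "sq_integrable f \<Longrightarrow> f \<in> borel_measurable borel"
  by (simp add: sq_integrable_def)

lemma sq_integrable_mult:
  assumes "sq_integrable f" "sq_integrable g"
  shows "integrable lborel (\<lambda>x. f x * g x)"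
proof (rule Bochner_Integration.integrable_bound)
  have [measurable]: "f \<in> borel_measurable borel" "g \<in> borel_measurable borel"
    using assms by (auto simp: sq_integrable_def)
  show "integrable lborel (\<lambda>x. (f x)\<^sup>2 + (g x)\<^sup>2)"
    using assms by (simp add: sq_integrable_def)
  show "(\<lambda>x. f x * g x) \<in> borel_measurable lborel" by measurable
  have "\<bar>f x * g x\<bar> \<le> (f x)\<^sup>2 + (g x)\<^sup>2" for x
  proof -
    have "0 \<le> \<bar>f x\<bar> * \<bar>g x\<bar>" by simp
    then show ?thesis
      using sum_squares_bound[of "\<bar>f x\<bar>" "\<bar>g x\<bar>"] unfolding abs_mult power2_abs by linarith
  qed
  then show "AE x in lborel. norm (f x * g x) \<le> norm ((f x)\<^sup>2 + (g x)\<^sup>2)" by simp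
qed

lemma sq_integrable_add:
  assumes "sq_integrable f" "sq_integrable g"
  shows "sq_integrable (\<lambda>x. f x + g x)"
  unfolding sq_integrable_def power2_sum
  using assms sq_integrable_mult[OF assms] by (auto simp: sq_integrable_def mult.assoc)

lemma sq_integrable_cmult: "sq_integrable f \<Longrightarrow> sq_integrable (\<lambda>x. c * f x)"
  by (auto simp: sq_integrable_def power_mult_distrib)

lemma sq_integrable_diff:
  "sq_integrable f \<Longrightarrow> sq_integrable g \<Longrightarrow> sq_integrable (\<lambda>x. f x - g x)"
  using sq_integrable_add[of f "\<lambda>x. -1 * g x"] sq_integrable_cmult[of g "-1"] by simp

lemma sq_integrable_bounded_mult:
  assumes f: "sq_integrable f" and h: "h \<in> borel_measurable borel" "\<And>x. \<bar>h x\<bar> \<le> B"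
  shows "sq_integrable (\<lambda>x. h x * f x)"
proof -
  have "\<bar>(h x)\<^sup>2\<bar> \<le> B\<^sup>2" for x using h(2)[of x] abs_le_square_iff[of "h x" B] by simp
  then have "integrable lborel (\<lambda>x. (f x)\<^sup>2 * (h x)\<^sup>2)"
    using f h(1) by (intro integrable_mult_bounded) (auto simp: sq_integrable_def)
  then show ?thesis using f h(1)
    by (auto simp: sq_integrable_def power_mult_distrib mult.commute[of "h _"] intro: borel_measurable_times)
qed

lemma sq_integrable_bounded_support:
  assumes "f \<in> borel_measurable borel" "\<And>x. \<bar>f x\<bar> \<le> B" "bounded S" "\<And>x. x \<notin> S \<Longrightarrow> f x = 0"
  shows "sq_integrable f"
proof -
  obtain R where R: "S \<subseteq> cball 0 R" using assms(3) by (auto simp: bounded_iff subset_iff)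
  have "integrable lborel (\<lambda>x::'a. indicator (cball 0 R) x *\<^sub>R (1::real))"
    by (intro borel_integrable_compact) auto
  moreover have "(indicator (cball 0 R) x)\<^sup>2 = (indicator (cball 0 R) x *\<^sub>R 1 :: real)" for x :: 'a
    by (simp add: indicator_def)
  ultimately have "sq_integrable (\<lambda>x::'a. indicator (cball 0 R) x)"
    by (simp add: sq_integrable_def borel_measurable_indicator borel_closed)
  from sq_integrable_bounded_mult[OF this assms(1,2)]
  have "sq_integrable (\<lambda>x. f x * indicator (cball 0 R) x)" .
  also have "(\<lambda>x. f x * indicator (cball 0 R) x) = f"
    using assms(4) R by (force simp: indicator_def fun_eq_iff subset_iff)
  finally show ?thesis .
qed

lemma sq_integrable_continuous:
  assumes "continuous_on UNIV f" "compact K" "\<And>x. x \<notin> K \<Longrightarrow> f x = 0"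
  shows "sq_integrable f"
  using continuous_compact_support_bounded[OF assms] assms
  by (metis sq_integrable_bounded_support borel_measurable_continuous_onI compact_imp_bounded)

lemma sq_integrable_imp_integrable:
  assumes "sq_integrable f" "bounded S" "\<And>x. x \<notin> S \<Longrightarrow> f x = 0"
  shows "integrable lborel f"
proof -
  obtain R where R: "S \<subseteq> cball 0 R" using assms(2) by (auto simp: bounded_iff subset_iff)
  have "sq_integrable (indicator (cball 0 R) :: 'a \<Rightarrow> real)"
    by (rule sq_integrable_bounded_support[of _ 1 "cball 0 R"])
      (auto simp: borel_measurable_indicator borel_closed)
  from sq_integrable_mult[OF this assms(1)]
  have "integrable lborel (\<lambda>x. indicator (cball 0 R) x * f x)" .
  also have "(\<lambda>x. indicator (cball 0 R) x * f x) = f"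
    using assms(3) R by (force simp: indicator_def fun_eq_iff subset_iff)
  finally show ?thesis .
qed

text \<open>The polynomial \<open>a + 2 * t * c + t^2 * b\<close> is the integral of the square of
  \<open>f + t * g\<close>, hence nonnegative for every \<open>t\<close>.\<close>

lemma Cauchy_Schwarz_integral:
  assumes f: "sq_integrable f" and g: "sq_integrable g"
  shows "(\<integral>x. f x * g x \<partial>lborel)\<^sup>2 \<le> (\<integral>x. (f x)\<^sup>2 \<partial>lborel) * (\<integral>x. (g x)\<^sup>2 \<partial>lborel)"
proof -
  define a b c where "a = (\<integral>x. (f x)\<^sup>2 \<partial>lborel)" and "b = (\<integral>x. (g x)\<^sup>2 \<partial>lborel)"
    and "c = (\<integral>x. f x * g x \<partial>lborel)"
  have nn: "a \<ge> 0" "b \<ge> 0" by (auto simp: a_def b_def)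
  have quad: "0 \<le> a + 2 * t * c + t\<^sup>2 * b" for t
  proof -
    have "0 \<le> (\<integral>x. (f x + t * g x)\<^sup>2 \<partial>lborel)" by simp
    also have "\<dots> = (\<integral>x. (f x)\<^sup>2 + (2 * t) * (f x * g x) + t\<^sup>2 * (g x)\<^sup>2 \<partial>lborel)"
      by (intro Bochner_Integration.integral_cong) (auto simp: power2_eq_square algebra_simps)
    also have "\<dots> = a + 2 * t * c + t\<^sup>2 * b"
      using f g sq_integrable_mult[OF f g] by (simp add: sq_integrable_def a_def b_def c_def)
    finally show ?thesis .
  qed
  show ?thesis
  proof (cases "b = 0")
    case True
    have "c = 0"
    proof (rule ccontr)
      assume "c \<noteq> 0"
      \<comment> \<open>When \<open>b\<close> is 0 the polynomial is affine in \<open>t\<close>, and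
        this choice of \<open>t\<close> gives it the value -1.\<close>
      then show False using quad[of "- (a + 1) / (2 * c)"] True nn by (simp add: field_simps)
    qed
    then show ?thesis using nn by (simp add: a_def b_def c_def)
  next
    case False
    then have "0 \<le> a - c\<^sup>2 / b" using quad[of "- c / b"] by (simp add: power2_eq_square field_simps)
    then show ?thesis using False nn(2) unfolding a_def[symmetric] b_def[symmetric] c_def[symmetric]
      by (simp add: field_simps)
  qed
qed

lemma integral_square_sum_le:
  assumes "sq_integrable f" "sq_integrable g"
  shows "(\<integral>x. (f x + g x)\<^sup>2 \<partial>lborel) \<le> 2 * (\<integral>x. (f x)\<^sup>2 \<partial>lborel) + 2 * (\<integral>x. (g x)\<^sup>2 \<partial>lborel)"
proof -
  have "(\<integral>x. (f x + g x)\<^sup>2 \<partial>lborel) \<le> (\<integral>x. 2 * (f x)\<^sup>2 + 2 * (g x)\<^sup>2 \<partial>lborel)"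
  proof (rule integral_mono)
    show "(f x + g x)\<^sup>2 \<le> 2 * (f x)\<^sup>2 + 2 * (g x)\<^sup>2" for x
      using sum_squares_bound[of "f x" "g x"] by (simp add: power2_sum)
  qed (use assms sq_integrable_add[OF assms] in \<open>auto simp: sq_integrable_def\<close>)
  then show ?thesis using assms by (simp add: sq_integrable_def)
qed

text \<open>Continuous functions converging to \<open>f\<close> almost everywhere come with the
  notion \<open>measurable_on\<close>. Clipping them to \<open>[-B, B]\<close> and multiplying by a
  cutoff that is 1 on \<open>K\<close> keeps the limit and adds the common bound and common compact
  support that dominated convergence calls for.\<close>

lemma continuous_approximation:
  fixes f :: "'a::euclidean_space \<Rightarrow> real"
  assumes f: "f \<in> borel_measurable borel" "\<And>x. \<bar>f x\<bar> \<le> B"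
    and K: "compact K" "\<And>x. x \<notin> K \<Longrightarrow> f x = 0" and U: "open U" "K \<subseteq> U"
  shows "\<exists>L c. compact L \<and> L \<subseteq> U \<and> (\<forall>n. continuous_on UNIV (c n)) \<and>
    (\<forall>n x. x \<notin> L \<longrightarrow> c n x = 0) \<and> (\<forall>n x. \<bar>c n x\<bar> \<le> B) \<and> (AE x in lborel. (\<lambda>n. c n x) \<longlonglongrightarrow> f x)"
proof -
  have B: "B \<ge> 0" using f(2)[of undefined] by linarith
  obtain \<eta> L where \<eta>: "smooth \<eta>" "compact L" "L \<subseteq> U" "\<And>x. x \<notin> L \<Longrightarrow> \<eta> x = 0"
    "\<And>x. x \<in> K \<Longrightarrow> \<eta> x = 1" "\<And>x. 0 \<le> \<eta> x" "\<And>x. \<eta> x \<le> 1"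
    using smooth_cutoff_exists[OF K(1) U] by metis
  have "f measurable_on UNIV"
    using f(1) by (intro lebesgue_measurable_imp_measurable_on) (auto intro: measurable_completion)
  then obtain N g where N: "negligible N" and g: "\<And>n. continuous_on UNIV (g n)"
    "\<And>x. x \<notin> N \<Longrightarrow> (\<lambda>n. g n x) \<longlonglongrightarrow> f x"
    unfolding measurable_on_def by auto
  define c where "c n x = \<eta> x * max (- B) (min B (g n x))" for n x
  have c1: "continuous_on UNIV (c n)" for n
    unfolding c_def using g(1) smooth_continuous[OF \<eta>(1)] by (intro continuous_intros)
  have c2: "c n x = 0" if "x \<notin> L" for n x using \<eta>(4)[OF that] by (simp add: c_def)
  have c3: "\<bar>c n x\<bar> \<le> B" for n x
  proof -
    have "\<bar>max (- B) (min B (g n x))\<bar> \<le> B" using B by auto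
    then have "\<bar>\<eta> x\<bar> * \<bar>max (- B) (min B (g n x))\<bar> \<le> 1 * B"
      using \<eta>(6,7)[of x] by (intro mult_mono) auto
    then show ?thesis by (simp add: c_def abs_mult)
  qed
  have lim: "(\<lambda>n. c n x) \<longlonglongrightarrow> f x" if "x \<notin> N" for x
  proof -
    have "(\<lambda>n. c n x) \<longlonglongrightarrow> \<eta> x * max (- B) (min B (f x))"
      unfolding c_def using g(2)[OF that] by (intro tendsto_intros)
    also have "\<eta> x * max (- B) (min B (f x)) = f x"
      using K(2)[of x] \<eta>(5)[of x] f(2)[of x] B by (cases "x \<in> K") (auto simp: abs_le_iff)
    finally show ?thesis .
  qed
  have c5: "AE x in lborel. (\<lambda>n. c n x) \<longlonglongrightarrow> f x"
  proof -
    have "N \<in> null_sets lebesgue" using N by (simp add: negligible_iff_null_sets)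
    then have "AE x in lebesgue. x \<notin> N" by (rule AE_not_in)
    then have "AE x in lborel. x \<notin> N" by (simp add: AE_completion_iff)
    then show ?thesis using lim by (auto elim: eventually_mono)
  qed
  show ?thesis using \<eta>(2,3) c1 c2 c3 c5 by (intro exI[of _ L] exI[of _ c] conjI allI impI)
qed

lemma sq_integrable_approximation:
  fixes f :: "'a::euclidean_space \<Rightarrow> real"
  assumes f: "sq_integrable f" and e: "e > 0"
  obtains c K where "continuous_on UNIV c" "compact K" "\<And>x. x \<notin> K \<Longrightarrow> c x = 0"
    "(\<integral>x. (f x - c x)\<^sup>2 \<partial>lborel) < e"
proof -
  have fm [measurable]: "f \<in> borel_measurable borel" using f by (simp add: sq_integrable_def)
  \<comment> \<open>Truncation both in space and in size gives a bounded function of bounded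
    support, to which \<open>continuous_approximation\<close> applies. Each of the two errors is
    kept below \<open>e / 4\<close>, since \<open>integral_square_sum_le\<close> doubles the
    squares.\<close>
  define h where "h k x = (if norm x \<le> real k \<and> \<bar>f x\<bar> \<le> real k then f x else 0)" for k x
  have hm [measurable]: "h k \<in> borel_measurable borel" for k unfolding h_def by measurable
  have "(\<lambda>k. \<integral>x. (f x - h k x)\<^sup>2 \<partial>lborel) \<longlonglongrightarrow> (\<integral>x. 0 \<partial>(lborel :: 'a measure))"
  proof (rule integral_dominated_convergence[where w = "\<lambda>x. (f x)\<^sup>2"])
    show "AE x in lborel. (\<lambda>k. (f x - h k x)\<^sup>2) \<longlonglongrightarrow> 0"
    proof (rule AE_I2)
      fix x
      obtain n where n: "max (norm x) \<bar>f x\<bar> \<le> real n" using real_arch_simple by blast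
      have "\<forall>\<^sub>F k in sequentially. (f x - h k x)\<^sup>2 = 0"
        using eventually_ge_at_top[of n]
      proof eventually_elim
        case (elim k)
        then have "real n \<le> real k" by simp
        with n show ?case by (simp add: h_def)
      qed
      then show "(\<lambda>k. (f x - h k x)\<^sup>2) \<longlonglongrightarrow> 0" by (rule tendsto_eventually)
    qed
    show "AE x in lborel. norm ((f x - h k x)\<^sup>2) \<le> (f x)\<^sup>2" for k by (auto simp: h_def)
  qed (use f in \<open>auto simp: sq_integrable_def\<close>)
  then have "\<forall>\<^sub>F k in sequentially. (\<integral>x. (f x - h k x)\<^sup>2 \<partial>lborel) < e / 4"
    using order_tendstoD(2)[of _ 0 sequentially "e / 4"] e by simp
  then obtain k where k: "(\<integral>x. (f x - h k x)\<^sup>2 \<partial>lborel) < e / 4"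
    by (auto simp: eventually_sequentially)
  have h: "\<bar>h k x\<bar> \<le> real k" "x \<notin> cball 0 (real k) \<Longrightarrow> h k x = 0" for x by (auto simp: h_def)
  obtain L c where c: "compact L" "L \<subseteq> UNIV" "\<And>n. continuous_on UNIV (c n)"
    "\<And>n x. x \<notin> L \<Longrightarrow> c n x = 0" "\<And>n x. \<bar>c n x\<bar> \<le> real k" "AE x in lborel. (\<lambda>n. c n x) \<longlonglongrightarrow> h k x"
    using continuous_approximation[of "h k" "real k" "cball 0 (real k)" UNIV,
        OF hm h(1) compact_cball h(2) open_UNIV subset_UNIV]
    by blast
  have cm [measurable]: "c n \<in> borel_measurable borel" for n
    using c(3) by (rule borel_measurable_continuous_onI)
  \<comment> \<open>Off \<open>L\<close> the approximants vanish, hence so does their limit; this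
    makes a multiple of the indicator of \<open>L\<close> a dominating function.\<close>
  have hL: "AE x in lborel. x \<notin> L \<longrightarrow> h k x = 0"
    using c(6) by eventually_elim (use c(4) in \<open>auto simp: LIMSEQ_const_iff\<close>)
  have "(\<lambda>n. \<integral>x. (h k x - c n x)\<^sup>2 \<partial>lborel) \<longlonglongrightarrow> (\<integral>x. 0 \<partial>(lborel :: 'a measure))"
  proof (rule integral_dominated_convergence[where w = "\<lambda>x. indicator L x *\<^sub>R (2 * real k)\<^sup>2"])
    show "integrable lborel (\<lambda>x. indicator L x *\<^sub>R (2 * real k)\<^sup>2)"
      using c(1) by (intro borel_integrable_compact) auto
    show "AE x in lborel. (\<lambda>n. (h k x - c n x)\<^sup>2) \<longlonglongrightarrow> 0"
      using c(6) by eventually_elim (auto intro!: tendsto_eq_intros)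
    show "AE x in lborel. norm ((h k x - c n x)\<^sup>2) \<le> indicator L x *\<^sub>R (2 * real k)\<^sup>2" for n
      using hL
    proof eventually_elim
      case (elim x)
      have "\<bar>h k x - c n x\<bar> \<le> \<bar>2 * real k\<bar>" using h(1)[of x] c(5)[of n x] by linarith
      then have "(h k x - c n x)\<^sup>2 \<le> (2 * real k)\<^sup>2" by (simp only: abs_le_square_iff)
      then show ?case using elim c(4)[of x n] by (cases "x \<in> L") auto
    qed
  qed auto
  then have "\<forall>\<^sub>F n in sequentially. (\<integral>x. (h k x - c n x)\<^sup>2 \<partial>lborel) < e / 4"
    using order_tendstoD(2)[of _ 0 sequentially "e / 4"] e by simp
  then obtain n where n: "(\<integral>x. (h k x - c n x)\<^sup>2 \<partial>lborel) < e / 4"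
    by (auto simp: eventually_sequentially)
  have hs: "sq_integrable (h k)" by (rule sq_integrable_bounded_support[OF hm h(1) bounded_cball h(2)])
  have cs: "sq_integrable (c n)" by (rule sq_integrable_continuous[OF c(3) c(1) c(4)])
  have "(\<integral>x. (f x - c n x)\<^sup>2 \<partial>lborel) < e"
    using integral_square_sum_le[OF sq_integrable_diff[OF f hs] sq_integrable_diff[OF hs cs]] k n by simp
  then show ?thesis using that[OF c(3) c(1) c(4)] by blast
qed

lemma sq_integrable_affine:
  fixes f :: "'a::euclidean_space \<Rightarrow> real"
  assumes "sq_integrable f" "\<bar>c\<bar> = 1"
  shows "sq_integrable (\<lambda>x. f (t + c *\<^sub>R x))"
    and "(\<integral>x. (f (t + c *\<^sub>R x))\<^sup>2 \<partial>lborel) = (\<integral>x. (f x)\<^sup>2 \<partial>lborel)"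
  using assms lborel_integral_affine[OF assms(2), of "\<lambda>x. (f x)\<^sup>2" t]
  by (auto simp: sq_integrable_def)

lemma sq_integrable_shift:
  assumes "sq_integrable f"
  shows "sq_integrable (\<lambda>x. f (x - t))" "(\<integral>x. (f (x - t))\<^sup>2 \<partial>lborel) = (\<integral>x. (f x)\<^sup>2 \<partial>lborel)"
  using sq_integrable_affine[OF assms, of 1 "- t"] by simp_all

text \<open>For a continuous function of compact support this is uniform continuity; the general
  case follows by approximation, because translations preserve the \<open>L^2\<close> norm.\<close>

lemma translation_continuous:
  fixes f :: "'a::euclidean_space \<Rightarrow> real"
  assumes f: "sq_integrable f" and e: "e > 0"
  obtains d where "d > 0" "\<And>s. norm s < d \<Longrightarrow> (\<integral>x. (f (x - s) - f x)\<^sup>2 \<partial>lborel) < e"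
proof -
  \<comment> \<open>The triangle inequality is applied twice in the form
    \<open>integral_square_sum_le\<close>, counting in units of \<open>e / 10\<close>:
    \<open>2 * (1 + 1) = 4\<close>, then \<open>2 * (4 + 1) = 10\<close>.\<close>
  obtain c K where c: "continuous_on UNIV c" "compact K" "\<And>x. x \<notin> K \<Longrightarrow> c x = 0"
    and fc: "(\<integral>x. (f x - c x)\<^sup>2 \<partial>lborel) < e / 10"
    using sq_integrable_approximation[OF f, of "e / 10"] e by auto
  obtain R where R: "\<And>x. x \<in> K \<Longrightarrow> norm x \<le> R"
    using c(2) compact_imp_bounded bounded_iff by metis
  have cs: "sq_integrable c" by (rule sq_integrable_continuous[OF c])
  \<comment> \<open>Off the ball of radius \<open>R + 1\<close> both \<open>c\<close> and its
    translates by less than 1 vanish; on it, the bound \<open>e / (10 * V)\<close> for the square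
    integrates to at most \<open>e / 10\<close>.\<close>
  define V where "V = measure lborel (cball (0::'a) (R + 1)) + 1"
  have V: "V > 0" unfolding V_def by (simp add: add_nonneg_pos)
  obtain d where d: "d > 0" "\<And>x y. dist x y < d \<Longrightarrow> \<bar>c x - c y\<bar> < sqrt (e / (10 * V))"
    using continuous_compact_support_uniform[OF c, of "sqrt (e / (10 * V))"] e V by auto
  have "(\<integral>x. (f (x - s) - f x)\<^sup>2 \<partial>lborel) < e" if s: "norm s < min d 1" for s
  proof -
    have "(\<integral>x. (c (x - s) - c x)\<^sup>2 \<partial>lborel) \<le> integral\<^sup>L lborel (\<lambda>x::'a. e / (10 * V) * indicator (cball 0 (R + 1)) x)"
    proof (rule integral_mono)
      show "integrable lborel (\<lambda>x. (c (x - s) - c x)\<^sup>2)"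
        using sq_integrable_diff[OF sq_integrable_shift(1)[OF cs] cs] by (simp add: sq_integrable_def)
      show "integrable lborel (\<lambda>x::'a. e / (10 * V) * indicator (cball 0 (R + 1)) x)"
        using emeasure_compact_finite[OF compact_cball, of 0 "R + 1"]
        by (intro integrable_mult_right) (simp add: integrable_indicator_iff)
      fix x
      show "(c (x - s) - c x)\<^sup>2 \<le> e / (10 * V) * indicator (cball 0 (R + 1)) x"
      proof (cases "x \<in> cball 0 (R + 1)")
        case True
        have "\<bar>c (x - s) - c x\<bar> \<le> sqrt (e / (10 * V))"
          using d(2)[of "x - s" x] s by (simp add: dist_norm)
        then have "(c (x - s) - c x)\<^sup>2 \<le> (sqrt (e / (10 * V)))\<^sup>2"
          using power_mono[of "\<bar>c (x - s) - c x\<bar>" _ 2] by simp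
        then show ?thesis using True e V by simp
      next
        case False
        then have "norm x > R" "norm (x - s) > R" using norm_triangle_ineq2[of x s] s by auto
        then have "x \<notin> K" "x - s \<notin> K" using R by force+
        then show ?thesis using c(3) False by simp
      qed
    qed
    also have "\<dots> = e / (10 * V) * (V - 1)" by (simp add: V_def)
    also have "\<dots> \<le> e / 10" using V e by (simp add: field_simps)
    finally have 1: "(\<integral>x. (c (x - s) - c x)\<^sup>2 \<partial>lborel) \<le> e / 10" .
    have 2: "(\<integral>x. (f (x - s) - c (x - s))\<^sup>2 \<partial>lborel) < e / 10"
      using sq_integrable_shift(2)[OF sq_integrable_diff[OF f cs], of s] fc by simp
    note fs = sq_integrable_shift(1)[OF f, of s] and cs' = sq_integrable_shift(1)[OF cs, of s]
    have 3: "(\<integral>x. (c x - f x)\<^sup>2 \<partial>lborel) < e / 10" using fc by (simp add: power2_commute)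
    have 4: "(\<integral>x. (f (x - s) - c x)\<^sup>2 \<partial>lborel) < 4 * (e / 10)"
      using integral_square_sum_le[OF sq_integrable_diff[OF fs cs'] sq_integrable_diff[OF cs' cs]] 1 2 by simp
    have "(\<integral>x. (f (x - s) - f x)\<^sup>2 \<partial>lborel) < 2 * (4 * (e / 10)) + 2 * (e / 10)"
      using integral_square_sum_le[OF sq_integrable_diff[OF fs cs] sq_integrable_diff[OF cs f]] 3 4 by simp
    then show ?thesis using e by simp
  qed
  then show ?thesis using d(1) that[of "min d 1"] by simp
qed

lemma mollifierD:
  assumes "mollifier c r k"
  shows "smooth k" "\<And>x. k x \<ge> 0" "\<And>x. x \<notin> cball c r \<Longrightarrow> k x = 0" "(\<integral>x. k x \<partial>lborel) = 1"
    "continuous_on UNIV k" "integrable lborel k" "k \<in> borel_measurable borel"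
  using assms continuous_compact_support_integrable[OF _ compact_cball[of c r], of k]
  by (auto simp: mollifier_def intro: smooth_continuous borel_measurable_continuous_onI)

text \<open>Fubini after the substitution \<open>y = z - x\<close> turns the pairing of
  \<open>G\<close> with a convolution into an average, with weight \<open>k\<close>, of pairings of
  \<open>G\<close> with translates of \<open>g\<close>. Absolute convergence comes from the bound on
  \<open>k\<close>.\<close>

lemma integral_mult_convol:
  fixes G g k :: "'a::euclidean_space \<Rightarrow> real"
  assumes G: "integrable lborel G" and g: "integrable lborel g"
    and k: "continuous_on UNIV k" "compact K" "\<And>x. x \<notin> K \<Longrightarrow> k x = 0"
  shows "(\<integral>z. G z * convol g k z \<partial>lborel) = (\<integral>y. k y * (\<integral>z. G z * g (z - y) \<partial>lborel) \<partial>lborel)"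
    and "integrable lborel (\<lambda>z. G z * convol g k z)"
    and "integrable lborel (\<lambda>y. k y * (\<integral>z. G z * g (z - y) \<partial>lborel))"
proof -
  have [measurable]: "G \<in> borel_measurable borel" "g \<in> borel_measurable borel" "k \<in> borel_measurable borel"
    using G g k(1) by (auto intro: borel_measurable_continuous_onI)
  obtain B where B: "B > 0" "\<And>x. \<bar>k x\<bar> \<le> B" using continuous_compact_support_bounded[OF k] by blast
  have sub: "(\<integral>y. f (z - y) * h y \<partial>lborel) = (\<integral>x. f x * h (z - x) \<partial>lborel)"
    "integrable lborel (\<lambda>y. f (z - y) * h y) \<longleftrightarrow> integrable lborel (\<lambda>x. f x * h (z - x))"
    if [measurable]: "f \<in> borel_measurable borel" "h \<in> borel_measurable borel" for f h :: "'a \<Rightarrow> real" and z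
    using lborel_integral_affine[of "-1" "\<lambda>x. f x * h (z - x)" z] by simp_all
  have gk: "integrable lborel (\<lambda>y. g (z - y) * k y)" for z
    using convol_integrand_integrable[OF g k] by (simp add: sub(2))
  define f where "f = (\<lambda>(z, y). G z * (g (z - y) * k y))"
  have int: "integrable (lborel \<Otimes>\<^sub>M lborel) f"
  proof (rule lborel_pair.Fubini_integrable)
    show [measurable]: "f \<in> borel_measurable (lborel \<Otimes>\<^sub>M lborel)" unfolding f_def by measurable
    show "AE z in lborel. integrable lborel (\<lambda>y. f (z, y))" using gk by (simp add: f_def)
    show "integrable lborel (\<lambda>z. \<integral>y. norm (f (z, y)) \<partial>lborel)"
    proof (rule Bochner_Integration.integrable_bound)
      show "integrable lborel (\<lambda>z. G z * (B * (\<integral>x. \<bar>g x\<bar> \<partial>lborel)))" using G by simp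
      show "(\<lambda>z. \<integral>y. norm (f (z, y)) \<partial>lborel) \<in> borel_measurable lborel" by measurable
      have "\<bar>\<integral>y. norm (f (z, y)) \<partial>lborel\<bar> \<le> \<bar>G z\<bar> * (B * (\<integral>x. \<bar>g x\<bar> \<partial>lborel))" for z
      proof -
        have "(\<integral>y. \<bar>g (z - y)\<bar> * \<bar>k y\<bar> \<partial>lborel) = (\<integral>x. \<bar>g x\<bar> * \<bar>k (z - x)\<bar> \<partial>lborel)"
          using sub(1)[of "\<lambda>x. \<bar>g x\<bar>" "\<lambda>x. \<bar>k x\<bar>" z] by simp
        also have "\<dots> \<le> (\<integral>x. B * \<bar>g x\<bar> \<partial>lborel)"
        proof (rule integral_mono)
          show "integrable lborel (\<lambda>x. \<bar>g x\<bar> * \<bar>k (z - x)\<bar>)"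
            using integrable_abs[OF convol_integrand_integrable[OF g k, of z]] by (simp add: abs_mult)
          show "\<bar>g x\<bar> * \<bar>k (z - x)\<bar> \<le> B * \<bar>g x\<bar>" for x
            using B(2)[of "z - x"] by (simp add: mult.commute[of B] mult_left_mono)
        qed (use g in auto)
        finally have *: "(\<integral>y. \<bar>g (z - y)\<bar> * \<bar>k y\<bar> \<partial>lborel) \<le> B * (\<integral>x. \<bar>g x\<bar> \<partial>lborel)" by simp
        have "(\<integral>y. norm (f (z, y)) \<partial>lborel) = \<bar>G z\<bar> * (\<integral>y. \<bar>g (z - y)\<bar> * \<bar>k y\<bar> \<partial>lborel)"
          by (simp add: f_def abs_mult)
        also have "\<bar>\<dots>\<bar> \<le> \<bar>G z\<bar> * (B * (\<integral>x. \<bar>g x\<bar> \<partial>lborel))"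
          using mult_left_mono[OF *, of "\<bar>G z\<bar>"] by (subst abs_of_nonneg) (auto intro!: mult_nonneg_nonneg)
        finally show ?thesis .
      qed
      then show "AE z in lborel. norm (\<integral>y. norm (f (z, y)) \<partial>lborel) \<le> norm (G z * (B * (\<integral>x. \<bar>g x\<bar> \<partial>lborel)))"
        using B(1) by (auto simp: abs_mult)
    qed
  qed
  have 1: "(\<integral>y. f (z, y) \<partial>lborel) = G z * convol g k z" for z
    using sub(1)[of g k z] by (simp add: f_def convol_def)
  have 2: "(\<integral>z. f (z, y) \<partial>lborel) = k y * (\<integral>z. G z * g (z - y) \<partial>lborel)" for y
    by (simp add: f_def mult.assoc[symmetric])
  show "(\<integral>z. G z * convol g k z \<partial>lborel) = (\<integral>y. k y * (\<integral>z. G z * g (z - y) \<partial>lborel) \<partial>lborel)"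
    using lborel_pair.Fubini_integral[of "\<lambda>z y. f (z, y)"] int by (simp add: 1 2)
  show "integrable lborel (\<lambda>z. G z * convol g k z)"
    using lborel_pair.integrable_fst[of "\<lambda>z y. f (z, y)"] int by (simp add: 1)
  show "integrable lborel (\<lambda>y. k y * (\<integral>z. G z * g (z - y) \<partial>lborel))"
    using lborel_pair.integrable_snd[of "\<lambda>z y. f (z, y)"] int by (simp add: 2)
qed

text \<open>The radius \<open>d\<close> does not depend on the shape or centre of the kernel: the
  tested convolution averages the correlations \<open>\<Phi> y\<close> over the support of
  \<open>k\<close>, and \<open>\<Phi>\<close> is close to \<open>\<Phi> 0\<close> near the origin by
  Cauchy-Schwarz and continuity of translations.\<close>

lemma mollifier_weak_convergence:
  fixes G g :: "'a::euclidean_space \<Rightarrow> real"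
  assumes G: "sq_integrable G" "integrable lborel G" and g: "sq_integrable g" "integrable lborel g"
    and e: "e > 0"
  shows "\<exists>d>0. \<forall>c r k. mollifier c r k \<and> cball c r \<subseteq> ball 0 d \<longrightarrow>
    \<bar>(\<integral>z. G z * convol g k z \<partial>lborel) - (\<integral>z. G z * g z \<partial>lborel)\<bar> \<le> e"
proof -
  define A where "A = (\<integral>z. (G z)\<^sup>2 \<partial>lborel) + 1"
  have A: "A > 0" unfolding A_def by (simp add: add_nonneg_pos)
  \<comment> \<open>\<open>A\<close> exceeds the squared norm of \<open>G\<close>, so a translation
    error below \<open>e^2 / A\<close> makes the square of \<open>\<Phi> y - \<Phi> 0\<close> at
    most \<open>e^2\<close>.\<close>
  obtain d where d: "d > 0" "\<And>s. norm s < d \<Longrightarrow> (\<integral>x. (g (x - s) - g x)\<^sup>2 \<partial>lborel) < e\<^sup>2 / A"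
    using translation_continuous[OF g(1), of "e\<^sup>2 / A"] e A by auto
  define \<Phi> where "\<Phi> y = (\<integral>z. G z * g (z - y) \<partial>lborel)" for y
  have close: "\<bar>\<Phi> y - \<Phi> 0\<bar> \<le> e" if "norm y < d" for y
  proof -
    note gy = sq_integrable_shift(1)[OF g(1), of y]
    have "\<Phi> y - \<Phi> 0 = (\<integral>z. G z * (g (z - y) - g z) \<partial>lborel)"
      unfolding \<Phi>_def using sq_integrable_mult[OF G(1) gy] sq_integrable_mult[OF G(1) g(1)]
      by (simp add: right_diff_distrib)
    then have "(\<Phi> y - \<Phi> 0)\<^sup>2 \<le> (\<integral>z. (G z)\<^sup>2 \<partial>lborel) * (\<integral>z. (g (z - y) - g z)\<^sup>2 \<partial>lborel)"
      using Cauchy_Schwarz_integral[OF G(1) sq_integrable_diff[OF gy g(1)]] by simp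
    also have "\<dots> \<le> A * (e\<^sup>2 / A)"
      using d(2)[OF that] by (intro mult_mono) (auto simp: A_def intro: add_nonneg_nonneg)
    finally have "(\<Phi> y - \<Phi> 0)\<^sup>2 \<le> e\<^sup>2" using A by simp
    then show ?thesis using e abs_le_square_iff[of "\<Phi> y - \<Phi> 0" e] by simp
  qed
  have "\<bar>(\<integral>z. G z * convol g k z \<partial>lborel) - (\<integral>z. G z * g z \<partial>lborel)\<bar> \<le> e"
    if k: "mollifier c r k" and sub: "cball c r \<subseteq> ball 0 d" for c r k
  proof -
    note kk = mollifierD[OF k]
    note I = integral_mult_convol[OF G(2) g(2) kk(5) compact_cball kk(3), folded \<Phi>_def]
    have "(\<integral>z. G z * convol g k z \<partial>lborel) - \<Phi> 0 = (\<integral>y. k y * \<Phi> y \<partial>lborel) - (\<integral>y. k y * \<Phi> 0 \<partial>lborel)"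
      using I(1) kk(4) by simp
    also have "\<dots> = (\<integral>y. k y * (\<Phi> y - \<Phi> 0) \<partial>lborel)"
      using I(3) kk(6) by (simp add: right_diff_distrib)
    also have "\<bar>\<dots>\<bar> \<le> (\<integral>y. k y * e \<partial>lborel)"
    proof (intro integral_abs_bound[THEN order_trans] integral_mono)
      show "integrable lborel (\<lambda>y. \<bar>k y * (\<Phi> y - \<Phi> 0)\<bar>)"
        using I(3) kk(6) by (intro integrable_abs) (simp add: right_diff_distrib)
      show "\<bar>k y * (\<Phi> y - \<Phi> 0)\<bar> \<le> k y * e" for y
      proof (cases "y \<in> cball c r")
        case True
        then have "norm y < d" using sub by auto
        then show ?thesis using close kk(2)[of y] by (simp add: abs_mult mult_left_mono)
      qed (simp add: kk(3))
    qed (use kk(6) in simp)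
    also have "\<dots> = e" using kk(4) by simp
    finally show ?thesis by (simp add: \<Phi>_def)
  qed
  then show ?thesis using d(1) by blast
qed

section \<open>Weak derivatives\<close>

lemma AE_lebesgue_on_iff:
  "S \<in> sets lebesgue \<Longrightarrow> (AE x in lebesgue_on S. P x) \<longleftrightarrow> (AE x in lborel. x \<in> S \<longrightarrow> P x)"
  by (simp add: AE_restrict_space_iff AE_completion_iff)

lemma lebesgue_open: "open S \<Longrightarrow> S \<in> sets lebesgue"
  by (intro sets_completionI_sets) simp

text \<open>A bridge from the completed measure on \<open>D\<close> to \<open>lborel\<close>: on a
  compact \<open>K\<close> the function \<open>v\<close> has one Borel representative that serves
  all Borel multipliers supported in \<open>K\<close>.\<close>

lemma locally_integrable_borel:
  fixes v :: "'a::euclidean_space \<Rightarrow> real"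
  assumes v: "locally_integrable D v" and D: "open D" and K: "compact K" "K \<subseteq> D"
  shows "\<exists>w. integrable lborel w \<and> (\<forall>x. x \<notin> K \<longrightarrow> w x = 0) \<and> (AE x in lborel. x \<in> K \<longrightarrow> w x = v x) \<and>
    (\<forall>\<phi>. \<phi> \<in> borel_measurable borel \<and> (\<forall>x. x \<notin> K \<longrightarrow> \<phi> x = 0) \<longrightarrow>
      (LINT x|lebesgue_on D. v x * \<phi> x) = (\<integral>x. w x * \<phi> x \<partial>lborel)) \<and>
    (\<forall>\<phi> B. \<phi> \<in> borel_measurable borel \<and> (\<forall>x. x \<notin> K \<longrightarrow> \<phi> x = 0) \<and> (\<forall>x. \<bar>\<phi> x\<bar> \<le> B) \<longrightarrow>
      integrable (lebesgue_on D) (\<lambda>x. v x * \<phi> x))"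
proof -
  have Kb: "K \<in> sets borel" using K(1) by (simp add: borel_closed compact_imp_closed)
  then have Kl: "K \<in> sets lebesgue" by simp
  have "integrable (lebesgue_on K) v" using v K by (simp add: locally_integrable_def)
  then have int: "integrable lebesgue (\<lambda>x. indicator K x *\<^sub>R v x)"
    using Kl by (simp add: integrable_restrict_space)
  then obtain w0 where w0: "w0 \<in> borel_measurable lborel" "AE x in lborel. indicator K x *\<^sub>R v x = w0 x"
    using completion_ex_borel_measurable_real[of _ lborel] by blast
  \<comment> \<open>\<open>w0\<close> agrees with the cut-off \<open>v\<close> only almost
    everywhere; the extra indicator makes \<open>w\<close> vanish off \<open>K\<close> at every
    point.\<close>
  define w where "w x = indicator K x * w0 x" for x
  have w0m [measurable]: "w0 \<in> borel_measurable borel" using w0(1) by simp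
  have wm [measurable]: "w \<in> borel_measurable borel" unfolding w_def using Kb by measurable
  have wv: "AE x in lborel. w x = indicator K x *\<^sub>R v x"
    using w0(2) by eventually_elim (auto simp: w_def indicator_def)
  have wint: "integrable lborel w"
  proof -
    have "integrable lebesgue w"
      by (rule Bochner_Integration.integrable_cong_AE_imp[OF int])
        (use wv in \<open>auto intro!: measurable_completion AE_completion elim: eventually_mono\<close>)
    then show ?thesis by (simp add: integrable_completion)
  qed
  have Dl: "D \<in> sets lebesgue" using D by (rule lebesgue_open)
  have eq: "AE x in lebesgue. indicator D x *\<^sub>R (v x * \<phi> x) = w x * \<phi> x"
    if "\<And>x. x \<notin> K \<Longrightarrow> \<phi> x = 0" for \<phi>
    using AE_completion[OF wv] by eventually_elim (use that K(2) in \<open>auto simp: indicator_def\<close>)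
  have meas: "(\<lambda>x. w x * \<phi> x) \<in> borel_measurable lebesgue" if "\<phi> \<in> borel_measurable borel" for \<phi>
    using that by (intro measurable_completion) simp
  have meas': "(\<lambda>x. indicator D x *\<^sub>R (v x * \<phi> x)) \<in> borel_measurable lebesgue"
    if "\<phi> \<in> borel_measurable borel" "\<And>x. x \<notin> K \<Longrightarrow> \<phi> x = 0" for \<phi>
    by (rule borel_measurable_AE[OF meas[OF that(1)] AE_symmetric[OF eq[OF that(2)]]])
  have "(LINT x|lebesgue_on D. v x * \<phi> x) = (\<integral>x. w x * \<phi> x \<partial>lborel)"
    if \<phi>: "\<phi> \<in> borel_measurable borel" "\<And>x. x \<notin> K \<Longrightarrow> \<phi> x = 0" for \<phi>
  proof -
    have "(LINT x|lebesgue_on D. v x * \<phi> x) = (\<integral>x. indicator D x *\<^sub>R (v x * \<phi> x) \<partial>lebesgue)"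
      using Dl by (simp add: integral_restrict_space)
    also have "\<dots> = (\<integral>x. w x * \<phi> x \<partial>lebesgue)"
      using meas[OF \<phi>(1)] meas'[OF \<phi>] eq[OF \<phi>(2)] by (intro integral_cong_AE) auto
    also have "\<dots> = (\<integral>x. w x * \<phi> x \<partial>lborel)"
      using \<phi>(1) by (intro integral_completion) simp
    finally show ?thesis .
  qed
  moreover have "integrable (lebesgue_on D) (\<lambda>x. v x * \<phi> x)"
    if \<phi>: "\<phi> \<in> borel_measurable borel" "\<And>x. x \<notin> K \<Longrightarrow> \<phi> x = 0" "\<And>x. \<bar>\<phi> x\<bar> \<le> B" for \<phi> B
  proof -
    have "integrable lborel (\<lambda>x. w x * \<phi> x)"
      using wint \<phi>(1,3) by (rule integrable_mult_bounded)
    then have "integrable lebesgue (\<lambda>x. w x * \<phi> x)"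
      using \<phi>(1) by (simp add: integrable_completion)
    then have "integrable lebesgue (\<lambda>x. indicator D x *\<^sub>R (v x * \<phi> x))"
      by (rule Bochner_Integration.integrable_cong_AE_imp[OF _ meas'[OF \<phi>(1,2)] AE_symmetric[OF eq[OF \<phi>(2)]]])
    then show ?thesis using Dl by (simp add: integrable_restrict_space)
  qed
  moreover have "AE x in lborel. x \<in> K \<longrightarrow> w x = v x" using wv by eventually_elim auto
  moreover have "w x = 0" if "x \<notin> K" for x using that by (simp add: w_def)
  ultimately show ?thesis using wint by (intro exI[of _ w] conjI allI impI; (elim conjE)?; blast)
qed

lemma convol_mollifier_support:
  assumes k: "mollifier c r k" and L: "\<And>x. x \<notin> L \<Longrightarrow> f x = 0"
    and z: "z \<notin> {x + y | x y. x \<in> L \<and> y \<in> cball c r}"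
  shows "convol f k z = 0"
proof -
  have "f x * k (z - x) = 0" for x
  proof (cases "x \<in> L")
    case True
    then have "z - x \<notin> cball c r" using z by force
    then show ?thesis using mollifierD(3)[OF k] by simp
  qed (simp add: L)
  then show ?thesis by (simp only: convol_def Bochner_Integration.integral_zero)
qed

lemma convol_mollifier_close:
  fixes f :: "'a::euclidean_space \<Rightarrow> real"
  assumes k: "mollifier 0 r k" and f: "continuous_on UNIV f" "compact K" "\<And>x. x \<notin> K \<Longrightarrow> f x = 0"
    and e: "\<And>x y. dist x y \<le> r \<Longrightarrow> \<bar>f x - f y\<bar> \<le> e"
  shows "\<bar>convol f k z - f z\<bar> \<le> e"
proof -
  note kk = mollifierD[OF k]
  have k': "integrable lborel (\<lambda>x. k (z - x))" "(\<integral>x. k (z - x) \<partial>lborel) = 1"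
    using lborel_integral_affine[OF _ kk(7), of "-1" z] kk(4,6) by simp_all
  have fk: "integrable lborel (\<lambda>x. f x * k (z - x))"
    by (rule convol_integrand_integrable[OF continuous_compact_support_integrable[OF f] kk(5) compact_cball kk(3)])
  have "convol f k z - f z = (\<integral>x. f x * k (z - x) \<partial>lborel) - (\<integral>x. f z * k (z - x) \<partial>lborel)"
    using k' by (simp add: convol_def)
  also have "\<dots> = (\<integral>x. (f x - f z) * k (z - x) \<partial>lborel)"
    using fk k'(1) by (simp add: left_diff_distrib)
  also have "\<bar>\<dots>\<bar> \<le> (\<integral>x. e * k (z - x) \<partial>lborel)"
  proof (intro integral_abs_bound[THEN order_trans] integral_mono)
    show "integrable lborel (\<lambda>x. \<bar>(f x - f z) * k (z - x)\<bar>)"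
      using fk k'(1) by (intro integrable_abs) (simp add: left_diff_distrib)
    show "\<bar>(f x - f z) * k (z - x)\<bar> \<le> e * k (z - x)" for x
    proof (cases "z - x \<in> cball 0 r")
      case True
      then show ?thesis using e[of x z] kk(2)[of "z - x"]
        by (simp add: dist_norm norm_minus_commute abs_mult mult_right_mono)
    qed (simp add: kk(3))
  qed (use k'(1) in simp)
  also have "\<dots> = e" using k'(2) by simp
  finally show ?thesis .
qed

text \<open>Mollification at a radius \<open>r \<le> d\<close> turns \<open>c\<close> into a test
  function of \<open>D\<close> that is uniformly within \<open>e / N\<close> of
  \<open>c\<close>.\<close>

lemma integral_continuous_eq_0:
  fixes v :: "'a::euclidean_space \<Rightarrow> real"
  assumes D: "open D" and v: "locally_integrable D v"
    and test: "\<And>\<psi>. test_function D \<psi> \<Longrightarrow> (LINT x|lebesgue_on D. v x * \<psi> x) = 0"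
    and c: "continuous_on UNIV c" "compact L" "L \<subseteq> D" "\<And>x. x \<notin> L \<Longrightarrow> c x = 0"
  shows "(LINT x|lebesgue_on D. v x * c x) = 0"
proof -
  obtain d where d: "d > 0" "(\<Union>x\<in>L. cball x d) \<subseteq> D"
    using compact_subset_open_imp_cball_epsilon_subset[OF c(2) D c(3)] by blast
  define L' where "L' = {x + y | x y. x \<in> L \<and> y \<in> cball 0 d}"
  have L': "compact L'" unfolding L'_def using c(2) by (intro compact_sums) auto
  have "L' \<subseteq> D"
  proof
    fix z assume "z \<in> L'"
    then obtain x y where xy: "x \<in> L" "norm y \<le> d" "z = x + y" by (auto simp: L'_def)
    then have "z \<in> cball x d" by (simp add: dist_norm)
    then show "z \<in> D" using d(2) xy(1) by blast
  qed
  obtain w where w: "integrable lborel w"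
    "\<And>\<phi>. \<phi> \<in> borel_measurable borel \<Longrightarrow> \<forall>x. x \<notin> L' \<longrightarrow> \<phi> x = 0 \<Longrightarrow>
      (LINT x|lebesgue_on D. v x * \<phi> x) = (\<integral>x. w x * \<phi> x \<partial>lborel)"
    using locally_integrable_borel[OF v D L' \<open>L' \<subseteq> D\<close>] by blast
  have cm: "c \<in> borel_measurable borel" using c(1) by (rule borel_measurable_continuous_onI)
  have cL': "c x = 0" if "x \<notin> L'" for x
  proof -
    have "x \<in> L'" if "x \<in> L" unfolding L'_def using that d(1) by (intro CollectI exI[of _ x] exI[of _ 0]) simp
    then show ?thesis using that c(4) by blast
  qed
  obtain B where B: "\<And>x. \<bar>c x\<bar> \<le> B" using continuous_compact_support_bounded[OF c(1,2,4)] by metis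
  define N where "N = (\<integral>x. \<bar>w x\<bar> \<partial>lborel) + 1"
  have N: "N > 0" unfolding N_def by (intro add_nonneg_pos integral_nonneg) auto
  have "\<bar>\<integral>x. w x * c x \<partial>lborel\<bar> \<le> e" if e: "e > 0" for e
  proof -
    obtain \<delta> where \<delta>: "\<delta> > 0" "\<And>x y. dist x y < \<delta> \<Longrightarrow> \<bar>c x - c y\<bar> < e / N"
      using continuous_compact_support_uniform[OF c(1,2,4), of "e / N"] e N by auto
    define r where "r = min d (\<delta> / 2)"
    have r: "r > 0" "r \<le> d" "r < \<delta>" using d(1) \<delta>(1) by (auto simp: r_def)
    obtain k :: "'a \<Rightarrow> real" where k: "mollifier 0 r k" using mollifier_exists[OF r(1)] by blast
    note kk = mollifierD[OF k]
    have ci: "integrable lborel c" by (rule continuous_compact_support_integrable[OF c(1,2,4)])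
    have sm: "smooth (convol c k)" by (rule smooth_convol[OF ci kk(1) compact_cball kk(3)])
    have out: "convol c k z = 0" if "z \<notin> L'" for z
      by (rule convol_mollifier_support[OF k c(4)]) (use that r(2) in \<open>auto simp: L'_def\<close>)
    have m: "convol c k \<in> borel_measurable borel"
      using smooth_continuous[OF sm] by (rule borel_measurable_continuous_onI)
    have "test_function D (convol c k)"
      using sm L' \<open>L' \<subseteq> D\<close> out by (auto simp: test_function_def)
    then have 0: "(\<integral>x. w x * convol c k x \<partial>lborel) = 0" using test w(2)[OF m] out by simp
    have close: "\<bar>convol c k z - c z\<bar> \<le> e / N" for z
      by (rule convol_mollifier_close[OF k c(1,2,4)]) (use \<delta>(2) r(3) in \<open>auto intro: less_imp_le\<close>)
    have bd: "\<bar>convol c k z\<bar> \<le> e / N + B" for z using close[of z] B[of z] by linarith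
    have i1: "integrable lborel (\<lambda>x. w x * convol c k x)"
      by (rule integrable_mult_bounded[OF w(1) m bd])
    have i2: "integrable lborel (\<lambda>x. w x * c x)" by (rule integrable_mult_bounded[OF w(1) cm B])
    have "\<bar>\<integral>x. w x * c x \<partial>lborel\<bar> = \<bar>\<integral>x. w x * c x - w x * convol c k x \<partial>lborel\<bar>"
      using i1 i2 0 by simp
    also have "\<dots> \<le> (\<integral>x. \<bar>w x\<bar> * (e / N) \<partial>lborel)"
    proof (intro integral_abs_bound[THEN order_trans] integral_mono)
      show "\<bar>w x * c x - w x * convol c k x\<bar> \<le> \<bar>w x\<bar> * (e / N)" for x
      proof -
        have "\<bar>w x * c x - w x * convol c k x\<bar> = \<bar>w x\<bar> * \<bar>convol c k x - c x\<bar>"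
          by (simp add: abs_mult[symmetric] right_diff_distrib abs_minus_commute)
        then show ?thesis using mult_left_mono[OF close, of "\<bar>w x\<bar>" x] by simp
      qed
    qed (use w(1) i1 i2 in auto)
    also have "\<dots> = (N - 1) * (e / N)" by (simp add: N_def)
    also have "\<dots> \<le> e" using N e by (simp add: field_simps)
    finally show ?thesis .
  qed
  then have "\<bar>\<integral>x. w x * c x \<partial>lborel\<bar> \<le> 0" by (rule field_le_epsilon) simp
  then show ?thesis using w(2)[OF cm] cL' by simp
qed

text \<open>Testing with continuous functions that converge boundedly to the sign of
  \<open>v\<close> on a compact \<open>K\<close> makes the integral of
  \<open>\<bar>v x\<bar>\<close> over \<open>K\<close> vanish; countably many such \<open>K\<close>
  exhaust \<open>D\<close>.\<close>

lemma fundamental_lemma: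
  fixes v :: "'a::euclidean_space \<Rightarrow> real"
  assumes D: "open D" and v: "locally_integrable D v"
    and test: "\<And>\<psi>. test_function D \<psi> \<Longrightarrow> (LINT x|lebesgue_on D. v x * \<psi> x) = 0"
  shows "AE x in lebesgue_on D. v x = 0"
proof -
  have K0: "AE x in lborel. x \<in> K \<longrightarrow> v x = 0" if K: "compact K" "K \<subseteq> D" for K
  proof -
    obtain u where u: "integrable lborel u" "\<And>x. x \<notin> K \<Longrightarrow> u x = 0" "AE x in lborel. x \<in> K \<longrightarrow> u x = v x"
      using locally_integrable_borel[OF v D K] by blast
    define b where "b x = sgn (u x)" for x
    have [measurable]: "u \<in> borel_measurable borel" using u(1) by auto
    have bm: "b \<in> borel_measurable borel" unfolding b_def sgn_if by measurable
    have b: "\<bar>b x\<bar> \<le> 1" "x \<notin> K \<Longrightarrow> b x = 0" for x using u(2) by (auto simp: b_def sgn_if)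
    obtain L c where c: "compact L" "L \<subseteq> D" "\<And>n. continuous_on UNIV (c n)"
      "\<And>n x. x \<notin> L \<Longrightarrow> c n x = 0" "\<And>n x. \<bar>c n x\<bar> \<le> 1" "AE x in lborel. (\<lambda>n. c n x) \<longlonglongrightarrow> b x"
      using continuous_approximation[OF bm b(1) K(1) b(2) D K(2)] by blast
    \<comment> \<open>The approximants of \<open>b\<close> may spread beyond \<open>K\<close> into
      \<open>L\<close>, so the pairing needs a second representative \<open>w\<close> of
      \<open>v\<close>, valid on \<open>L \<union> K\<close>.\<close>
    have M: "compact (L \<union> K)" "L \<union> K \<subseteq> D" using c(1,2) K by auto
    obtain w where w: "integrable lborel w" "AE x in lborel. x \<in> L \<union> K \<longrightarrow> w x = v x"
      "\<And>\<phi>. \<phi> \<in> borel_measurable borel \<Longrightarrow> \<forall>x. x \<notin> L \<union> K \<longrightarrow> \<phi> x = 0 \<Longrightarrow>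
        (LINT x|lebesgue_on D. v x * \<phi> x) = (\<integral>x. w x * \<phi> x \<partial>lborel)"
      using locally_integrable_borel[OF v D M] by blast
    have [measurable]: "w \<in> borel_measurable borel" using w(1) by auto
    have cm [measurable]: "c n \<in> borel_measurable borel" for n
      using c(3) by (rule borel_measurable_continuous_onI)
    have "(\<integral>x. w x * c n x \<partial>lborel) = 0" for n
    proof -
      have "(LINT x|lebesgue_on D. v x * c n x) = 0"
        by (rule integral_continuous_eq_0[OF D v test c(3) c(1,2) c(4)])
      moreover have "(LINT x|lebesgue_on D. v x * c n x) = (\<integral>x. w x * c n x \<partial>lborel)"
        using c(4) by (intro w(3) cm) auto
      ultimately show ?thesis by simp
    qed
    moreover have "(\<lambda>n. \<integral>x. w x * c n x \<partial>lborel) \<longlonglongrightarrow> (\<integral>x. w x * b x \<partial>lborel)"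
    proof (rule integral_dominated_convergence[where w = "\<lambda>x. \<bar>w x\<bar>"])
      show "AE x in lborel. (\<lambda>n. w x * c n x) \<longlonglongrightarrow> w x * b x"
        using c(6) by eventually_elim (intro tendsto_intros)
      show "AE x in lborel. norm (w x * c n x) \<le> \<bar>w x\<bar>" for n
        using c(5) mult_left_mono[of "\<bar>c n _\<bar>" 1 "\<bar>w _\<bar>"] by (simp add: abs_mult)
    qed (use w(1) bm in auto)
    ultimately have "(\<integral>x. w x * b x \<partial>lborel) = 0" by (simp add: LIMSEQ_const_iff)
    moreover have "AE x in lborel. w x * b x = \<bar>u x\<bar>"
      using w(2) u(3)
    proof eventually_elim
      case (elim x)
      then show ?case using u(2)[of x] by (cases "x \<in> K") (auto simp: b_def sgn_if)
    qed
    then have "(\<integral>x. w x * b x \<partial>lborel) = (\<integral>x. \<bar>u x\<bar> \<partial>lborel)"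
      using bm by (intro integral_cong_AE) auto
    ultimately have "(\<integral>x. \<bar>u x\<bar> \<partial>lborel) = 0" by simp
    then have "AE x in lborel. u x = 0"
      using integral_nonneg_eq_0_iff_AE[of lborel "\<lambda>x. \<bar>u x\<bar>"] u(1) by simp
    then show ?thesis using u(3) by eventually_elim auto
  qed
  obtain C where C: "\<And>n::nat. compact (C n)" "\<And>n. C n \<subseteq> D" "\<Union> (range C) = D"
    using open_Union_compact_subsets[OF D] by metis
  have "AE x in lborel. \<forall>n. x \<in> C n \<longrightarrow> v x = 0"
    unfolding AE_all_countable using K0[OF C(1,2)] by blast
  then have "AE x in lborel. x \<in> D \<longrightarrow> v x = 0"
    by eventually_elim (use C(3) in blast)
  then show ?thesis using D by (simp add: AE_lebesgue_on_iff lebesgue_open)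
qed

section \<open>Rules for weak derivatives\<close>

lemma test_function_partial_deriv:
  "test_function D \<psi> \<Longrightarrow> b \<in> Basis \<Longrightarrow> test_function D (partial_deriv b \<psi>)"
  unfolding test_function_def by (metis partial_deriv_outside_support smooth_partial_deriv)

lemma locally_integrable_test_integrable:
  assumes "locally_integrable D v" "open D" "test_function D \<psi>"
  shows "integrable (lebesgue_on D) (\<lambda>x. v x * \<psi> x)"
proof -
  obtain K where K: "compact K" "K \<subseteq> D" "\<And>x. x \<notin> K \<Longrightarrow> \<psi> x = 0" "smooth \<psi>"
    using assms(3) unfolding test_function_def by blast
  note c = smooth_continuous[OF K(4), of UNIV]
  obtain B where B: "\<And>x. \<bar>\<psi> x\<bar> \<le> B" using continuous_compact_support_bounded[OF c K(1,3)] by metis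
  show ?thesis
    using locally_integrable_borel[OF assms(1,2) K(1,2)] borel_measurable_continuous_onI[OF c] K(3) B by blast
qed

lemma locally_integrable_add:
  "locally_integrable D u \<Longrightarrow> locally_integrable D v \<Longrightarrow> locally_integrable D (\<lambda>x. u x + v x)"
  by (simp add: locally_integrable_def)

lemma locally_integrable_uminus:
  "locally_integrable D u \<Longrightarrow> locally_integrable D (\<lambda>x. - u x)"
  by (simp add: locally_integrable_def)

lemma locally_integrable_cong_AE:
  fixes u v :: "'a::euclidean_space \<Rightarrow> real"
  assumes "locally_integrable D u" "AE x in lebesgue_on D. u x = v x" "open D"
  shows "locally_integrable D v"
  unfolding locally_integrable_def
proof (intro allI impI)
  fix K assume K: "compact K \<and> K \<subseteq> D"
  have Kl: "K \<in> sets lebesgue" using K by (simp add: borel_closed compact_imp_closed)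
  have "integrable (lebesgue_on K) u" using assms(1) K by (simp add: locally_integrable_def)
  then have i: "integrable lebesgue (\<lambda>x. indicator K x *\<^sub>R u x)"
    using Kl by (simp add: integrable_restrict_space)
  have "AE x in lebesgue. x \<in> D \<longrightarrow> u x = v x"
    using assms(2,3) AE_completion by (simp add: AE_lebesgue_on_iff lebesgue_open)
  then have eq: "AE x in lebesgue. indicator K x *\<^sub>R u x = indicator K x *\<^sub>R v x"
    by eventually_elim (use K in \<open>auto simp: indicator_def\<close>)
  have "integrable lebesgue (\<lambda>x. indicator K x *\<^sub>R v x)"
    by (rule Bochner_Integration.integrable_cong_AE_imp[OF i
        borel_measurable_AE[OF borel_measurable_integrable[OF i] eq] eq])
  then show "integrable (lebesgue_on K) v" using Kl by (simp add: integrable_restrict_space)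
qed

lemma lebesgue_on_integral_cong:
  fixes u v \<psi> :: "'a::euclidean_space \<Rightarrow> real"
  assumes "locally_integrable D u" "AE x in lebesgue_on D. u x = v x" "open D" "test_function D \<psi>"
  shows "(LINT x|lebesgue_on D. u x * \<psi> x) = (LINT x|lebesgue_on D. v x * \<psi> x)"
proof (rule integral_cong_AE)
  show "(\<lambda>x. u x * \<psi> x) \<in> borel_measurable (lebesgue_on D)"
    using locally_integrable_test_integrable[OF assms(1,3,4)] by auto
  show "(\<lambda>x. v x * \<psi> x) \<in> borel_measurable (lebesgue_on D)"
    using locally_integrable_test_integrable[OF locally_integrable_cong_AE[OF assms(1-3)] assms(3,4)] by auto
  show "AE x in lebesgue_on D. u x * \<psi> x = v x * \<psi> x" using assms(2) by eventually_elim simp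
qed

lemma has_weak_deriv_cong:
  assumes "has_weak_deriv D b u v" "AE x in lebesgue_on D. u x = u' x" "AE x in lebesgue_on D. v x = v' x"
    "open D" "b \<in> Basis"
  shows "has_weak_deriv D b u' v'"
  unfolding has_weak_deriv_def
proof (intro conjI allI impI)
  have uv: "locally_integrable D u" "locally_integrable D v"
    using assms(1) by (auto simp: has_weak_deriv_def)
  show "locally_integrable D u'" "locally_integrable D v'"
    using uv assms by (auto intro: locally_integrable_cong_AE)
  fix \<psi> assume \<psi>: "test_function D \<psi>"
  then have "(LINT x|lebesgue_on D. u x * partial_deriv b \<psi> x) = - (LINT x|lebesgue_on D. v x * \<psi> x)"
    using assms(1) by (auto simp: has_weak_deriv_def)
  then show "(LINT x|lebesgue_on D. u' x * partial_deriv b \<psi> x) = - (LINT x|lebesgue_on D. v' x * \<psi> x)"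
    using lebesgue_on_integral_cong[OF uv(1) assms(2,4) test_function_partial_deriv[OF \<psi> assms(5)]]
      lebesgue_on_integral_cong[OF uv(2) assms(3,4) \<psi>] by simp
qed

lemma has_weak_deriv_add:
  assumes "has_weak_deriv D b u v" "has_weak_deriv D b u' v'" "open D" "b \<in> Basis"
  shows "has_weak_deriv D b (\<lambda>x. u x + u' x) (\<lambda>x. v x + v' x)"
  using assms unfolding has_weak_deriv_def
  by (simp add: locally_integrable_add distrib_right Bochner_Integration.integral_add
      locally_integrable_test_integrable test_function_partial_deriv)

lemma has_weak_deriv_uminus:
  assumes "has_weak_deriv D b u v"
  shows "has_weak_deriv D b (\<lambda>x. - u x) (\<lambda>x. - v x)"
  using assms unfolding has_weak_deriv_def by (simp add: locally_integrable_uminus)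

lemma has_weak_deriv_diff:
  assumes "has_weak_deriv D b u v" "has_weak_deriv D b u' v'" "open D" "b \<in> Basis"
  shows "has_weak_deriv D b (\<lambda>x. u x - u' x) (\<lambda>x. v x - v' x)"
  using has_weak_deriv_add[OF assms(1) has_weak_deriv_uminus[OF assms(2)] assms(3,4)] by simp

text \<open>The difference of two candidates is a weak derivative of 0, hence orthogonal to every
  test function.\<close>

lemma has_weak_deriv_unique:
  assumes "has_weak_deriv D b u v" "has_weak_deriv D b u' v'" "AE x in lebesgue_on D. u x = u' x"
    "open D" "b \<in> Basis"
  shows "AE x in lebesgue_on D. v x = v' x"
proof -
  have *: "has_weak_deriv D b (\<lambda>x. u x - u' x) (\<lambda>x. v x - v' x)"
    using assms by (intro has_weak_deriv_diff)
  have "has_weak_deriv D b (\<lambda>x. 0) (\<lambda>x. v x - v' x)"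
    by (rule has_weak_deriv_cong[OF *]) (use assms(3-5) in \<open>auto elim: eventually_mono\<close>)
  then have "AE x in lebesgue_on D. v x - v' x = 0"
    by (intro fundamental_lemma[OF assms(4)]) (auto simp: has_weak_deriv_def)
  then show ?thesis by eventually_elim simp
qed

lemma weak_deriv_has_weak_deriv:
  "has_weak_deriv D b u v \<Longrightarrow> has_weak_deriv D b u (weak_deriv D b u)"
  unfolding weak_deriv_def using someI[of "has_weak_deriv D b u" v] .

lemma weak_deriv_AE_eq:
  assumes "has_weak_deriv D b u v" "open D" "b \<in> Basis"
  shows "AE x in lebesgue_on D. weak_deriv D b u x = v x"
  using has_weak_deriv_unique[OF weak_deriv_has_weak_deriv[OF assms(1)] assms(1)] assms(2,3) by simp

text \<open>Two integrations by parts move both derivatives to the test function, the signs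
  cancelling, and there the order is immaterial.\<close>

lemma has_weak_deriv_commute:
  assumes D: "open D" and b: "b \<in> Basis" and c: "c \<in> Basis"
    and "has_weak_deriv D b u v" "has_weak_deriv D c v w"
    and "has_weak_deriv D c u v'" "has_weak_deriv D b v' w'"
  shows "AE x in lebesgue_on D. w x = w' x"
proof -
  have lw: "locally_integrable D w" "locally_integrable D w'"
    using assms by (auto simp: has_weak_deriv_def)
  have "AE x in lebesgue_on D. w x - w' x = 0"
  proof (rule fundamental_lemma[OF D])
    show "locally_integrable D (\<lambda>x. w x - w' x)"
      using locally_integrable_add[OF lw(1) locally_integrable_uminus[OF lw(2)]] by simp
    fix \<psi> assume \<psi>: "test_function D \<psi>"
    then have "cont_diff 2 \<psi>" by (auto simp: test_function_def smooth_def)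
    then have comm: "partial_deriv b (partial_deriv c \<psi>) = partial_deriv c (partial_deriv b \<psi>)"
      using partial_deriv_commute[OF _ b c] by auto
    have swap: "(LINT x|lebesgue_on D. w x * \<psi> x) = (LINT x|lebesgue_on D. u x * partial_deriv b (partial_deriv c \<psi>) x)"
      if "has_weak_deriv D b u v" "has_weak_deriv D c v w" "b \<in> Basis" "c \<in> Basis" for b c v w
      using that \<psi> test_function_partial_deriv[OF \<psi>, of c] by (simp add: has_weak_deriv_def)
    have "(LINT x|lebesgue_on D. w x * \<psi> x) = (LINT x|lebesgue_on D. w' x * \<psi> x)"
      using swap[OF assms(4,5) b c] swap[OF assms(6,7) c b] comm by simp
    then show "(LINT x|lebesgue_on D. (w x - w' x) * \<psi> x) = 0"
      using locally_integrable_test_integrable[OF _ D \<psi>] lw by (simp add: left_diff_distrib)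
  qed
  then show ?thesis by eventually_elim simp
qed

section \<open>Second weak derivatives and the curl-curl identity\<close>

lemma sobolev_has_weak_partial:
  assumes "sobolev (Suc k) D u"
  shows "has_weak_deriv D (axis i 1) u (weak_partial D i u)"
  using assms weak_deriv_has_weak_deriv unfolding weak_partial_def by fastforce

text \<open>\<open>weak_partial\<close> is an unspecified representative, so it is computed only
  almost everywhere; \<open>u'\<close> allows for data such as \<open>a\<close> and \<open>f\<close>
  that equal a known expression only off a null set.\<close>

lemma weak_partial_AE_eq:
  assumes "has_weak_deriv D (axis i 1) u v" "AE x in lebesgue_on D. u' x = u x" "open D"
  shows "AE x in lebesgue_on D. weak_partial D i u' x = v x"
  unfolding weak_partial_def
proof (rule weak_deriv_AE_eq[OF _ assms(3)])
  show "has_weak_deriv D (axis i 1) u' v"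
    by (rule has_weak_deriv_cong[OF assms(1) AE_symmetric[OF assms(2)] _ assms(3)]) auto
qed auto

text \<open>\<open>sobolev\<close> supplies some weak derivative \<open>v\<close> that can be
  differentiated again, and \<open>weak_partial D j u\<close> is known to equal it only almost
  everywhere; the differentiability is carried over.\<close>

lemma sobolev_has_weak_partial2:
  assumes "sobolev (Suc (Suc k)) D u" "open D"
  shows "has_weak_deriv D (axis i 1) (weak_partial D j u) (weak_partial D i (weak_partial D j u))"
proof -
  have "axis j 1 \<in> (Basis :: (real^3) set)" by simp
  then obtain v where v: "has_weak_deriv D (axis j 1) u v" "sobolev (Suc k) D v"
    using assms(1) by (metis sobolev.simps(2))
  have "AE x in lebesgue_on D. weak_partial D j u x = v x"
    by (rule weak_partial_AE_eq[OF v(1) _ assms(2)]) simp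
  then have "has_weak_deriv D (axis i 1) (weak_partial D j u) (weak_partial D i v)"
    by (intro has_weak_deriv_cong[OF sobolev_has_weak_partial[OF v(2)] AE_symmetric _ assms(2)]) auto
  then show ?thesis unfolding weak_partial_def by (rule weak_deriv_has_weak_deriv)
qed

lemma weak_partial_commute:
  assumes "sobolev (Suc (Suc k)) D u" "open D"
  shows "AE x in lebesgue_on D. weak_partial D i (weak_partial D j u) x = weak_partial D j (weak_partial D i u) x"
  by (rule has_weak_deriv_commute[of D "axis j 1" "axis i 1" u "weak_partial D j u" _ "weak_partial D i u"])
    (use assms in \<open>auto simp del: sobolev.simps intro: sobolev_has_weak_partial sobolev_has_weak_partial2\<close>)

text \<open>Written out in second derivatives, the two sides differ only by the order of
  differentiation in the mixed terms. All exceptional null sets are merged first, so that the rest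
  is algebra at a single point \<open>x\<close>.\<close>

lemma weak_laplacian_eq_curl_curl:
  fixes A a :: "real^3 \<Rightarrow> real^3" and f :: "real^3 \<Rightarrow> real"
  assumes D: "open D" and A: "sobolev_vec 2 D A"
    and a: "AE x in lebesgue_on D. a x = weak_curl D A x"
    and f: "AE x in lebesgue_on D. f x = weak_div D A x"
  shows "AE x in lebesgue_on D. - weak_laplacian D A x = weak_curl D a x - weak_grad D f x"
proof -
  define d where "d i j = weak_partial D i (\<lambda>y. A y $ j)" for i j
  define e where "e k i j = weak_partial D k (d i j)" for k i j
  have S: "sobolev (Suc (Suc 0)) D (\<lambda>y. A y $ j)" for j
    using A by (simp add: sobolev_vec_def numeral_2_eq_2)
  have e: "has_weak_deriv D (axis k 1) (d i j) (e k i j)" for k i j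
    unfolding e_def d_def by (rule sobolev_has_weak_partial2[OF S D])
  have comm: "AE x in lebesgue_on D. \<forall>k i j. e k i j x = e i k j x"
    using weak_partial_commute[OF S D] by (auto simp: AE_all_countable e_def d_def)
  have diff: "AE x in lebesgue_on D. \<forall>k. weak_partial D k (\<lambda>y. a y $ l) x = e k i j x - e k i' j' x"
    if "AE x in lebesgue_on D. a x $ l = d i j x - d i' j' x" for l i j i' j'
    unfolding AE_all_countable using that D
    by (intro allI weak_partial_AE_eq[OF has_weak_deriv_diff[OF e e]]) auto
  have a1: "AE x in lebesgue_on D. \<forall>k. weak_partial D k (\<lambda>y. a y $ 1) x = e k 2 3 x - e k 3 2 x"
    and a2: "AE x in lebesgue_on D. \<forall>k. weak_partial D k (\<lambda>y. a y $ 2) x = e k 3 1 x - e k 1 3 x"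
    and a3: "AE x in lebesgue_on D. \<forall>k. weak_partial D k (\<lambda>y. a y $ 3) x = e k 1 2 x - e k 2 1 x"
    by (rule diff, use a in eventually_elim, simp add: weak_curl_def d_def)+
  have "AE x in lebesgue_on D. f x = d 1 1 x + d 2 2 x + d 3 3 x"
    using f by eventually_elim (simp add: weak_div_def d_def sum_3)
  then have fk: "AE x in lebesgue_on D. \<forall>k. weak_partial D k f x = e k 1 1 x + e k 2 2 x + e k 3 3 x"
    unfolding AE_all_countable using D
    by (intro allI weak_partial_AE_eq[OF has_weak_deriv_add[OF has_weak_deriv_add[OF e e] e]]) auto
  show ?thesis
    using comm a1 a2 a3 fk
  proof eventually_elim
    case (elim x)
    have "weak_laplacian D A x $ j = e 1 1 j x + e 2 2 j x + e 3 3 j x" for j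
      by (simp add: weak_laplacian_def sum_3 e_def d_def)
    moreover have "e 2 1 j x = e 1 2 j x" "e 3 1 j x = e 1 3 j x" "e 3 2 j x = e 2 3 j x" for j
      using elim(1) by blast+
    ultimately show ?case using elim(2-)
      by (simp add: vec_eq_iff forall_3 weak_curl_def weak_grad_def)
  qed
qed

section \<open>Borel sets and two-dimensional Hausdorff measure\<close>

lemma hausdorff2_pre_mono: "E \<subseteq> F \<Longrightarrow> hausdorff2_pre \<delta> E \<le> hausdorff2_pre \<delta> F"
  unfolding hausdorff2_pre_def by (intro INF_superset_mono) auto

lemma hausdorff2_pre_antimono: "\<delta> \<le> \<delta>' \<Longrightarrow> hausdorff2_pre \<delta>' E \<le> hausdorff2_pre \<delta> E"
  unfolding hausdorff2_pre_def by (intro INF_superset_mono) (auto intro: order_trans)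

lemma hausdorff2_outer_mono: "E \<subseteq> F \<Longrightarrow> hausdorff2_outer E \<le> hausdorff2_outer F"
  unfolding hausdorff2_outer_def by (intro SUP_mono) (use hausdorff2_pre_mono in blast)

lemma hausdorff2_outer_empty [simp]: "hausdorff2_outer ({} :: 'a::euclidean_space set) = 0"
  using outer_measure_space_hausdorff2_outer by (auto simp: outer_measure_space_def positive_def)

text \<open>\<open>countably_subadditive\<close> speaks of disjoint families;
  \<open>disjointed\<close> and monotonicity give the general case.\<close>

lemma hausdorff2_outer_UN_le:
  fixes E :: "nat \<Rightarrow> 'a::euclidean_space set"
  shows "hausdorff2_outer (\<Union>i. E i) \<le> (\<Sum>i. hausdorff2_outer (E i))"
proof -
  have ca: "countably_subadditive UNIV (hausdorff2_outer :: 'a set \<Rightarrow> ennreal)"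
    and inc: "increasing UNIV (hausdorff2_outer :: 'a set \<Rightarrow> ennreal)"
    using outer_measure_space_hausdorff2_outer by (auto simp: outer_measure_space_def)
  have "(\<Union>i. disjointed E i) = (\<Union>i. E i)" by (rule UN_disjointed_eq)
  then have "hausdorff2_outer (\<Union>i. E i) \<le> (\<Sum>i. hausdorff2_outer (disjointed E i))"
    using ca disjoint_family_disjointed[of E] unfolding countably_subadditive_def
    by (metis UNIV_I subset_UNIV)
  also have "\<dots> \<le> (\<Sum>i. hausdorff2_outer (E i))"
    by (intro suminf_le hausdorff2_outer_mono disjointed_subset) auto
  finally show ?thesis .
qed

lemma hausdorff2_outer_Un_le:
  "hausdorff2_outer (A \<union> B) \<le> hausdorff2_outer A + hausdorff2_outer (B :: 'a::euclidean_space set)"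
proof -
  define E where "E i = (if i = 0 then A else if i = Suc 0 then B else {})" for i :: nat
  have "(\<Sum>i. hausdorff2_outer (E i)) = (\<Sum>i\<in>{0, Suc 0}. hausdorff2_outer (E i))"
    by (intro suminf_finite) (auto simp: E_def)
  moreover have "(\<Union>i. E i) = A \<union> B" by (auto simp: E_def split: if_splits)
  ultimately show ?thesis using hausdorff2_outer_UN_le[of E] by (simp add: E_def)
qed

text \<open>A set of diameter at most \<open>\<delta>\<close> cannot meet both \<open>A\<close> and
  \<open>B\<close>, so a cover of the union splits into covers of the two parts.\<close>

lemma hausdorff2_pre_separated:
  fixes A B :: "'a::euclidean_space set"
  assumes d: "\<And>x y. x \<in> A \<Longrightarrow> y \<in> B \<Longrightarrow> \<delta> < dist x y" and "\<delta> > 0"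
  shows "hausdorff2_pre \<delta> A + hausdorff2_pre \<delta> B \<le> hausdorff2_pre \<delta> (A \<union> B)"
  unfolding hausdorff2_pre_def[of \<delta> "A \<union> B"]
proof (rule INF_greatest)
  fix C :: "nat \<Rightarrow> 'a set"
  assume "C \<in> {C. A \<union> B \<subseteq> (\<Union>n. C n) \<and> (\<forall>n. bounded (C n) \<and> diameter (C n) \<le> \<delta>)}"
  then have C: "A \<union> B \<subseteq> (\<Union>n. C n)" "\<And>n. bounded (C n)" "\<And>n. diameter (C n) \<le> \<delta>" by auto
  \<comment> \<open>Members that miss \<open>S\<close> are replaced by the empty set, of diameter 0;
    this keeps the index set, so the two sums can be added termwise.\<close>
  define part where "part S n = (if C n \<inter> S = {} then {} else C n)" for S n
  let ?a = "\<lambda>S n. ennreal (pi / 4 * (diameter (part S n))\<^sup>2)"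
  have le: "hausdorff2_pre \<delta> S \<le> (\<Sum>n. ?a S n)" if "S \<subseteq> A \<union> B" for S
    unfolding hausdorff2_pre_def
  proof (rule INF_lower, safe)
    show "x \<in> (\<Union>n. part S n)" if xS: "x \<in> S" for x
    proof -
      obtain n where "x \<in> C n" using xS \<open>S \<subseteq> A \<union> B\<close> C(1) by blast
      then have "x \<in> part S n" using xS by (auto simp: part_def)
      then show ?thesis by blast
    qed
    show "bounded (part S n)" "diameter (part S n) \<le> \<delta>" for n
      using C(2,3) \<open>\<delta> > 0\<close> by (auto simp: part_def)
  qed
  have "C n \<inter> A = {} \<or> C n \<inter> B = {}" for n
  proof (rule ccontr)
    assume "\<not> ?thesis"
    then obtain x y where "x \<in> C n" "y \<in> C n" "x \<in> A" "y \<in> B" by blast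
    then show False using d diameter_bounded_bound[OF C(2)] C(3)[of n] by force
  qed
  then have part: "?a A n + ?a B n \<le> ennreal (pi / 4 * (diameter (C n))\<^sup>2)" for n
    by (auto simp: part_def)
  have "hausdorff2_pre \<delta> A + hausdorff2_pre \<delta> B \<le> (\<Sum>n. ?a A n) + (\<Sum>n. ?a B n)"
    by (intro add_mono le) auto
  also have "\<dots> = (\<Sum>n. ?a A n + ?a B n)" by (intro suminf_add) auto
  also have "\<dots> \<le> (\<Sum>n. ennreal (pi / 4 * (diameter (C n))\<^sup>2))"
    by (intro suminf_le part) auto
  finally show "hausdorff2_pre \<delta> A + hausdorff2_pre \<delta> B \<le> (\<Sum>n. ennreal (pi / 4 * (diameter (C n))\<^sup>2))" .
qed

lemma hausdorff2_outer_separated: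
  fixes A B :: "'a::euclidean_space set"
  assumes d: "\<And>x y. x \<in> A \<Longrightarrow> y \<in> B \<Longrightarrow> d \<le> dist x y" and "d > 0"
  shows "hausdorff2_outer A + hausdorff2_outer B \<le> hausdorff2_outer (A \<union> B)"
proof -
  have "hausdorff2_outer A + hausdorff2_outer B
      = (SUP \<delta>\<in>{0<..}. hausdorff2_pre \<delta> A + hausdorff2_pre \<delta> B)"
    unfolding hausdorff2_outer_def
  proof (rule SUP_add_directed_ennreal[symmetric])
    fix i j :: real assume "i \<in> {0<..}" "j \<in> {0<..}"
    then show "\<exists>k\<in>{0<..}. hausdorff2_pre i A + hausdorff2_pre j B \<le> hausdorff2_pre k A + hausdorff2_pre k B"
      by (intro bexI[of _ "min i j"] add_mono hausdorff2_pre_antimono) auto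
  qed
  also have "\<dots> \<le> hausdorff2_outer (A \<union> B)"
  proof (rule SUP_least)
    fix \<delta> :: real assume "\<delta> \<in> {0<..}"
    \<comment> \<open>Lowering \<open>\<delta>\<close> only increases \<open>hausdorff2_pre\<close>,
      so it may be taken below the distance \<open>d\<close>.\<close>
    define \<delta>' where "\<delta>' = min \<delta> (d / 2)"
    have \<delta>': "0 < \<delta>'" "\<delta>' \<le> \<delta>" "\<delta>' < d" using \<open>\<delta> \<in> {0<..}\<close> \<open>d > 0\<close> by (auto simp: \<delta>'_def)
    have "hausdorff2_pre \<delta> A + hausdorff2_pre \<delta> B \<le> hausdorff2_pre \<delta>' A + hausdorff2_pre \<delta>' B"
      using \<delta>' by (intro add_mono hausdorff2_pre_antimono)
    also have "\<dots> \<le> hausdorff2_pre \<delta>' (A \<union> B)"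
      using \<delta>' d by (intro hausdorff2_pre_separated) (auto intro: less_le_trans)
    also have "\<dots> \<le> hausdorff2_outer (A \<union> B)"
      unfolding hausdorff2_outer_def using \<delta>' by (intro SUP_upper) auto
    finally show "hausdorff2_pre \<delta> A + hausdorff2_pre \<delta> B \<le> hausdorff2_outer (A \<union> B)" .
  qed
  finally show ?thesis .
qed

lemma hausdorff2_outer_separated_sum:
  fixes R :: "nat \<Rightarrow> 'a::euclidean_space set"
  assumes sep: "\<And>i j. i < j \<Longrightarrow> \<exists>d>0. \<forall>x\<in>R i. \<forall>y\<in>R j. d \<le> dist x y"
  shows "(\<Sum>i<n. hausdorff2_outer (R i)) \<le> hausdorff2_outer (\<Union>i<n. R i)"
proof (induction n)
  case (Suc n)
  obtain d where d: "\<And>i. i < n \<Longrightarrow> d i > 0 \<and> (\<forall>x\<in>R i. \<forall>y\<in>R n. d i \<le> dist x y)"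
    using sep[of _ n] by metis
  \<comment> \<open>The element 1 makes the minimum well defined for \<open>n = 0\<close>.\<close>
  define e where "e = Min (insert 1 (d ` {..<n}))"
  have e: "e > 0" "\<And>i. i < n \<Longrightarrow> e \<le> d i" using d by (auto simp: e_def)
  have "(\<Sum>i<Suc n. hausdorff2_outer (R i)) \<le> hausdorff2_outer (\<Union>i<n. R i) + hausdorff2_outer (R n)"
    using Suc.IH by (simp add: add_mono)
  also have "\<dots> \<le> hausdorff2_outer ((\<Union>i<n. R i) \<union> R n)"
  proof (rule hausdorff2_outer_separated[OF _ e(1)])
    fix x y assume "x \<in> (\<Union>i<n. R i)" "y \<in> R n"
    then obtain i where "i < n" "d i \<le> dist x y" using d by blast
    then show "e \<le> dist x y" using e(2) by (meson order_trans)
  qed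
  also have "(\<Union>i<n. R i) \<union> R n = (\<Union>i<Suc n. R i)" by (auto simp: less_Suc_eq)
  finally show ?case .
qed simp

lemma ennreal_suminf_tail_le:
  fixes f :: "nat \<Rightarrow> ennreal"
  assumes "(\<Sum>i. f i) < top" "e > 0"
  obtains n where "(\<Sum>i. f (i + n)) \<le> e"
proof -
  let ?S = "\<Sum>i. f i"
  have "(\<Sum>i<n. f i) \<le> ?S" for n by (rule sum_le_suminf) auto
  then have fin: "(\<Sum>i<n. f i) < top" for n using assms(1) by (rule order_le_less_trans)
  have lim: "(\<lambda>n. \<Sum>i<n. f i) \<longlonglongrightarrow> ?S" using summable_LIMSEQ[of f] by simp
  have "\<exists>n. ?S \<le> (\<Sum>i<n. f i) + e"
  proof (rule ccontr)
    assume "\<nexists>n. ?S \<le> (\<Sum>i<n. f i) + e"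
    then have "(\<Sum>i<n. f i) + e \<le> ?S" for n by (meson linear)
    moreover have "(\<lambda>n. (\<Sum>i<n. f i) + e) \<longlonglongrightarrow> ?S + e"
      using lim by (intro tendsto_add tendsto_const)
    ultimately have "?S + e \<le> ?S" using LIMSEQ_le_const2 by blast
    moreover have "?S + 0 < ?S + e"
      using assms by (subst ennreal_add_left_cancel_less) auto
    ultimately show False by simp
  qed
  then obtain n where "?S \<le> (\<Sum>i<n. f i) + e" by blast
  moreover have "?S = (\<Sum>i<n. f i) + (\<Sum>i. f (i + n))"
    using suminf_offset[of f n] by (simp add: add.commute)
  ultimately have "(\<Sum>i. f (i + n)) \<le> e"
    using fin[of n] ennreal_add_left_cancel_le by (metis less_irrefl infinity_ennreal_def)
  then show ?thesis using that by blast
qed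

text \<open>
  Caratheodory's criterion for metric outer measures: the shells \<open>R i\<close> around \<open>F\<close> with indices of the
  same parity are separated, so their outer measures are summable and the tail is negligible.
\<close>
lemma closed_in_sets_hausdorff2:
  fixes F :: "'a::euclidean_space set"
  assumes F: "closed F"
  shows "F \<in> sets hausdorff2"
proof (cases "F = {}")
  case False
  have "hausdorff2_outer (F \<inter> E) + hausdorff2_outer ((UNIV - F) \<inter> E) = hausdorff2_outer E" for E :: "'a set"
  proof (rule antisym)
    have "F \<inter> E \<union> (UNIV - F) \<inter> E = E" by blast
    then show "hausdorff2_outer E \<le> hausdorff2_outer (F \<inter> E) + hausdorff2_outer ((UNIV - F) \<inter> E)"
      using hausdorff2_outer_Un_le[of "F \<inter> E" "(UNIV - F) \<inter> E"] by simp
    show "hausdorff2_outer (F \<inter> E) + hausdorff2_outer ((UNIV - F) \<inter> E) \<le> hausdorff2_outer E"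
    proof (cases "hausdorff2_outer E < top")
      case fin: True
      define t where "t n = 1 / real (n + 1)" for n
      have t: "t n > 0" "t (Suc n) < t n" "m \<le> n \<Longrightarrow> t n \<le> t m" for m n
        by (auto simp: t_def field_simps)
      define A where "A n = {x \<in> E - F. t n \<le> infdist x F}" for n
      define R where "R n = {x \<in> E - F. t (Suc n) \<le> infdist x F \<and> infdist x F < t n}" for n
      \<comment> \<open>A point off the closed set \<open>F\<close> has positive distance to it; the
        least \<open>k\<close> with \<open>t k\<close> at most this distance puts the point into
        \<open>A n\<close> if \<open>k \<le> n\<close>, and into the shell \<open>R (k - 1)\<close>
        otherwise.\<close>
      have "(UNIV - F) \<inter> E \<subseteq> A n \<union> (\<Union>i. R (i + n))" for n
      proof
        fix x assume x: "x \<in> (UNIV - F) \<inter> E"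
        have "infdist x F \<noteq> 0" using in_closed_iff_infdist_zero[OF F False] x by blast
        then have pos: "infdist x F > 0" using infdist_nonneg[of x F] by linarith
        define k where "k = (LEAST k. t k \<le> infdist x F)"
        obtain m where "inverse (real (Suc m)) < infdist x F"
          using reals_Archimedean[OF pos] by blast
        then have "t m \<le> infdist x F" by (simp add: t_def inverse_eq_divide add.commute)
        then have k: "t k \<le> infdist x F" unfolding k_def by (rule LeastI)
        have least: "\<not> t j \<le> infdist x F" if "j < k" for j using that unfolding k_def by (rule not_less_Least)
        show "x \<in> A n \<union> (\<Union>i. R (i + n))"
        proof (cases "k \<le> n")
          case True
          then have "t n \<le> infdist x F" using k t(3)[of k n] by simp
          then show ?thesis using x by (simp add: A_def)
        next
          case False
          then obtain i where i: "k = Suc (i + n)" using less_iff_Suc_add[of n k] by (auto simp: add.commute)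
          then have "x \<in> R (i + n)" using k least[of "i + n"] x by (simp add: R_def)
          then show ?thesis by blast
        qed
      qed
      then have split: "hausdorff2_outer ((UNIV - F) \<inter> E)
          \<le> hausdorff2_outer (A n) + (\<Sum>i. hausdorff2_outer (R (i + n)))" for n
        using hausdorff2_outer_mono hausdorff2_outer_Un_le[of "A n" "\<Union>i. R (i + n)"]
          hausdorff2_outer_UN_le[of "\<lambda>i. R (i + n)"] by (meson add_left_mono order_trans)
      have AF: "hausdorff2_outer (F \<inter> E) + hausdorff2_outer (A n) \<le> hausdorff2_outer E" for n
      proof -
        have "hausdorff2_outer (F \<inter> E) + hausdorff2_outer (A n) \<le> hausdorff2_outer (F \<inter> E \<union> A n)"
        proof (rule hausdorff2_outer_separated[OF _ t(1)])
          fix x y assume "x \<in> F \<inter> E" "y \<in> A n"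
          then show "t n \<le> dist x y" using infdist_le[of x F y] by (auto simp: A_def dist_commute)
        qed
        also have "\<dots> \<le> hausdorff2_outer E" by (rule hausdorff2_outer_mono) (auto simp: A_def)
        finally show ?thesis .
      qed
      \<comment> \<open>Two shells with at least one shell between them are separated by the width
        of \<open>R (Suc i)\<close>, because \<open>infdist\<close> is 1-Lipschitz.\<close>
      have sep: "\<exists>d>0. \<forall>x\<in>R i. \<forall>y\<in>R j. d \<le> dist x y" if "Suc i < j" for i j
      proof (intro exI conjI ballI)
        show "t (Suc i) - t (Suc (Suc i)) > 0" using t(2) by simp
        fix x y assume "x \<in> R i" "y \<in> R j"
        then have "t (Suc i) \<le> infdist x F" "infdist y F < t j" by (auto simp: R_def)
        moreover have "t j \<le> t (Suc (Suc i))" using that by (intro t(3)) simp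
        ultimately show "t (Suc i) - t (Suc (Suc i)) \<le> dist x y" using infdist_triangle[of x F y] by linarith
      qed
      \<comment> \<open>\<open>m = 0\<close> and \<open>m = 1\<close> select the even and the odd
        shells.\<close>
      have sub: "(\<Sum>i<n. hausdorff2_outer (R (2 * i + m))) \<le> hausdorff2_outer E" for n m
        by (rule order_trans[OF hausdorff2_outer_separated_sum[OF sep]])
          (auto intro!: hausdorff2_outer_mono simp: R_def)
      have "(\<Sum>i<n. hausdorff2_outer (R i)) \<le> hausdorff2_outer E + hausdorff2_outer E" for n
      proof -
        have "(\<Sum>i<n. hausdorff2_outer (R i)) \<le> (\<Sum>i<2 * n. hausdorff2_outer (R i))"
          by (intro sum_mono2) auto
        also have "\<dots> = (\<Sum>i<n. hausdorff2_outer (R (2 * i + 0)) + hausdorff2_outer (R (2 * i + 1)))"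
          by (induction n) (auto simp: algebra_simps)
        also have "\<dots> \<le> hausdorff2_outer E + hausdorff2_outer E"
          unfolding sum.distrib by (intro add_mono sub)
        finally show ?thesis .
      qed
      then have "(\<Sum>i. hausdorff2_outer (R i)) \<le> hausdorff2_outer E + hausdorff2_outer E"
        by (intro suminf_le_const) auto
      then have summ: "(\<Sum>i. hausdorff2_outer (R i)) < top"
        using fin by (auto simp: order_le_less_trans)
      show ?thesis
      proof (rule ennreal_le_epsilon)
        fix e :: real assume "e > 0"
        then obtain n where n: "(\<Sum>i. hausdorff2_outer (R (i + n))) \<le> ennreal e"
          using ennreal_suminf_tail_le[OF summ, of "ennreal e"] by auto
        have "hausdorff2_outer (F \<inter> E) + hausdorff2_outer ((UNIV - F) \<inter> E)
            \<le> hausdorff2_outer (F \<inter> E) + (hausdorff2_outer (A n) + ennreal e)"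
          using split[of n] n by (meson add_left_mono order_trans)
        also have "\<dots> \<le> hausdorff2_outer E + ennreal e"
          using AF[of n] by (simp add: add.assoc[symmetric] add_right_mono)
        finally show "hausdorff2_outer (F \<inter> E) + hausdorff2_outer ((UNIV - F) \<inter> E)
            \<le> hausdorff2_outer E + ennreal e" .
      qed
    qed (simp add: less_top[symmetric])
  qed
  then show ?thesis by (simp add: sets_hausdorff2 lambda_system_def)
qed simp

section \<open>Comparison of Hausdorff measure with Lebesgue measure of the plane\<close>

lemma sets_borel_subset_hausdorff2: "sets borel \<subseteq> sets (hausdorff2 :: 'a::euclidean_space measure)"
proof -
  have "sigma_sets UNIV (Collect closed) \<subseteq> sets (hausdorff2 :: 'a measure)"
    using sets.sigma_sets_subset[of "Collect closed" "hausdorff2 :: 'a measure"] closed_in_sets_hausdorff2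
    by (auto simp: space_hausdorff2)
  then show ?thesis by (simp add: borel_eq_closed)
qed

lemma borel_measurable_hausdorff2: "f \<in> borel_measurable borel \<Longrightarrow> f \<in> borel_measurable hausdorff2"
  using sets_borel_subset_hausdorff2 by (auto simp: measurable_def space_hausdorff2)

text \<open>A set of diameter \<open>d\<close> projects into a square of side \<open>2 * d\<close>,
  whose area is \<open>16 / pi\<close> times \<open>pi / 4 * d^2\<close>; this is the origin of the
  constant. Since \<open>\<sigma>\<close> is a right inverse of the 1-Lipschitz map
  \<open>P\<close>, the squares built from a cover of \<open>E\<close> cover the preimage.\<close>

lemma emeasure_vimage_le_hausdorff2:
  fixes E :: "'a::euclidean_space set" and \<sigma> :: "real^2 \<Rightarrow> 'a" and P :: "'a \<Rightarrow> real^2"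
  assumes P: "\<And>x y. dist (P x) (P y) \<le> dist x y" and \<sigma>: "\<And>z. P (\<sigma> z) = z"
    and E: "E \<in> sets borel" and \<sigma>m: "\<sigma> \<in> borel_measurable borel"
  shows "emeasure lborel (\<sigma> -` E) \<le> ennreal (16 / pi) * hausdorff2_outer E"
proof -
  \<comment> \<open>The bound holds for covers of any mesh; the mesh 1 is an arbitrary
    choice.\<close>
  have "ennreal (pi / 16) * emeasure lborel (\<sigma> -` E) \<le> hausdorff2_pre 1 E"
    unfolding hausdorff2_pre_def
  proof (rule INF_greatest)
    fix C :: "nat \<Rightarrow> 'a set"
    assume "C \<in> {C. E \<subseteq> (\<Union>n. C n) \<and> (\<forall>n. bounded (C n) \<and> diameter (C n) \<le> 1)}"
    then have C: "E \<subseteq> (\<Union>n. C n)" "\<And>n. bounded (C n)" by auto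
    \<comment> \<open>An empty \<open>C n\<close> offers no centre for the square and is sent to the
      empty set.\<close>
    define Q where "Q n = (if C n = {} then {} else
      cbox (P (SOME x. x \<in> C n) - diameter (C n) *\<^sub>R One) (P (SOME x. x \<in> C n) + diameter (C n) *\<^sub>R One))" for n
    have Q: "P x \<in> Q n" if "x \<in> C n" for x n
    proof -
      define c where "c = (SOME x. x \<in> C n)"
      have "c \<in> C n" unfolding c_def using that by (rule someI)
      then have "dist (P x) (P c) \<le> diameter (C n)"
        using P[of x c] diameter_bounded_bound[OF C(2) that, of c] by linarith
      then have "\<bar>(P x - P c) \<bullet> b\<bar> \<le> diameter (C n)" if "b \<in> Basis" for b
        using Basis_le_norm[OF that, of "P x - P c"] by (simp add: dist_norm)
      then have "P x \<in> cbox (P c - diameter (C n) *\<^sub>R One) (P c + diameter (C n) *\<^sub>R One)"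
        by (force simp: mem_box inner_diff_left inner_add_left abs_le_iff algebra_simps)
      then show ?thesis using that by (auto simp: Q_def c_def)
    qed
    have Qe: "emeasure lborel (Q n) \<le> ennreal (16 / pi) * ennreal (pi / 4 * (diameter (C n))\<^sup>2)" for n
    proof (cases "C n = {}")
      case False
      have "diameter (C n) \<ge> 0" by (rule diameter_ge_0[OF C(2)])
      define c where "c = P (SOME x. x \<in> C n)"
      have diff: "(c + diameter (C n) *\<^sub>R One - (c - diameter (C n) *\<^sub>R One)) \<bullet> b = 2 * diameter (C n)"
        if "b \<in> Basis" for b
        using inner_sum_left_Basis[OF that, of "\<lambda>_. 1"]
        by (simp only: inner_diff_left inner_add_left inner_scaleR_left scaleR_one)
      have "emeasure lborel (Q n) = emeasure lborel (cbox (c - diameter (C n) *\<^sub>R One) (c + diameter (C n) *\<^sub>R One))"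
        using False by (simp add: Q_def c_def)
      also have "\<dots> = (\<Prod>b\<in>Basis. (c + diameter (C n) *\<^sub>R One - (c - diameter (C n) *\<^sub>R One)) \<bullet> b)"
        using \<open>diameter (C n) \<ge> 0\<close>
        by (intro emeasure_lborel_cbox) (simp add: inner_diff_left inner_add_left)
      also have "\<dots> = ennreal ((2 * diameter (C n))\<^sup>2)"
        by (subst prod.cong[OF refl diff]) simp_all
      also have "(2 * diameter (C n))\<^sup>2 = 16 / pi * (pi / 4 * (diameter (C n))\<^sup>2)"
        by (simp add: power2_eq_square)
      finally show ?thesis by (subst ennreal_mult[symmetric]) auto
    qed (simp add: Q_def)
    have "\<sigma> -` E \<subseteq> (\<Union>n. Q n)"
    proof
      fix z assume "z \<in> \<sigma> -` E"
      then obtain n where "\<sigma> z \<in> C n" using C(1) by auto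
      from Q[OF this] show "z \<in> (\<Union>n. Q n)" using \<sigma> by auto
    qed
    then have "emeasure lborel (\<sigma> -` E) \<le> emeasure lborel (\<Union>n. Q n)"
      by (intro emeasure_mono) (auto simp: Q_def)
    also have "\<dots> \<le> (\<Sum>n. emeasure lborel (Q n))"
      by (intro emeasure_subadditive_countably) (auto simp: Q_def)
    also have "\<dots> \<le> (\<Sum>n. ennreal (16 / pi) * ennreal (pi / 4 * (diameter (C n))\<^sup>2))"
      by (intro suminf_le Qe) auto
    also have "\<dots> = ennreal (16 / pi) * (\<Sum>n. ennreal (pi / 4 * (diameter (C n))\<^sup>2))"
      by simp
    finally have "ennreal (pi / 16) * emeasure lborel (\<sigma> -` E)
        \<le> ennreal (pi / 16) * (ennreal (16 / pi) * (\<Sum>n. ennreal (pi / 4 * (diameter (C n))\<^sup>2)))"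
      by (rule mult_left_mono) simp
    also have "\<dots> = (\<Sum>n. ennreal (pi / 4 * (diameter (C n))\<^sup>2))"
      by (simp add: mult.assoc[symmetric] ennreal_mult[symmetric])
    finally show "ennreal (pi / 16) * emeasure lborel (\<sigma> -` E)
        \<le> (\<Sum>n. ennreal (pi / 4 * (diameter (C n))\<^sup>2))" .
  qed
  also have "\<dots> \<le> hausdorff2_outer E"
    unfolding hausdorff2_outer_def by (intro SUP_upper) auto
  finally have "ennreal (16 / pi) * (ennreal (pi / 16) * emeasure lborel (\<sigma> -` E))
      \<le> ennreal (16 / pi) * hausdorff2_outer E"
    by (rule mult_left_mono) simp
  then show ?thesis by (simp add: mult.assoc[symmetric] ennreal_mult[symmetric])
qed

text \<open>The comparison of measures passes to integrals after pushing Lebesgue measure forward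
  along \<open>\<sigma>\<close>. Pushing \<open>hausdorff2\<close> forward along the identity
  restricts it to Borel sets, so that both measures have the same measurable sets.\<close>

lemma nn_integral_graph_le_hausdorff2:
  fixes \<Phi> :: "'a::euclidean_space \<Rightarrow> ennreal" and \<sigma> :: "real^2 \<Rightarrow> 'a" and P :: "'a \<Rightarrow> real^2"
  assumes P: "\<And>x y. dist (P x) (P y) \<le> dist x y" and \<sigma>: "\<And>z. P (\<sigma> z) = z"
    and \<Phi>: "\<Phi> \<in> borel_measurable borel" and \<sigma>m [measurable]: "\<sigma> \<in> borel_measurable borel"
  shows "(\<integral>\<^sup>+z. \<Phi> (\<sigma> z) \<partial>lborel) \<le> ennreal (16 / pi) * (\<integral>\<^sup>+x. \<Phi> x \<partial>hausdorff2)"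
proof -
  have id: "(\<lambda>x. x) \<in> measurable (hausdorff2 :: 'a measure) borel"
    by (intro borel_measurable_hausdorff2) simp
  have "(\<integral>\<^sup>+z. \<Phi> (\<sigma> z) \<partial>lborel) = (\<integral>\<^sup>+x. \<Phi> x \<partial>distr lborel borel \<sigma>)"
    using \<Phi> by (subst nn_integral_distr) auto
  also have "\<dots> \<le> (\<integral>\<^sup>+x. \<Phi> x \<partial>scale_measure (ennreal (16 / pi)) (distr hausdorff2 borel (\<lambda>x. x)))"
  proof (rule nn_integral_mono_measure)
    show "distr lborel borel \<sigma> \<le> scale_measure (ennreal (16 / pi)) (distr hausdorff2 borel (\<lambda>x. x))"
    proof (subst le_measure; simp)
      show "\<forall>E\<in>sets borel. emeasure (distr lborel borel \<sigma>) E
          \<le> ennreal (16 / pi) * emeasure (distr hausdorff2 borel (\<lambda>x. x)) E"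
      proof
        fix E :: "'a set" assume E: "E \<in> sets borel"
        then have "E \<in> sets hausdorff2" using sets_borel_subset_hausdorff2 by blast
        then show "emeasure (distr lborel borel \<sigma>) E
            \<le> ennreal (16 / pi) * emeasure (distr hausdorff2 borel (\<lambda>x. x)) E"
          using emeasure_vimage_le_hausdorff2[OF P \<sigma> E \<sigma>m] E id
          by (simp add: emeasure_distr space_hausdorff2 emeasure_hausdorff2)
      qed
    qed
  qed simp
  also have "\<dots> = ennreal (16 / pi) * (\<integral>\<^sup>+x. \<Phi> x \<partial>hausdorff2)"
    using \<Phi> id by (simp add: nn_integral_scale_measure nn_integral_distr)
  finally show ?thesis .
qed

section \<open>Traces on graphs\<close>

lemma orthogonal_transformation_bounded_linear:
  "orthogonal_transformation T \<Longrightarrow> bounded_linear T"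
  for T :: "'a::euclidean_space \<Rightarrow> 'a"
  by (simp add: orthogonal_transformation_linear linear_conv_bounded_linear[symmetric])

lemma orthogonal_transformation_continuous:
  "orthogonal_transformation T \<Longrightarrow> continuous_on S T"
  for T :: "'a::euclidean_space \<Rightarrow> 'a"
  by (intro linear_continuous_on orthogonal_transformation_bounded_linear)

lemma lborel_distr_orthogonal:
  fixes T :: "real^3 \<Rightarrow> real^3"
  assumes T: "orthogonal_transformation T"
  shows "distr lborel borel T = lborel"
proof (rule lborel_eqI[symmetric])
  have Tm: "T \<in> borel_measurable borel"
    using T by (intro borel_measurable_continuous_onI orthogonal_transformation_continuous)
  fix l u :: "real^3" assume lu: "\<And>b. b \<in> Basis \<Longrightarrow> l \<bullet> b \<le> u \<bullet> b"
  have bij: "bij T" using T by (rule orthogonal_transformation_bij)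
  have inv: "orthogonal_transformation (inv T)" using T by (rule orthogonal_transformation_inv)
  have vim: "T -` box l u = inv T ` box l u" using bij by (simp add: bij_vimage_eq_inv_image)
  have b: "T -` box l u \<in> sets borel" using measurable_sets[OF Tm, of "box l u"] by simp
  have lm: "inv T ` box l u \<in> lmeasurable" by (rule measurable_orthogonal_image[OF inv]) simp
  have "emeasure lborel (T -` box l u) = emeasure lebesgue (T -` box l u)"
    using b by simp
  also have "\<dots> = emeasure lebesgue (inv T ` box l u)" by (rule arg_cong[OF vim])
  also have "\<dots> = ennreal (measure lebesgue (inv T ` box l u))"
    by (rule emeasure_eq_measure2[OF lm])
  also have "measure lebesgue (inv T ` box l u) = measure lebesgue (box l u)"
    by (rule measure_orthogonal_image[OF inv]) simp
  also have "\<dots> = (\<Prod>b\<in>Basis. (u - l) \<bullet> b)" using lu by (simp add: measure_lborel_box_eq)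
  finally show "emeasure (distr lborel borel T) (box l u) = (\<Prod>b\<in>Basis. (u - l) \<bullet> b)"
    using Tm by (simp add: emeasure_distr)
qed simp

definition vec3 :: "real^2 \<Rightarrow> real \<Rightarrow> real^3" where
  "vec3 z t = (z $ 1) *\<^sub>R axis 1 1 + (z $ 2) *\<^sub>R axis 2 1 + t *\<^sub>R axis 3 1"

definition proj2 :: "real^3 \<Rightarrow> real^2" where
  "proj2 y = (y $ 1) *\<^sub>R axis 1 1 + (y $ 2) *\<^sub>R axis 2 1"

lemma vec3_nth [simp]: "vec3 z t $ 1 = z $ 1" "vec3 z t $ 2 = z $ 2" "vec3 z t $ 3 = t"
  by (simp_all add: vec3_def axis_def)

lemma proj2_nth [simp]: "proj2 y $ 1 = y $ 1" "proj2 y $ 2 = y $ 2"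
  by (simp_all add: proj2_def axis_def)

lemma proj2_eq_vector: "proj2 y = vector [y $ 1, y $ 2]"
  by (simp add: vec_eq_iff forall_2)

lemma proj2_vec3 [simp]: "proj2 (vec3 z t) = z"
  by (simp add: vec_eq_iff forall_2)

lemma bounded_linear_proj2: "bounded_linear proj2"
  unfolding proj2_def by (intro bounded_linear_intros bounded_linear_vec_nth)

lemma norm_proj2_le: "norm (proj2 y) \<le> norm y"
  unfolding norm_vec_def L2_set_def by (simp add: sum_2 sum_3 del: norm_eq_zero)

lemma vec3_add: "vec3 z (s + t) = vec3 z s + t *\<^sub>R axis 3 1"
  by (simp add: vec3_def algebra_simps)

lemma continuous_vec3 [continuous_intros]:
  "continuous_on A f \<Longrightarrow> continuous_on A g \<Longrightarrow> continuous_on A (\<lambda>x. vec3 (f x) (g x))"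
  unfolding vec3_def by (intro continuous_intros)

lemma bij_betw_axis: "bij_betw (\<lambda>i. axis i 1) UNIV (Basis :: (real^'n) set)"
  by (auto simp: bij_betw_def inj_on_def axis_eq_axis Basis_vec_def)

lemma prod_Basis_vec:
  "(\<Prod>b\<in>(Basis :: (real^'n) set). f b) = (\<Prod>i\<in>UNIV. f (axis i 1))"
  by (rule prod.reindex_bij_betw[OF bij_betw_axis, symmetric])

lemma prod_3: "(\<Prod>i\<in>(UNIV :: 3 set). f i) = f 1 * f 2 * (f 3 :: real)"
  unfolding UNIV_3 by simp

lemma lborel_vec3: "lborel = distr (lborel \<Otimes>\<^sub>M lborel) borel (\<lambda>(z, t). vec3 z t)"
proof (rule lborel_eqI)
  have m: "(\<lambda>(z, t). vec3 z t) \<in> measurable (lborel \<Otimes>\<^sub>M lborel) borel"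
  proof -
    have "(\<lambda>p. vec3 (fst p) (snd p)) \<in> borel_measurable borel"
      by (intro borel_measurable_continuous_onI continuous_intros)
    then show ?thesis by (simp add: borel_prod[symmetric] split_beta')
  qed
  fix l u :: "real^3" assume lu: "\<And>b. b \<in> Basis \<Longrightarrow> l \<bullet> b \<le> u \<bullet> b"
  have le: "l $ i \<le> u $ i" for i using lu[of "axis i 1"] by (simp add: inner_axis)
  have "(\<lambda>(z, t). vec3 z t) -` box l u = box (proj2 l) (proj2 u) \<times> box (l $ 3) (u $ 3)"
    by (auto simp: mem_box_cart forall_2 forall_3)
  then have E: "emeasure (distr (lborel \<Otimes>\<^sub>M lborel) borel (\<lambda>(z, t). vec3 z t)) (box l u)
      = emeasure lborel (box (proj2 l) (proj2 u)) * emeasure lborel (box (l $ 3) (u $ 3))"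
    using m by (simp add: emeasure_distr space_pair_measure lborel.emeasure_pair_measure_Times)
  have E1: "emeasure lborel (box (proj2 l) (proj2 u)) = ennreal ((u $ 1 - l $ 1) * (u $ 2 - l $ 2))"
  proof (subst emeasure_lborel_box)
    show "proj2 l \<bullet> b \<le> proj2 u \<bullet> b" if bB: "b \<in> Basis" for b
    proof -
      obtain i where i: "b = axis i 1" using bB by (auto simp: Basis_vec_def)
      have "i = 1 \<or> i = 2" by (rule exhaust_2)
      then show ?thesis using le by (auto simp: i inner_axis)
    qed
    show "ennreal (\<Prod>b\<in>Basis. (proj2 u - proj2 l) \<bullet> b) = ennreal ((u $ 1 - l $ 1) * (u $ 2 - l $ 2))"
      unfolding prod_Basis_vec by (simp add: UNIV_2 inner_axis)
  qed
  have E2: "emeasure lborel (box (l $ 3) (u $ 3)) = ennreal (u $ 3 - l $ 3)"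
    using emeasure_lborel_Ioo[OF le[of 3]] by (simp only: box_real)
  have E3: "ennreal ((u $ 1 - l $ 1) * (u $ 2 - l $ 2)) * ennreal (u $ 3 - l $ 3) = (\<Prod>b\<in>Basis. (u - l) \<bullet> b)"
  proof -
    have "(\<Prod>b\<in>Basis. (u - l) \<bullet> b) = (u $ 1 - l $ 1) * (u $ 2 - l $ 2) * (u $ 3 - l $ 3)"
      unfolding prod_Basis_vec prod_3 inner_axis by simp
    moreover have "0 \<le> u $ i - l $ i" for i using le[of i] by simp
    ultimately show ?thesis by (simp only: ennreal_mult[symmetric] mult_nonneg_nonneg)
  qed
  show "emeasure (distr (lborel \<Otimes>\<^sub>M lborel) borel (\<lambda>(z, t). vec3 z t)) (box l u) = (\<Prod>b\<in>Basis. (u - l) \<bullet> b)"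
    unfolding E E1 E2 E3 ..
qed simp

text \<open>Rotations preserve Lebesgue measure, and so does, for each fixed \<open>z\<close>, the
  shift of the last coordinate by \<open>\<gamma> z\<close>. In the new coordinates \<open>s\<close>
  is the height above the graph.\<close>

lemma nn_integral_graph_coordinates:
  fixes T :: "real^3 \<Rightarrow> real^3" and \<gamma> :: "real^2 \<Rightarrow> real"
  assumes T: "orthogonal_transformation T" and [measurable]: "f \<in> borel_measurable borel"
    and [measurable]: "\<gamma> \<in> borel_measurable borel"
  shows "(\<integral>\<^sup>+x. f x \<partial>lborel) = (\<integral>\<^sup>+z. \<integral>\<^sup>+s. f (T (vec3 z (\<gamma> z + s))) \<partial>lborel \<partial>lborel)"
proof -
  have Tm [measurable]: "T \<in> borel_measurable borel"
    using T by (intro borel_measurable_continuous_onI orthogonal_transformation_continuous)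
  have m [measurable]: "(\<lambda>(z, t). vec3 z t) \<in> measurable (lborel \<Otimes>\<^sub>M lborel) borel"
  proof -
    have "(\<lambda>p. vec3 (fst p) (snd p)) \<in> borel_measurable borel"
      by (intro borel_measurable_continuous_onI continuous_intros)
    then show ?thesis by (simp add: borel_prod[symmetric] split_beta')
  qed
  have v [measurable]: "vec3 z \<in> borel_measurable borel" for z
    by (intro borel_measurable_continuous_onI continuous_intros)
  have "(\<integral>\<^sup>+x. f x \<partial>lborel) = (\<integral>\<^sup>+x. f (T x) \<partial>lborel)"
    by (subst lborel_distr_orthogonal[OF T, symmetric], subst nn_integral_distr) auto
  also have "\<dots> = (\<integral>\<^sup>+p. f (T ((\<lambda>(z, t). vec3 z t) p)) \<partial>(lborel \<Otimes>\<^sub>M lborel))"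
    by (subst lborel_vec3, subst nn_integral_distr) auto
  also have "\<dots> = (\<integral>\<^sup>+z. \<integral>\<^sup>+t. f (T (vec3 z t)) \<partial>lborel \<partial>lborel)"
    by (subst lborel.nn_integral_fst[symmetric]) auto
  also have "\<dots> = (\<integral>\<^sup>+z. \<integral>\<^sup>+s. f (T (vec3 z (\<gamma> z + s))) \<partial>lborel \<partial>lborel)"
  proof (rule nn_integral_cong)
    fix z
    show "(\<integral>\<^sup>+t. f (T (vec3 z t)) \<partial>lborel) = (\<integral>\<^sup>+s. f (T (vec3 z (\<gamma> z + s))) \<partial>lborel)"
      using nn_integral_real_affine[of "\<lambda>t. f (T (vec3 z t))" 1 "\<gamma> z"] by simp
  qed
  finally show ?thesis .
qed

text \<open>In graph coordinates the layer is \<open>0 \<le> s \<le> \<epsilon>\<close> above each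
  \<open>z\<close>. For small \<open>\<epsilon>\<close> the uniformly continuous \<open>h\<close>
  differs there from its value on the graph by less than \<open>\<omega> / V\<close>, which costs at
  most \<open>\<omega>\<close> over the shadow \<open>Q\<close> of the support.\<close>

lemma graph_layer_bound:
  fixes T :: "real^3 \<Rightarrow> real^3" and \<gamma> :: "real^2 \<Rightarrow> real" and h :: "real^3 \<Rightarrow> real"
  assumes T: "orthogonal_transformation T" and \<gamma>: "continuous_on UNIV \<gamma>"
    and h: "continuous_on UNIV h" "compact K" "\<And>x. x \<notin> K \<Longrightarrow> h x = 0" and w: "\<omega> > 0"
  shows "\<exists>\<epsilon>0>0. \<forall>\<epsilon>. 0 < \<epsilon> \<and> \<epsilon> < \<epsilon>0 \<longrightarrow>
    (\<integral>\<^sup>+x. ennreal (\<bar>h x\<bar> * indicator {0..\<epsilon>} (T x $ 3 - \<gamma> (proj2 (T x)))) \<partial>lborel)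
      \<le> ennreal \<epsilon> * ((\<integral>\<^sup>+z. ennreal \<bar>h (inv T (vec3 z (\<gamma> z)))\<bar> \<partial>lborel) + ennreal \<omega>)"
proof -
  define S where "S = inv T"
  have S: "orthogonal_transformation S" unfolding S_def using T by (rule orthogonal_transformation_inv)
  have bij: "bij T" using T by (rule orthogonal_transformation_bij)
  have TS: "T (S y) = y" for y unfolding S_def using bij by (simp add: bij_is_surj surj_f_inv_f)
  have Sl: "linear S" using S by (rule orthogonal_transformation_linear)
  have Tc: "continuous_on UNIV T" and Sc: "continuous_on UNIV S"
    using T S by (auto intro: orthogonal_transformation_continuous)
  obtain R where R: "\<And>x. x \<in> K \<Longrightarrow> norm x \<le> R"
    using h(2) compact_imp_bounded bounded_iff by metis
  \<comment> \<open>Rotations preserve norms and \<open>proj2\<close> does not increase them, so a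
    point over \<open>z\<close> can lie in \<open>K\<close> only if
    \<open>norm z \<le> R\<close>.\<close>
  define Q :: "(real^2) set" where "Q = cball 0 R"
  have [measurable]: "Q \<in> sets borel" unfolding Q_def by (intro borel_closed closed_cball)
  have hQ: "h (S (vec3 z t)) = 0" if "z \<notin> Q" for z t
  proof (rule h(3), rule notI)
    assume "S (vec3 z t) \<in> K"
    then have "norm (vec3 z t) \<le> R" using R S by (metis orthogonal_transformation_norm)
    then have "norm z \<le> R" using norm_proj2_le[of "vec3 z t"] by simp
    then show False using that by (simp add: Q_def)
  qed
  define V where "V = measure lborel Q + 1"
  have V: "V > 0" unfolding V_def by (simp add: add_nonneg_pos)
  obtain \<delta> where \<delta>: "\<delta> > 0" "\<And>x y. dist x y < \<delta> \<Longrightarrow> \<bar>h x - h y\<bar> < \<omega> / V"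
    using continuous_compact_support_uniform[OF h, of "\<omega> / V"] w V by auto
  have [measurable]: "h \<in> borel_measurable borel" "\<gamma> \<in> borel_measurable borel" "T \<in> borel_measurable borel"
    using h(1) \<gamma> Tc by (auto intro: borel_measurable_continuous_onI)
  have gm [measurable]: "(\<lambda>z. h (S (vec3 z (\<gamma> z)))) \<in> borel_measurable borel"
    by (intro borel_measurable_continuous_onI continuous_on_compose2[OF h(1)]
        continuous_on_compose2[OF Sc] continuous_intros \<gamma>) auto
  have Gm: "(\<lambda>x. T x $ 3 - \<gamma> (proj2 (T x))) \<in> borel_measurable borel"
    by (intro borel_measurable_continuous_onI continuous_intros Tc continuous_on_compose2[OF \<gamma>]
        continuous_on_compose2[OF linear_continuous_on[OF bounded_linear_proj2, of UNIV]]) auto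
  have "(\<integral>\<^sup>+x. ennreal (\<bar>h x\<bar> * indicator {0..\<epsilon>} (T x $ 3 - \<gamma> (proj2 (T x)))) \<partial>lborel)
      \<le> ennreal \<epsilon> * ((\<integral>\<^sup>+z. ennreal \<bar>h (S (vec3 z (\<gamma> z)))\<bar> \<partial>lborel) + ennreal \<omega>)"
    if \<epsilon>: "0 < \<epsilon>" "\<epsilon> < \<delta>" for \<epsilon>
  proof -
    have fm: "(\<lambda>x. ennreal (\<bar>h x\<bar> * indicator {0..\<epsilon>} (T x $ 3 - \<gamma> (proj2 (T x))))) \<in> borel_measurable borel"
      using Gm by measurable
    have "(\<integral>\<^sup>+x. ennreal (\<bar>h x\<bar> * indicator {0..\<epsilon>} (T x $ 3 - \<gamma> (proj2 (T x)))) \<partial>lborel)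
      = (\<integral>\<^sup>+z. \<integral>\<^sup>+s. ennreal (\<bar>h (S (vec3 z (\<gamma> z + s)))\<bar> * indicator {0..\<epsilon>} s) \<partial>lborel \<partial>lborel)"
      by (subst nn_integral_graph_coordinates[OF S fm, of \<gamma>]) (simp_all add: TS)
    also have "\<dots> \<le> (\<integral>\<^sup>+z. ennreal \<epsilon> * (ennreal \<bar>h (S (vec3 z (\<gamma> z)))\<bar> + ennreal (\<omega> / V) * indicator Q z) \<partial>lborel)"
    proof (rule nn_integral_mono)
      fix z
      show "(\<integral>\<^sup>+s. ennreal (\<bar>h (S (vec3 z (\<gamma> z + s)))\<bar> * indicator {0..\<epsilon>} s) \<partial>lborel)
        \<le> ennreal \<epsilon> * (ennreal \<bar>h (S (vec3 z (\<gamma> z)))\<bar> + ennreal (\<omega> / V) * indicator Q z)"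
      proof (cases "z \<in> Q")
        case True
        have "(\<integral>\<^sup>+s. ennreal (\<bar>h (S (vec3 z (\<gamma> z + s)))\<bar> * indicator {0..\<epsilon>} s) \<partial>lborel)
          \<le> (\<integral>\<^sup>+s. ennreal (\<bar>h (S (vec3 z (\<gamma> z)))\<bar> + \<omega> / V) * indicator {0..\<epsilon>} s \<partial>lborel)"
        proof (rule nn_integral_mono)
          fix s
          show "ennreal (\<bar>h (S (vec3 z (\<gamma> z + s)))\<bar> * indicator {0..\<epsilon>} s)
            \<le> ennreal (\<bar>h (S (vec3 z (\<gamma> z)))\<bar> + \<omega> / V) * indicator {0..\<epsilon>} s"
          proof (cases "s \<in> {0..\<epsilon>}")
            case s: True
            have "S (vec3 z (\<gamma> z + s)) - S (vec3 z (\<gamma> z)) = S (s *\<^sub>R axis 3 1)"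
              using linear_diff[OF Sl, symmetric] by (simp add: vec3_add)
            then have "dist (S (vec3 z (\<gamma> z + s))) (S (vec3 z (\<gamma> z))) = \<bar>s\<bar>"
              using S by (simp add: dist_norm orthogonal_transformation_norm)
            then have "\<bar>h (S (vec3 z (\<gamma> z + s))) - h (S (vec3 z (\<gamma> z)))\<bar> < \<omega> / V"
              using s \<epsilon> by (intro \<delta>(2)) auto
            then have "\<bar>h (S (vec3 z (\<gamma> z + s)))\<bar> \<le> \<bar>h (S (vec3 z (\<gamma> z)))\<bar> + \<omega> / V" by linarith
            from ennreal_leI[OF this] show ?thesis using s by simp
          qed simp
        qed
        also have "\<dots> = ennreal (\<bar>h (S (vec3 z (\<gamma> z)))\<bar> + \<omega> / V) * ennreal \<epsilon>"
          using \<epsilon> by (subst nn_integral_cmult_indicator) auto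
        also have "\<dots> = ennreal \<epsilon> * (ennreal \<bar>h (S (vec3 z (\<gamma> z)))\<bar> + ennreal (\<omega> / V) * indicator Q z)"
          using True w V by (simp add: ennreal_plus mult.commute)
        finally show ?thesis .
      qed (simp add: hQ)
    qed
    also have "\<dots> = ennreal \<epsilon> * ((\<integral>\<^sup>+z. ennreal \<bar>h (S (vec3 z (\<gamma> z)))\<bar> \<partial>lborel)
        + (\<integral>\<^sup>+z. ennreal (\<omega> / V) * indicator Q z \<partial>lborel))"
    proof -
      have m1: "(\<lambda>z. ennreal \<bar>h (S (vec3 z (\<gamma> z)))\<bar>) \<in> borel_measurable lborel" by measurable
      have m2: "(\<lambda>z. ennreal (\<omega> / V) * indicator Q z) \<in> borel_measurable lborel"
        by measurable
      show ?thesis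
        by (simp only: nn_integral_cmult[OF borel_measurable_add[OF m1 m2]] nn_integral_add[OF m1 m2])
    qed
    also have "(\<integral>\<^sup>+z. ennreal (\<omega> / V) * indicator Q z \<partial>lborel) = ennreal (\<omega> / V * (V - 1))"
    proof -
      have "emeasure lborel Q = ennreal (V - 1)"
        unfolding V_def Q_def using emeasure_compact_finite[OF compact_cball, of "0 :: real^2" R]
        by (simp add: emeasure_eq_ennreal_measure)
      moreover have "V - 1 \<ge> 0" by (simp add: V_def)
      ultimately show ?thesis using w V
        by (subst nn_integral_cmult_indicator) (simp_all add: ennreal_mult[symmetric] del: times_divide_eq_left)
    qed
    also have "ennreal \<epsilon> * ((\<integral>\<^sup>+z. ennreal \<bar>h (S (vec3 z (\<gamma> z)))\<bar> \<partial>lborel) + ennreal (\<omega> / V * (V - 1)))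
        \<le> ennreal \<epsilon> * ((\<integral>\<^sup>+z. ennreal \<bar>h (S (vec3 z (\<gamma> z)))\<bar> \<partial>lborel) + ennreal \<omega>)"
      using w V by (intro mult_left_mono add_mono ennreal_leI) (auto simp: field_simps)
    finally show ?thesis .
  qed
  then show ?thesis using \<delta>(1) unfolding S_def by blast
qed

text \<open>A step from 0 to 1 whose derivative is the tent of height 2 over \<open>[0, 1]\<close>.
  Squares of positive parts give one formula on the whole line; the derivative being continuous,
  products with \<open>h\<close> fall under \<open>integral_partial_deriv_eq_0\<close>.\<close>

definition ramp :: "real \<Rightarrow> real" where
  "ramp s = 2 * (max 0 s)\<^sup>2 - 4 * (max 0 (s - 1/2))\<^sup>2 + 2 * (max 0 (s - 1))\<^sup>2"

definition ramp' :: "real \<Rightarrow> real" where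
  "ramp' s = 4 * max 0 s - 8 * max 0 (s - 1/2) + 4 * max 0 (s - 1)"

lemma ramp_simps: "s \<le> 0 \<Longrightarrow> ramp s = 0" "s \<ge> 1 \<Longrightarrow> ramp s = 1"
  by (auto simp: ramp_def power2_eq_square algebra_simps)

lemma abs_ramp'_le: "\<bar>ramp' s\<bar> \<le> 2 * indicator {0..1} s"
  by (auto simp: ramp'_def indicator_def max_def)

lemma DERIV_max_square: "((\<lambda>s::real. (max 0 s)\<^sup>2) has_real_derivative 2 * max 0 s) (at s)"
proof -
  consider "s < 0" | "s > 0" | "s = 0" by linarith
  then show ?thesis
  proof cases
    case 1
    have "((\<lambda>_. 0) has_real_derivative 2 * max 0 s) (at s)" using 1 by simp
    then show ?thesis
      by (rule has_field_derivative_transform_within_open[where S="{..<0}"]) (use 1 in auto)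
  next
    case 2
    have "((\<lambda>s. s\<^sup>2) has_real_derivative 2 * max 0 s) (at s)"
      using 2 by (auto intro!: derivative_eq_intros)
    then show ?thesis
      by (rule has_field_derivative_transform_within_open[where S="{0<..}"]) (use 2 in auto)
  next
    case 3
    have "((\<lambda>h::real. (max 0 h)\<^sup>2 / h) \<longlongrightarrow> 0) (at 0)"
    proof (rule tendsto_0_le[where K=1 and f="\<lambda>h. h"])
      show "\<forall>\<^sub>F h in at 0. norm ((max 0 h)\<^sup>2 / h) \<le> norm (h :: real) * 1"
        by (intro always_eventually) (auto simp: max_def power2_eq_square)
    qed (rule tendsto_ident_at)
    then show ?thesis using 3 by (simp add: has_field_derivative_iff)
  qed
qed

lemma DERIV_ramp: "(ramp has_real_derivative ramp' s) (at s)"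
proof -
  have shift: "((\<lambda>s. (max 0 (s - c))\<^sup>2) has_real_derivative 2 * max 0 (s - c)) (at s)" for c :: real
    using DERIV_shift[of "\<lambda>s. (max 0 s)\<^sup>2" "2 * max 0 (s - c)" s "- c"] DERIV_max_square[of "s - c"] by simp
  show ?thesis unfolding ramp_def[abs_def] ramp'_def
    by (rule derivative_eq_intros shift DERIV_max_square refl | simp)+
qed

lemma cont_diff_ramp: "cont_diff 1 ramp"
proof -
  have "continuous_on UNIV (\<lambda>s. ramp' s * 1)" unfolding ramp'_def by (intro continuous_intros)
  then have "cont_diff (Suc 0) ramp"
    by (intro cont_diff_SucI[OF DERIV_ramp[unfolded has_field_derivative_def]]) auto
  then show ?thesis by simp
qed

lemma ramp_bounds: "0 \<le> ramp s" "ramp s \<le> 1"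
proof -
  have *: "ramp s = (if s \<le> 0 then 0 else if s \<le> 1/2 then 2 * s\<^sup>2 else if s \<le> 1 then 1 - 2 * (1 - s)\<^sup>2 else 1)"
    by (auto simp: ramp_def power2_eq_square algebra_simps max_def)
  have 1: "2 * s\<^sup>2 \<le> 1" if "0 \<le> s" "s \<le> 1/2" using power_mono[OF that(2,1), of 2] by (simp add: power2_eq_square)
  have 2: "2 * (1 - s)\<^sup>2 \<le> 1" if "1/2 \<le> s" "s \<le> 1"
    using power_mono[of "1 - s" "1/2" 2] that by (simp add: power2_eq_square)
  show "0 \<le> ramp s" "ramp s \<le> 1" using 1 2 by (auto simp: *)
qed

section \<open>Boundary charts and the boundary estimate\<close>

lemma cont_diff_1_linear_compose:
  fixes \<gamma> :: "'b::euclidean_space \<Rightarrow> real" and P :: "'a::euclidean_space \<Rightarrow> 'b"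
  assumes \<gamma>: "cont_diff 1 \<gamma>" and P: "bounded_linear P"
  shows "cont_diff 1 (\<lambda>x. \<gamma> (P x))"
proof -
  have D: "((\<lambda>x. \<gamma> (P x)) has_derivative (\<lambda>h. partial_deriv (P h) \<gamma> (P x))) (at x)" for x
    by (rule has_derivative_compose[OF bounded_linear_imp_has_derivative[OF P] cont_diff_1D(1)[OF \<gamma>]])
  have "continuous_on UNIV (\<lambda>x. partial_deriv (P b) \<gamma> (P x))" for b
    by (subst cont_diff_1D(4)[OF \<gamma>])
      (intro continuous_intros continuous_on_compose2[OF cont_diff_1D(2)[OF \<gamma>, of _ UNIV]]
        linear_continuous_on[OF P]; simp)
  then have "cont_diff (Suc 0) (\<lambda>x. \<gamma> (P x))" by (intro cont_diff_SucI[OF D]) simp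
  then show ?thesis by simp
qed

text \<open>Recasts the graph condition as positivity of one continuously differentiable height
  function, the form in which both the integration by parts and the inward shift use it.\<close>

lemma C2_boundary_chart:
  assumes "C2_boundary D" "p \<in> frontier D"
  obtains r and T :: "real^3 \<Rightarrow> real^3" and \<gamma> where "r > 0" "orthogonal_transformation T" "continuous_on UNIV \<gamma>"
    "cont_diff 1 (\<lambda>x. T x $ 3 - \<gamma> (proj2 (T x)))"
    "D \<inter> ball p r = {x \<in> ball p r. T x $ 3 - \<gamma> (proj2 (T x)) > 0}"
proof -
  obtain r and T :: "real^3 \<Rightarrow> real^3" and \<gamma> :: "real^2 \<Rightarrow> real" where *: "r > 0" "orthogonal_transformation T" "cont_diff 2 \<gamma>"
    "D \<inter> ball p r = {x \<in> ball p r. T x $ 3 > \<gamma> (vector [T x $ 1, T x $ 2])}"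
    using assms unfolding C2_boundary_def by blast
  have \<gamma>: "cont_diff 1 \<gamma>" using *(3) by (rule cont_diff_le) simp
  have T: "bounded_linear T"
    using *(2) by (rule orthogonal_transformation_bounded_linear)
  have "cont_diff 1 (\<lambda>x. T x $ 3 + - 1 * \<gamma> (proj2 (T x)))"
    by (intro cont_diff_add cont_diff_mult cont_diff_const
        cont_diff_1_linear_compose[OF \<gamma>, of "\<lambda>x. proj2 (T x)"]
        cont_diff_bounded_linear bounded_linear_compose[OF bounded_linear_vec_nth T]
        bounded_linear_compose[OF bounded_linear_proj2 T])
  moreover have "continuous_on UNIV \<gamma>" using \<gamma> by (rule cont_diff_continuous)
  ultimately show ?thesis using * by (intro that[of r T \<gamma>]) (auto simp: proj2_eq_vector)
qed

text \<open>Moving from \<open>x\<close> along \<open>e\<close> makes \<open>\<Gamma>\<close>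
  positive at once, so \<open>x\<close> is a limit of points of \<open>D\<close> without being
  one.\<close>

lemma frontier_chart:
  assumes D: "open D" and \<Gamma>: "continuous_on UNIV \<Gamma>"
    and chart: "D \<inter> ball p r = {x \<in> ball p r. \<Gamma> x > (0::real)}"
    and inc: "\<And>s. s > 0 \<Longrightarrow> \<Gamma> (x + s *\<^sub>R e) = \<Gamma> x + s" and e: "norm e = 1"
    and x: "x \<in> ball p r" "\<Gamma> x = 0"
  shows "x \<in> frontier D"
proof -
  have mem: "y \<in> ball p r \<Longrightarrow> y \<in> D \<longleftrightarrow> \<Gamma> y > 0" for y using chart by blast
  then have "x \<notin> D" using x by simp
  moreover have "x \<in> closure D"
    unfolding closure_approachable
  proof (intro allI impI)
    fix \<epsilon> :: real assume "\<epsilon> > 0"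
    define s where "s = min (\<epsilon> / 2) ((r - dist p x) / 2)"
    have s: "s > 0" "s < \<epsilon>" "s < r - dist p x" using \<open>\<epsilon> > 0\<close> x(1) by (auto simp: s_def min_def)
    have d: "dist (x + s *\<^sub>R e) x = s" using s(1) e by (simp add: dist_norm)
    have "dist p (x + s *\<^sub>R e) < r" using dist_triangle[of p "x + s *\<^sub>R e" x] d s(3) by (simp add: dist_commute)
    then have "x + s *\<^sub>R e \<in> D" using mem[of "x + s *\<^sub>R e"] inc[OF s(1)] x(2) s(1) by simp
    then show "\<exists>y\<in>D. dist y x < \<epsilon>" using d s(2) by (intro bexI[of _ "x + s *\<^sub>R e"]) simp_all
  qed
  ultimately show ?thesis using D by (simp add: frontier_def interior_open)
qed

text \<open>On \<open>K\<close> the indicator of \<open>D\<close> is the limit of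
  \<open>ramp (n * \<Gamma>)\<close>, with \<open>\<Gamma>\<close> the height above the graph.
  Integration by parts leaves \<open>h\<close> times a derivative of size at most
  \<open>2 * n * M\<close> in a layer of thickness \<open>1 / n\<close>, which in the limit is
  bounded by a multiple of the integral of \<open>\<bar>h\<bar>\<close> along the graph.
  Cauchy-Schwarz and the comparison with Hausdorff measure finish the estimate. The constant depends
  on \<open>K\<close> but not on \<open>h\<close>.\<close>

lemma graph_boundary_estimate:
  fixes D :: "(real^3) set"
  assumes D: "open D" and T: "orthogonal_transformation T" and \<gamma>: "continuous_on UNIV \<gamma>"
    and \<Gamma>1: "cont_diff 1 (\<lambda>x. T x $ 3 - \<gamma> (proj2 (T x)))"
    and chart: "D \<inter> ball p r = {x \<in> ball p r. T x $ 3 - \<gamma> (proj2 (T x)) > 0}"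
    and K: "compact K" "K \<subseteq> ball p r"
  shows "\<exists>C\<ge>0. \<forall>h b. cont_diff 1 h \<and> (\<forall>x. x \<notin> K \<longrightarrow> h x = 0) \<and> b \<in> Basis \<longrightarrow>
    ennreal ((\<integral>x. indicator D x * partial_deriv b h x \<partial>lborel)\<^sup>2)
      \<le> ennreal C * (\<integral>\<^sup>+x\<in>frontier D. ennreal ((h x)\<^sup>2) \<partial>hausdorff2)"
proof -
  define \<Gamma> where "\<Gamma> x = T x $ 3 - \<gamma> (proj2 (T x))" for x
  have \<Gamma>: "cont_diff 1 \<Gamma>" using \<Gamma>1 by (simp add: \<Gamma>_def[abs_def])
  have \<Gamma>c: "continuous_on A \<Gamma>" for A by (rule cont_diff_continuous[OF \<Gamma>])
  have [measurable]: "\<Gamma> \<in> borel_measurable borel" using \<Gamma>c by (rule borel_measurable_continuous_onI)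
  have bij: "bij T" using T by (rule orthogonal_transformation_bij)
  have Tl: "linear T" using T by (rule orthogonal_transformation_linear)
  have S: "orthogonal_transformation (inv T)" using T by (rule orthogonal_transformation_inv)
  have TS: "T (inv T y) = y" for y using bij by (simp add: bij_is_surj surj_f_inv_f)
  have Sc: "continuous_on UNIV (inv T)"
    using S by (rule orthogonal_transformation_continuous)
  define \<sigma> where "\<sigma> z = inv T (vec3 z (\<gamma> z))" for z
  have \<sigma>c: "continuous_on UNIV \<sigma>" unfolding \<sigma>_def
    by (intro continuous_on_compose2[OF Sc] continuous_intros \<gamma>) auto
  have [measurable]: "\<sigma> \<in> borel_measurable borel" using \<sigma>c by (rule borel_measurable_continuous_onI)
  have proj: "proj2 (T (\<sigma> z)) = z" for z by (simp add: \<sigma>_def TS)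
  have lip: "dist (proj2 (T x)) (proj2 (T y)) \<le> dist x y" for x y
  proof -
    have "proj2 (T x) - proj2 (T y) = proj2 (T (x - y))"
      by (simp add: linear_diff[OF Tl] linear_diff[OF bounded_linear.linear[OF bounded_linear_proj2]])
    then show ?thesis
      using norm_proj2_le[of "T (x - y)"] T by (simp add: dist_norm orthogonal_transformation_norm)
  qed
  \<comment> \<open>Only graph points in \<open>K\<close> matter for \<open>h\<close>; there the
    chart is valid, so they are boundary points of \<open>D\<close>.\<close>
  have \<sigma>S: "\<sigma> z \<in> frontier D" if "\<sigma> z \<in> K" for z
  proof (rule frontier_chart[OF D \<Gamma>c chart[folded \<Gamma>_def]])
    show "norm (inv T (axis 3 1)) = 1" using S by (simp add: orthogonal_transformation_norm)
    show "\<Gamma> (\<sigma> z + s *\<^sub>R inv T (axis 3 1)) = \<Gamma> (\<sigma> z) + s" for s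
    proof -
      have "T (\<sigma> z + s *\<^sub>R inv T (axis 3 1)) = vec3 z (\<gamma> z + s)"
        by (simp add: linear_add[OF Tl] linear_cmul[OF Tl] TS \<sigma>_def vec3_add)
      then show ?thesis by (simp add: \<Gamma>_def \<sigma>_def TS)
    qed
    show "\<sigma> z \<in> ball p r" using that K(2) by blast
    show "\<Gamma> (\<sigma> z) = 0" by (simp add: \<Gamma>_def \<sigma>_def TS)
  qed
  obtain M where M: "M > 0" "\<And>x b. x \<in> K \<Longrightarrow> b \<in> Basis \<Longrightarrow> \<bar>partial_deriv b \<Gamma> x\<bar> \<le> M"
  proof -
    have "\<exists>B>0. \<forall>x\<in>K. \<bar>partial_deriv b \<Gamma> x\<bar> \<le> B" if "b \<in> Basis" for b
    proof -
      have "bounded (partial_deriv b \<Gamma> ` K)"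
        using K(1) cont_diff_1D(2)[OF \<Gamma> that] by (intro compact_imp_bounded compact_continuous_image)
      then show ?thesis by (auto simp: bounded_pos)
    qed
    then obtain B where B: "\<And>b. b \<in> Basis \<Longrightarrow> B b > 0"
      "\<And>b x. b \<in> Basis \<Longrightarrow> x \<in> K \<Longrightarrow> \<bar>partial_deriv b \<Gamma> x\<bar> \<le> B b" by metis
    have le: "B b \<le> sum B Basis" if "b \<in> Basis" for b
      using B(1) that by (intro member_le_sum) (auto intro: less_imp_le)
    have "sum B Basis > 0" using B(1) by (intro sum_pos) auto
    then show ?thesis using B(2) le by (intro that[of "sum B Basis"]) (auto intro: order_trans)
  qed
  obtain R where R: "\<And>x. x \<in> K \<Longrightarrow> norm x \<le> R"
    using K(1) compact_imp_bounded bounded_iff by metis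
  define Q :: "(real^2) set" where "Q = cball 0 R"
  have \<sigma>Q: "z \<in> Q" if "\<sigma> z \<in> K" for z
    using R[OF that] norm_proj2_le[of "T (\<sigma> z)"] T
    by (simp add: proj Q_def orthogonal_transformation_norm)
  have Qc: "compact Q" by (simp add: Q_def)
  define V where "V = (\<integral>z. (indicator Q z :: real)\<^sup>2 \<partial>lborel)"
  have V: "V \<ge> 0" by (simp add: V_def)
  \<comment> \<open>The integral will be bounded by \<open>2 * M * N\<close>, with \<open>N\<close>
    the integral of \<open>\<bar>h (\<sigma> z)\<bar>\<close>. Squaring gives
    \<open>4 * M^2\<close>, Cauchy-Schwarz over \<open>Q\<close> contributes its area
    \<open>V\<close>, and \<open>16 / pi\<close> comes from the Hausdorff measure.\<close>
  define C where "C = 4 * M\<^sup>2 * V * (16 / pi)"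
  have "ennreal ((\<integral>x. indicator D x * partial_deriv b h x \<partial>lborel)\<^sup>2)
      \<le> ennreal C * (\<integral>\<^sup>+x\<in>frontier D. ennreal ((h x)\<^sup>2) \<partial>hausdorff2)"
    if h: "cont_diff 1 h" "\<And>x. x \<notin> K \<Longrightarrow> h x = 0" and b: "b \<in> Basis" for h b
  proof -
    have hc: "continuous_on A h" for A by (rule cont_diff_continuous[OF h(1)])
    have [measurable]: "h \<in> borel_measurable borel" using hc by (rule borel_measurable_continuous_onI)
    have dc: "continuous_on A (partial_deriv b h)" for A by (rule cont_diff_1D(2)[OF h(1) b])
    have d0: "partial_deriv b h x = 0" if "x \<notin> K" for x
      using K(1) h(2) that by (rule partial_deriv_outside_support)
    have [measurable]: "partial_deriv b h \<in> borel_measurable borel"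
      using dc by (rule borel_measurable_continuous_onI)
    have di: "integrable lborel (partial_deriv b h)"
      by (rule continuous_compact_support_integrable[OF dc K(1) d0])
    have hi: "integrable lborel h" by (rule continuous_compact_support_integrable[OF hc K(1) h(2)])
    have h\<sigma>c: "continuous_on UNIV (\<lambda>z. \<bar>h (\<sigma> z)\<bar>)"
      by (intro continuous_intros continuous_on_compose2[OF hc \<sigma>c]) auto
    have h\<sigma>0: "\<bar>h (\<sigma> z)\<bar> = 0" if "z \<notin> Q" for z using that \<sigma>Q[of z] h(2)[of "\<sigma> z"] by auto
    define N where "N = (\<integral>z. \<bar>h (\<sigma> z)\<bar> \<partial>lborel)"
    have N: "(\<integral>\<^sup>+z. ennreal \<bar>h (\<sigma> z)\<bar> \<partial>lborel) = ennreal N" "N \<ge> 0" unfolding N_def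
      using continuous_compact_support_integrable[OF h\<sigma>c Qc h\<sigma>0] by (auto intro: nn_integral_eq_integral)
    define I where "I = (\<integral>x. indicator D x * partial_deriv b h x \<partial>lborel)"
    define In where "In n = (\<integral>x. partial_deriv b h x * ramp (real (Suc n) * \<Gamma> x) \<partial>lborel)" for n
    have rampc: "continuous_on UNIV ramp" by (rule cont_diff_continuous[OF cont_diff_ramp])
    have [measurable]: "ramp \<in> borel_measurable borel" using rampc by (rule borel_measurable_continuous_onI)
    \<comment> \<open>Where \<open>\<Gamma> x > 0\<close> the ramp is eventually equal to 1; where
      \<open>\<Gamma> x \<le> 0\<close> it is 0; off \<open>K\<close> the factor
      \<open>partial_deriv b h x\<close> vanishes.\<close>
    have lim: "In \<longlonglongrightarrow> I"
      unfolding In_def I_def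
    proof (rule integral_dominated_convergence[where w = "\<lambda>x. \<bar>partial_deriv b h x\<bar>"])
      show "AE x in lborel. (\<lambda>n. partial_deriv b h x * ramp (real (Suc n) * \<Gamma> x)) \<longlonglongrightarrow> indicator D x * partial_deriv b h x"
      proof (rule AE_I2)
        fix x
        show "(\<lambda>n. partial_deriv b h x * ramp (real (Suc n) * \<Gamma> x)) \<longlonglongrightarrow> indicator D x * partial_deriv b h x"
        proof (cases "x \<in> K")
          case True
          then have xb: "x \<in> ball p r" using K(2) by blast
          have mem: "x \<in> D \<longleftrightarrow> \<Gamma> x > 0" using chart xb unfolding \<Gamma>_def by blast
          show ?thesis
          proof (cases "\<Gamma> x > 0")
            case pos: True
            then have "x \<in> D" using mem by simp
            obtain n0 :: nat where n0: "1 / \<Gamma> x \<le> real n0" using real_arch_simple by blast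
            have "\<forall>\<^sub>F n in sequentially.
                partial_deriv b h x * ramp (real (Suc n) * \<Gamma> x) = indicator D x * partial_deriv b h x"
              using eventually_ge_at_top[of n0]
            proof eventually_elim
              case (elim n)
              then have "1 / \<Gamma> x \<le> real (Suc n)" using n0 by simp
              then have "1 \<le> real (Suc n) * \<Gamma> x" using pos by (simp add: field_simps)
              then show ?case using \<open>x \<in> D\<close> by (simp add: ramp_simps del: of_nat_Suc)
            qed
            then show ?thesis by (rule tendsto_eventually)
          next
            case False
            then have "x \<notin> D" using mem by simp
            moreover have "real (Suc n) * \<Gamma> x \<le> 0" for n using False by (simp add: mult_nonneg_nonpos)
            ultimately show ?thesis by (simp add: ramp_simps del: of_nat_Suc)
          qed
        qed (simp add: d0)
      qed
      show "AE x in lborel. norm (partial_deriv b h x * ramp (real (Suc n) * \<Gamma> x)) \<le> \<bar>partial_deriv b h x\<bar>" for n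
        using ramp_bounds mult_left_mono[OF ramp_bounds(2), of "\<bar>partial_deriv b h _\<bar>"] by (auto simp: abs_mult)
      show "(\<lambda>x. indicator D x * partial_deriv b h x) \<in> borel_measurable lborel"
        using D di by (intro borel_measurable_times borel_measurable_indicator) auto
      show "(\<lambda>x. partial_deriv b h x * ramp (real (Suc n) * \<Gamma> x)) \<in> borel_measurable lborel" for n by measurable
    qed (use di in simp)
    \<comment> \<open>The partial derivative of the product \<open>F\<close> of \<open>h\<close> and
      \<open>\<rho>\<close> has integral 0, so \<open>In n\<close> is minus the integral of
      \<open>h\<close> times the derivative of \<open>\<rho>\<close>, which lives where
      \<open>0 \<le> \<Gamma> x \<le> 1 / (n + 1)\<close>.\<close>
    have layer: "\<bar>In n\<bar> \<le> 2 * M * (real (Suc n) * (\<integral>x. \<bar>h x\<bar> * indicator {0..1 / real (Suc n)} (\<Gamma> x) \<partial>lborel))" for n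
    proof -
      let ?n = "real (Suc n)"
      define \<rho> where "\<rho> x = ramp (?n * \<Gamma> x)" for x
      have \<rho>1: "cont_diff 1 \<rho>" unfolding \<rho>_def
        by (intro cont_diff_compose[OF cont_diff_ramp] cont_diff_mult cont_diff_const \<Gamma>)
      have "(\<rho> has_derivative (\<lambda>d. ramp' (?n * \<Gamma> x) * (?n * partial_deriv d \<Gamma> x))) (at x)" for x
        unfolding \<rho>_def
        by (rule has_derivative_compose[OF has_derivative_mult_right[OF cont_diff_1D(1)[OF \<Gamma>]]
            DERIV_ramp[unfolded has_field_derivative_def]])
      note d\<rho> = partial_deriv_eq[OF this]
      define F where "F x = h x * \<rho> x" for x
      have F1: "cont_diff 1 F" unfolding F_def by (intro cont_diff_mult h(1) \<rho>1)
      have F0: "F x = 0" if "x \<notin> K" for x using h(2)[OF that] by (simp add: F_def)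
      have dF: "partial_deriv b F x = h x * (ramp' (?n * \<Gamma> x) * (?n * partial_deriv b \<Gamma> x))
          + partial_deriv b h x * \<rho> x" for x
        unfolding F_def d\<rho>[symmetric]
        by (rule partial_deriv_eq[OF has_derivative_mult[OF cont_diff_1D(1)[OF h(1)] cont_diff_1D(1)[OF \<rho>1]]])
      have \<rho>c: "continuous_on UNIV \<rho>" by (rule cont_diff_continuous[OF \<rho>1])
      have i2: "integrable lborel (\<lambda>x. partial_deriv b h x * \<rho> x)"
        using d0 by (intro continuous_compact_support_integrable[OF _ K(1)] continuous_intros dc \<rho>c) auto
      have i1: "integrable lborel (\<lambda>x. h x * (ramp' (?n * \<Gamma> x) * (?n * partial_deriv b \<Gamma> x)))"
        unfolding d\<rho>[symmetric] using h(2)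
        by (intro continuous_compact_support_integrable[OF _ K(1)] continuous_intros hc cont_diff_1D(2)[OF \<rho>1 b]) auto
      have hb: "integrable lborel (\<lambda>x. \<bar>h x\<bar> * indicator {0..1 / ?n} (\<Gamma> x))"
        using hi by (intro integrable_mult_bounded[where B = 1]) (auto simp: indicator_def)
      have "(\<integral>x. partial_deriv b F x \<partial>lborel) = 0"
        by (rule integral_partial_deriv_eq_0[OF F1 K(1) F0 b])
      then have "In n = - (\<integral>x. h x * (ramp' (?n * \<Gamma> x) * (?n * partial_deriv b \<Gamma> x)) \<partial>lborel)"
        unfolding dF using i1 i2 by (simp add: In_def \<rho>_def)
      also have "\<bar>\<dots>\<bar> \<le> (\<integral>x. 2 * M * (?n * (\<bar>h x\<bar> * indicator {0..1 / ?n} (\<Gamma> x))) \<partial>lborel)"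
        unfolding abs_minus_cancel
      proof (intro integral_abs_bound[THEN order_trans] integral_mono)
        show "\<bar>h x * (ramp' (?n * \<Gamma> x) * (?n * partial_deriv b \<Gamma> x))\<bar>
            \<le> 2 * M * (?n * (\<bar>h x\<bar> * indicator {0..1 / ?n} (\<Gamma> x)))" for x
        proof (cases "x \<in> K")
          case True
          have ind: "indicator {0..1} (?n * \<Gamma> x) = (indicator {0..1 / ?n} (\<Gamma> x) :: real)"
          proof -
            have "0 \<le> ?n * \<Gamma> x \<longleftrightarrow> 0 \<le> \<Gamma> x" "?n * \<Gamma> x \<le> 1 \<longleftrightarrow> \<Gamma> x \<le> 1 / ?n"
              by (simp_all add: zero_le_mult_iff pos_le_divide_eq mult.commute del: of_nat_Suc)
            then show ?thesis by (simp add: indicator_def del: of_nat_Suc)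
          qed
          have "\<bar>ramp' (?n * \<Gamma> x)\<bar> * \<bar>partial_deriv b \<Gamma> x\<bar> \<le> (2 * indicator {0..1 / ?n} (\<Gamma> x)) * M"
            using abs_ramp'_le[of "?n * \<Gamma> x"] M(2)[OF True b] unfolding ind
            by (intro mult_mono) auto
          then have "?n * \<bar>h x\<bar> * (\<bar>ramp' (?n * \<Gamma> x)\<bar> * \<bar>partial_deriv b \<Gamma> x\<bar>)
              \<le> ?n * \<bar>h x\<bar> * ((2 * indicator {0..1 / ?n} (\<Gamma> x)) * M)"
            by (rule mult_left_mono) simp
          then show ?thesis by (simp only: abs_mult abs_of_nat ac_simps)
        qed (simp add: h(2))
      qed (use i1 hb in auto)
      finally show ?thesis by (simp add: mult.assoc)
    qed
    \<comment> \<open>The factor \<open>n + 1\<close> from the derivative cancels the thickness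
      \<open>1 / (n + 1)\<close> of the layer; the tolerance \<open>e / (2 * M)\<close> makes up for
      the prefactor \<open>2 * M\<close>.\<close>
    have "\<bar>I\<bar> \<le> 2 * M * N + e" if e: "e > 0" for e
    proof -
      have pos: "e / (2 * M) > 0" using e M(1) by simp
      obtain \<epsilon>0 where \<epsilon>0: "\<epsilon>0 > 0" "\<And>\<epsilon>. 0 < \<epsilon> \<Longrightarrow> \<epsilon> < \<epsilon>0 \<Longrightarrow>
        (\<integral>\<^sup>+x. ennreal (\<bar>h x\<bar> * indicator {0..\<epsilon>} (\<Gamma> x)) \<partial>lborel) \<le> ennreal \<epsilon> * (ennreal N + ennreal (e / (2 * M)))"
        using graph_layer_bound[OF T \<gamma> hc K(1) h(2) pos]
        unfolding \<Gamma>_def[symmetric] \<sigma>_def[symmetric] N(1) by blast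
      obtain n0 where n0: "inverse (real (Suc n0)) < \<epsilon>0" using reals_Archimedean[OF \<epsilon>0(1)] by blast
      have "\<bar>In n\<bar> \<le> 2 * M * N + e" if "n \<ge> n0" for n
      proof -
        let ?n = "real (Suc n)"
        have "1 / ?n \<le> 1 / real (Suc n0)" using that by (intro divide_left_mono) auto
        then have lt: "1 / ?n < \<epsilon>0" using n0 by (simp add: inverse_eq_divide)
        let ?J = "\<integral>x. \<bar>h x\<bar> * indicator {0..1 / ?n} (\<Gamma> x) \<partial>lborel"
        have "integrable lborel (\<lambda>x. \<bar>h x\<bar> * indicator {0..1 / ?n} (\<Gamma> x))"
          using hi by (intro integrable_mult_bounded[where B = 1]) (auto simp: indicator_def)
        then have "ennreal ?J = (\<integral>\<^sup>+x. ennreal (\<bar>h x\<bar> * indicator {0..1 / ?n} (\<Gamma> x)) \<partial>lborel)"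
          by (intro nn_integral_eq_integral[symmetric]) auto
        also have "\<dots> \<le> ennreal (1 / ?n) * (ennreal N + ennreal (e / (2 * M)))" by (intro \<epsilon>0(2) lt) simp
        also have "\<dots> = ennreal (1 / ?n * (N + e / (2 * M)))"
          using N(2) pos by (subst ennreal_mult) (auto intro: add_nonneg_nonneg)
        finally have "?J \<le> 1 / ?n * (N + e / (2 * M))"
          using N(2) e M(1) by (subst (asm) ennreal_le_iff) (auto simp del: of_nat_Suc)
        then have "?n * ?J \<le> N + e / (2 * M)" by (simp add: field_simps del: of_nat_Suc)
        then have "2 * M * (?n * ?J) \<le> 2 * M * (N + e / (2 * M))" using M(1) by (intro mult_left_mono) auto
        also have "\<dots> = 2 * M * N + e" using M(1) by (simp add: field_simps)
        finally show ?thesis using layer[of n] by linarith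
      qed
      moreover have "(\<lambda>n. \<bar>In n\<bar>) \<longlonglongrightarrow> \<bar>I\<bar>" using lim by (rule tendsto_rabs)
      ultimately show ?thesis by (intro LIMSEQ_le_const2) auto
    qed
    then have "\<bar>I\<bar> \<le> 2 * M * N" by (rule field_le_epsilon)
    then have I2: "I\<^sup>2 \<le> 4 * M\<^sup>2 * N\<^sup>2"
      using power_mono[of "\<bar>I\<bar>" "2 * M * N" 2] by (simp add: power_mult_distrib)
    have sq: "sq_integrable (\<lambda>z. \<bar>h (\<sigma> z)\<bar>)" by (rule sq_integrable_continuous[OF h\<sigma>c Qc h\<sigma>0])
    have "sq_integrable (indicator Q :: real^2 \<Rightarrow> real)"
      by (rule sq_integrable_bounded_support[of _ 1 Q]) (auto simp: Q_def borel_measurable_indicator borel_closed)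
    from Cauchy_Schwarz_integral[OF sq this]
    have "(\<integral>z. \<bar>h (\<sigma> z)\<bar> * indicator Q z \<partial>lborel)\<^sup>2 \<le> (\<integral>z. (h (\<sigma> z))\<^sup>2 \<partial>lborel) * V"
      by (simp add: V_def)
    moreover have "\<bar>h (\<sigma> z)\<bar> * indicator Q z = \<bar>h (\<sigma> z)\<bar>" for z using h\<sigma>0[of z] by (cases "z \<in> Q") auto
    ultimately have N2: "N\<^sup>2 \<le> (\<integral>z. (h (\<sigma> z))\<^sup>2 \<partial>lborel) * V" by (simp only: N_def)
    have "I\<^sup>2 \<le> 4 * M\<^sup>2 * V * (\<integral>z. (h (\<sigma> z))\<^sup>2 \<partial>lborel)"
      using I2 mult_left_mono[OF N2, of "4 * M\<^sup>2"] by (simp add: ac_simps)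
    then have "ennreal (I\<^sup>2) \<le> ennreal (4 * M\<^sup>2 * V) * ennreal (\<integral>z. (h (\<sigma> z))\<^sup>2 \<partial>lborel)"
      using V by (simp add: ennreal_mult[symmetric] ennreal_leI)
    also have "ennreal (\<integral>z. (h (\<sigma> z))\<^sup>2 \<partial>lborel) = (\<integral>\<^sup>+z. ennreal ((h (\<sigma> z))\<^sup>2) \<partial>lborel)"
      using sq by (intro nn_integral_eq_integral[symmetric]) (auto simp: sq_integrable_def)
    also have "\<dots> = (\<integral>\<^sup>+z. ennreal ((h (\<sigma> z))\<^sup>2) * indicator (frontier D) (\<sigma> z) \<partial>lborel)"
      using \<sigma>S h(2) by (intro nn_integral_cong) (auto simp: indicator_def)
    also have "\<dots> \<le> ennreal (16 / pi) * (\<integral>\<^sup>+x\<in>frontier D. ennreal ((h x)\<^sup>2) \<partial>hausdorff2)"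
    proof (rule nn_integral_graph_le_hausdorff2[OF lip proj])
      have "frontier D \<in> sets borel" by (intro borel_closed frontier_closed)
      then show "(\<lambda>x. ennreal ((h x)\<^sup>2) * indicator (frontier D) x) \<in> borel_measurable borel" by measurable
    qed measurable
    finally have fin: "ennreal (I\<^sup>2) \<le> ennreal (4 * M\<^sup>2 * V) *
        (ennreal (16 / pi) * (\<integral>\<^sup>+x\<in>frontier D. ennreal ((h x)\<^sup>2) \<partial>hausdorff2))"
      by (simp add: mult_left_mono)
    have "ennreal C = ennreal (4 * M\<^sup>2 * V) * ennreal (16 / pi)"
      unfolding C_def using V by (intro ennreal_mult) auto
    then show ?thesis using fin by (simp only: I_def mult.assoc)
  qed
  moreover have "C \<ge> 0" using V by (simp add: C_def)
  ultimately show ?thesis by blast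
qed

section \<open>Localization at the boundary\<close>

text \<open>Interior points are included, with constant 0, so that a cover of the compact closure
  can treat all points alike. The radius is fixed before \<open>K\<close>, while the constant may
  depend on \<open>K\<close>.\<close>

lemma boundary_estimate:
  fixes D :: "(real^3) set"
  assumes D: "open D" "C2_boundary D" and p: "p \<in> closure D"
  shows "\<exists>r>0. \<forall>K. compact K \<and> K \<subseteq> ball p r \<longrightarrow> (\<exists>C\<ge>0. \<forall>h b. cont_diff 1 h \<and> (\<forall>x. x \<notin> K \<longrightarrow> h x = 0) \<and> b \<in> Basis \<longrightarrow>
    ennreal ((\<integral>x. indicator D x * partial_deriv b h x \<partial>lborel)\<^sup>2)
      \<le> ennreal C * (\<integral>\<^sup>+x\<in>frontier D. ennreal ((h x)\<^sup>2) \<partial>hausdorff2))"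
proof (cases "p \<in> D")
  case True
  then obtain r where r: "r > 0" "ball p r \<subseteq> D" using D(1) open_contains_ball by blast
  have z: "(\<integral>x. indicator D x * partial_deriv b h x \<partial>lborel) = 0"
    if "compact K" "K \<subseteq> ball p r" "cont_diff 1 h" "\<And>x. x \<notin> K \<Longrightarrow> h x = 0" "b \<in> Basis" for K h b
  proof -
    have "indicator D x * partial_deriv b h x = partial_deriv b h x" for x
      using that(2) r(2) partial_deriv_outside_support[of K h x b, OF that(1,4)] by (cases "x \<in> D") auto
    moreover have "(\<integral>x. partial_deriv b h x \<partial>lborel) = 0"
      by (rule integral_partial_deriv_eq_0[OF that(3,1) _ that(5)]) (rule that(4))
    ultimately show ?thesis by (simp only:)
  qed
  have "ennreal ((\<integral>x. indicator D x * partial_deriv b h x \<partial>lborel)\<^sup>2)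
      \<le> ennreal 0 * (\<integral>\<^sup>+x\<in>frontier D. ennreal ((h x)\<^sup>2) \<partial>hausdorff2)"
    if "compact K \<and> K \<subseteq> ball p r" "cont_diff 1 h \<and> (\<forall>x. x \<notin> K \<longrightarrow> h x = 0) \<and> b \<in> Basis" for K h b
  proof -
    have "(\<integral>x. indicator D x * partial_deriv b h x \<partial>lborel) = 0"
      using that by (intro z[of K h b]) blast+
    then show ?thesis by simp
  qed
  then show ?thesis using r(1) by (intro exI[of _ r] conjI allI impI exI[of _ "0 :: real"]) auto
next
  case False
  then have "p \<in> frontier D" using p D(1) by (simp add: frontier_def interior_open)
  then show ?thesis
  proof (rule C2_boundary_chart[OF D(2)])
    fix r and T :: "real^3 \<Rightarrow> real^3" and \<gamma>
    assume "r > 0" "orthogonal_transformation T" "continuous_on UNIV \<gamma>"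
      "cont_diff 1 (\<lambda>x. T x $ 3 - \<gamma> (proj2 (T x)))"
      "D \<inter> ball p r = {x \<in> ball p r. T x $ 3 - \<gamma> (proj2 (T x)) > 0}"
    then show ?thesis using graph_boundary_estimate[OF D(1), of T \<gamma> p r] by (intro exI[of _ r]) blast
  qed
qed

text \<open>In a chart the third axis points into \<open>D\<close>: near \<open>p\<close> the points
  of the closure have height at least 0, and a shift by \<open>s\<close> raises the height by
  \<open>s\<close>. Compactness of \<open>K\<close> then allows a whole ball of shifts around
  \<open>c\<close>.\<close>

lemma inward_direction:
  fixes D :: "(real^3) set"
  assumes D: "open D" "C2_boundary D" and p: "p \<in> closure D"
  shows "\<exists>r>0. \<forall>K \<delta>. compact K \<and> K \<subseteq> closure D \<inter> ball p r \<and> \<delta> > 0 \<longrightarrow>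
    (\<exists>c \<eta>. \<eta> > 0 \<and> cball c \<eta> \<subseteq> ball 0 \<delta> \<and> (\<forall>x\<in>K. \<forall>y\<in>cball c \<eta>. x + y \<in> D))"
proof -
  have "\<exists>r>0. \<exists>e. norm e \<le> 1 \<and> (\<forall>x\<in>closure D \<inter> ball p r. \<forall>s. 0 < s \<and> s < r \<longrightarrow> x + s *\<^sub>R e \<in> D)"
  proof (cases "p \<in> D")
    case True
    then obtain r where "r > 0" "ball p r \<subseteq> D" using D(1) open_contains_ball by blast
    \<comment> \<open>At an interior point no motion is required, so the direction is 0.\<close>
    then show ?thesis by (intro exI[of _ r] conjI exI[of _ 0]) auto
  next
    case False
    then have "p \<in> frontier D" using p D(1) by (simp add: frontier_def interior_open)
    then show ?thesis
    proof (rule C2_boundary_chart[OF D(2)])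
      fix r and T :: "real^3 \<Rightarrow> real^3" and \<gamma>
      assume r: "r > 0" and T: "orthogonal_transformation T"
        and \<Gamma>: "cont_diff 1 (\<lambda>x. T x $ 3 - \<gamma> (proj2 (T x)))"
        and chart: "D \<inter> ball p r = {x \<in> ball p r. T x $ 3 - \<gamma> (proj2 (T x)) > 0}"
      define \<Gamma> where "\<Gamma> x = T x $ 3 - \<gamma> (proj2 (T x))" for x
      have \<Gamma>c: "continuous_on UNIV \<Gamma>" unfolding \<Gamma>_def by (rule cont_diff_continuous[OF \<Gamma>])
      have mem: "x \<in> D \<longleftrightarrow> \<Gamma> x > 0" if "x \<in> ball p r" for x using chart that unfolding \<Gamma>_def by blast
      define e where "e = inv T (axis 3 1)"
      have "T e = axis 3 1"
        unfolding e_def using orthogonal_transformation_bij[OF T] by (simp add: bij_is_surj surj_f_inv_f)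
      then have Te: "T (x + s *\<^sub>R e) = T x + s *\<^sub>R axis 3 1" for x s
        by (simp add: linear_add[OF orthogonal_transformation_linear[OF T]]
            linear_cmul[OF orthogonal_transformation_linear[OF T]])
      have inc: "\<Gamma> (x + s *\<^sub>R e) = \<Gamma> x + s" for x s
      proof -
        have "proj2 (T x + s *\<^sub>R axis 3 1) = proj2 (T x)"
          by (simp add: proj2_def axis_def)
        then show ?thesis by (simp add: \<Gamma>_def Te)
      qed
      have e: "norm e = 1"
        unfolding e_def using orthogonal_transformation_inv[OF T] by (simp add: orthogonal_transformation_norm)
      \<comment> \<open>Halving the radius keeps the shifted point in the ball where the chart is
        valid.\<close>
      have "x + s *\<^sub>R e \<in> D" if x: "x \<in> closure D" "x \<in> ball p (r / 2)" and s: "0 < s" "s < r / 2" for x s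
      proof -
        have "x \<in> ball p r" using x(2) r by auto
        then have "x \<in> closure (D \<inter> ball p r)"
          using open_Int_closure_subset[of "ball p r" D] x(1) by (auto simp: Int_commute)
        also have "\<dots> \<subseteq> {x. \<Gamma> x \<ge> 0}"
        proof (rule closure_minimal)
          show "closed {x. \<Gamma> x \<ge> 0}" using \<Gamma>c by (intro closed_Collect_le continuous_intros)
        qed (use mem in \<open>auto intro: less_imp_le\<close>)
        finally have "\<Gamma> x \<ge> 0" by simp
        have "dist x (x + s *\<^sub>R e) = s" using e s(1) by (simp add: dist_norm)
        then have "dist p (x + s *\<^sub>R e) < r" using dist_triangle[of p "x + s *\<^sub>R e" x] x(2) s(2) by simp
        then show ?thesis using mem[of "x + s *\<^sub>R e"] inc[of x s] \<open>\<Gamma> x \<ge> 0\<close> s(1) by simp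
      qed
      then show ?thesis using r e by (intro exI[of _ "r / 2"] conjI exI[of _ e]) auto
    qed
  qed
  then obtain r e where r: "r > 0" and e: "norm e \<le> 1"
    and into: "\<And>x s. x \<in> closure D \<inter> ball p r \<Longrightarrow> 0 < s \<Longrightarrow> s < r \<Longrightarrow> x + s *\<^sub>R e \<in> D"
    by blast
  have "\<exists>c \<eta>. \<eta> > 0 \<and> cball c \<eta> \<subseteq> ball 0 \<delta> \<and> (\<forall>x\<in>K. \<forall>y\<in>cball c \<eta>. x + y \<in> D)"
    if K: "compact K" "K \<subseteq> closure D \<inter> ball p r" and \<delta>: "\<delta> > 0" for K \<delta>
  proof -
    define s where "s = min r \<delta> / 2"
    have s: "0 < s" "s < r" "s \<le> \<delta> / 2" using r \<delta> by (auto simp: s_def)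
    define c where "c = s *\<^sub>R e"
    have "norm c = s * norm e" using s(1) by (simp add: c_def)
    also have "\<dots> \<le> s * 1" using e s(1) by (intro mult_left_mono) auto
    finally have nc: "norm c \<le> \<delta> / 2" using s(3) by simp
    have "compact ((\<lambda>x. x + c) ` K)" using K(1) by (intro compact_continuous_image continuous_intros)
    moreover have "(\<lambda>x. x + c) ` K \<subseteq> D" using into[OF _ s(1,2)] K(2) unfolding c_def by blast
    ultimately obtain \<eta> where \<eta>: "\<eta> > 0" "(\<Union>x\<in>(\<lambda>x. x + c) ` K. cball x \<eta>) \<subseteq> D"
      using compact_subset_open_imp_cball_epsilon_subset[OF _ D(1)] by metis
    \<comment> \<open>\<open>norm c \<le> \<delta> / 2\<close> together with a radius of at most
      \<open>\<delta> / 3\<close> keeps the ball inside \<open>ball 0 \<delta>\<close>.\<close>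
    define \<eta>' where "\<eta>' = min \<eta> (\<delta> / 3)"
    have "cball c \<eta>' \<subseteq> ball 0 \<delta>"
    proof
      fix y assume "y \<in> cball c \<eta>'"
      then have "norm (y - c) \<le> \<delta> / 3" by (simp add: \<eta>'_def dist_norm norm_minus_commute)
      then show "y \<in> ball 0 \<delta>" using nc norm_triangle_ineq[of "y - c" c] \<delta> by simp
    qed
    moreover have "x + y \<in> D" if "x \<in> K" "y \<in> cball c \<eta>'" for x y
    proof -
      have "x + y \<in> cball (x + c) \<eta>" using that(2) by (simp add: \<eta>'_def dist_norm)
      then show ?thesis using \<eta>(2) that(1) by blast
    qed
    moreover have "\<eta>' > 0" using \<eta>(1) \<delta> by (simp add: \<eta>'_def)
    ultimately show ?thesis by blast
  qed
  then show ?thesis using r by blast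
qed

text \<open>A partition of unity in disguise: the balls of a finite cover are peeled off one at a
  time, splitting \<open>\<psi>\<close> into \<open>\<eta> x * \<psi> x\<close> and
  \<open>(1 - \<eta> x) * \<psi> x\<close>. The first part is supported near \<open>p\<close>, the
  second vanishes on the half-sized ball around \<open>p\<close>.\<close>

lemma smooth_localization:
  fixes X :: "'a::euclidean_space set" and P :: "('a \<Rightarrow> real) \<Rightarrow> bool"
  assumes X: "compact X"
    and local: "\<And>p. p \<in> X \<Longrightarrow> \<exists>r>0. \<forall>K \<psi>. compact K \<and> K \<subseteq> ball p r \<and> smooth \<psi> \<and> (\<forall>x. x \<notin> K \<longrightarrow> \<psi> x = 0) \<longrightarrow> P \<psi>"
    and zero: "\<And>\<psi>. smooth \<psi> \<Longrightarrow> (\<And>x. x \<in> X \<Longrightarrow> \<psi> x = 0) \<Longrightarrow> P \<psi>"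
    and add: "\<And>\<psi> \<psi>'. smooth \<psi> \<Longrightarrow> smooth \<psi>' \<Longrightarrow> P \<psi> \<Longrightarrow> P \<psi>' \<Longrightarrow> P (\<lambda>x. \<psi> x + \<psi>' x)"
    and \<psi>: "smooth \<psi>"
  shows "P \<psi>"
proof -
  have "\<forall>p\<in>X. \<exists>r>0. \<forall>K \<psi>. compact K \<and> K \<subseteq> ball p r \<and> smooth \<psi> \<and> (\<forall>x. x \<notin> K \<longrightarrow> \<psi> x = 0) \<longrightarrow> P \<psi>"
    using local by blast
  from bchoice[OF this] obtain r where r0: "\<forall>p\<in>X. r p > 0 \<and>
    (\<forall>K \<psi>. compact K \<and> K \<subseteq> ball p (r p) \<and> smooth \<psi> \<and> (\<forall>x. x \<notin> K \<longrightarrow> \<psi> x = 0) \<longrightarrow> P \<psi>)"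
    by blast
  have r: "\<And>p. p \<in> X \<Longrightarrow> r p > 0"
    "\<And>p K \<psi>. p \<in> X \<Longrightarrow> compact K \<Longrightarrow> K \<subseteq> ball p (r p) \<Longrightarrow> smooth \<psi> \<Longrightarrow> \<forall>x. x \<notin> K \<longrightarrow> \<psi> x = 0 \<Longrightarrow> P \<psi>"
    using r0 by blast+
  have "X \<subseteq> (\<Union>p\<in>X. ball p (r p / 2))" using r(1) by force
  then obtain F where F: "F \<subseteq> X" "finite F" "X \<subseteq> (\<Union>p\<in>F. ball p (r p / 2))"
    using compactE_image[OF X, of X "\<lambda>p. ball p (r p / 2)"] by blast
  \<comment> \<open>The induction over \<open>F\<close> needs the claim for every smooth
    \<open>\<psi>\<close> that vanishes at the points of \<open>X\<close> not covered by the balls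
    of \<open>F\<close>.\<close>
  have "P \<psi>" if "smooth \<psi>" "\<And>x. x \<in> X \<Longrightarrow> x \<notin> (\<Union>p\<in>F. ball p (r p / 2)) \<Longrightarrow> \<psi> x = 0" for \<psi>
    using F(2,1) that
  proof (induction F arbitrary: \<psi>)
    case empty
    then show ?case by (intro zero) auto
  next
    case (insert p F)
    have p: "p \<in> X" using insert.prems(1) by simp
    have "cball p (r p / 2) \<subseteq> ball p (r p)" using r(1)[OF p] by auto
    then obtain \<eta> L where \<eta>: "smooth \<eta>" "compact L" "L \<subseteq> ball p (r p)" "\<And>x. x \<notin> L \<Longrightarrow> \<eta> x = 0"
      "\<And>x. x \<in> cball p (r p / 2) \<Longrightarrow> \<eta> x = 1"
      using smooth_cutoff_exists[OF compact_cball[of p "r p / 2"] open_ball[of p "r p"]] by metis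
    have s: "smooth (\<lambda>x. \<eta> x * \<psi> x)" "smooth (\<lambda>x. (1 - \<eta> x) * \<psi> x)"
      using smooth_mult[OF \<eta>(1)] smooth_mult[OF smooth_diff[OF smooth_const \<eta>(1)]] insert.prems(2) by auto
    have "P (\<lambda>x. \<eta> x * \<psi> x)" by (rule r(2)[OF p \<eta>(2,3) s(1)]) (simp add: \<eta>(4))
    moreover have "P (\<lambda>x. (1 - \<eta> x) * \<psi> x)"
    proof (rule insert.IH[OF _ s(2)])
      show "F \<subseteq> X" using insert.prems(1) by simp
      fix x assume x: "x \<in> X" "x \<notin> (\<Union>p\<in>F. ball p (r p / 2))"
      show "(1 - \<eta> x) * \<psi> x = 0"
        using \<eta>(5)[of x] insert.prems(3)[OF x(1)] x(2) by (cases "x \<in> ball p (r p / 2)") auto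
    qed
    ultimately have "P (\<lambda>x. \<eta> x * \<psi> x + (1 - \<eta> x) * \<psi> x)" by (intro add s)
    then show ?case by (simp add: algebra_simps)
  qed
  then show ?thesis using \<psi> F(3) by blast
qed

lemma tendsto_0_if_square_le:
  fixes x y :: "nat \<Rightarrow> real"
  assumes "\<And>n. (x n)\<^sup>2 \<le> y n" "y \<longlonglongrightarrow> 0"
  shows "x \<longlonglongrightarrow> 0"
proof -
  have "(\<lambda>n. (x n)\<^sup>2) \<longlonglongrightarrow> 0"
    by (rule tendsto_sandwich[OF _ _ tendsto_const assms(2)]) (use assms(1) in auto)
  then have "(\<lambda>n. sqrt ((x n)\<^sup>2)) \<longlonglongrightarrow> sqrt 0" by (rule tendsto_real_sqrt)
  then show ?thesis by (simp add: tendsto_rabs_zero_iff)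
qed

lemma partial_deriv_reflect:
  fixes k :: "'a::euclidean_space \<Rightarrow> real"
  assumes "cont_diff 1 k"
  shows "partial_deriv b (\<lambda>x. k (z - x)) x = - partial_deriv b k (z - x)"
proof -
  have "((\<lambda>x. k (z - x)) has_derivative (\<lambda>h. partial_deriv (- h) k (z - x))) (at x)"
    by (rule has_derivative_compose[OF _ cont_diff_1D(1)[OF assms], of "\<lambda>x. z - x"])
      (auto intro!: derivative_eq_intros)
  from partial_deriv_eq[OF this, of b] show ?thesis
    using partial_deriv_scaleR[of 0 k "-1" b "z - x"] assms by simp
qed

text \<open>The weak derivative is assumed against all smooth functions, so the reflected kernel
  \<open>k (z - x)\<close> may be inserted; the sign from the reflection cancels that of the
  integration by parts.\<close>

lemma partial_deriv_convol:
  fixes u g :: "'a::euclidean_space \<Rightarrow> real"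
  assumes u: "integrable lborel u" and k: "mollifier c r k"
    and weak: "\<And>\<zeta>. smooth \<zeta> \<Longrightarrow> (\<integral>x. u x * partial_deriv b \<zeta> x \<partial>lborel) = - (\<integral>x. g x * \<zeta> x \<partial>lborel)"
  shows "partial_deriv b (convol u k) z = convol g k z"
proof -
  note kk = mollifierD[OF k]
  have k1: "cont_diff 1 k" using kk(1) by (simp add: smooth_def)
  have "partial_deriv b (convol u k) z = convol u (partial_deriv b k) z"
    by (rule partial_deriv_eq[OF convol_has_derivative[OF u k1 compact_cball kk(3)]])
  also have "\<dots> = - (\<integral>x. u x * partial_deriv b (\<lambda>x. k (z - x)) x \<partial>lborel)"
    by (simp add: convol_def partial_deriv_reflect[OF k1])
  also have "\<dots> = (\<integral>x. g x * k (z - x) \<partial>lborel)"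
    using weak[OF smooth_affine[OF kk(1), of "-1" z]] by simp
  finally show ?thesis by (simp add: convol_def)
qed

section \<open>Functions with vanishing trace\<close>

text \<open>
  \<open>U\<close> and \<open>G b\<close> are a function and its weak derivatives, extended by \<open>0\<close> outside \<open>D\<close>, and \<open>w\<close> is
  the approximating sequence from the definition of the trace.
\<close>

locale zero_trace =
  fixes D :: "(real^3) set" and U :: "real^3 \<Rightarrow> real" and G :: "real^3 \<Rightarrow> real^3 \<Rightarrow> real"
    and w :: "nat \<Rightarrow> real^3 \<Rightarrow> real"
  assumes D: "open D" "bounded D" "C2_boundary D"
    and U: "sq_integrable U" "\<And>x. x \<notin> D \<Longrightarrow> U x = 0"
    and G: "\<And>b. b \<in> Basis \<Longrightarrow> sq_integrable (G b)" "\<And>b x. b \<in> Basis \<Longrightarrow> x \<notin> D \<Longrightarrow> G b x = 0"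
    and w: "\<And>n. smooth (w n)"
    and wU: "(\<lambda>n. \<integral>\<^sup>+x\<in>D. ennreal ((w n x - U x)\<^sup>2) \<partial>lborel) \<longlonglongrightarrow> 0"
    and wG: "\<And>b. b \<in> Basis \<Longrightarrow>
      (\<lambda>n. \<integral>\<^sup>+x\<in>D. ennreal ((partial_deriv b (w n) x - G b x)\<^sup>2) \<partial>lborel) \<longlonglongrightarrow> 0"
    and trace: "(\<lambda>n. \<integral>\<^sup>+x\<in>frontier D. ennreal ((w n x)\<^sup>2) \<partial>hausdorff2) \<longlonglongrightarrow> 0"
begin

section \<open>Pairings of functions on \<open>D\<close> with smooth functions\<close>

lemma compact_closure_D: "compact (closure D)"
  using D(2) by (simp add: compact_closure)

lemma D_borel [measurable]: "D \<in> sets borel"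
  using D(1) by (rule borel_open)

lemma smooth_measurable: "smooth f \<Longrightarrow> f \<in> borel_measurable borel" for f :: "real^3 \<Rightarrow> real"
  by (intro borel_measurable_continuous_onI smooth_continuous)

lemma smooth_bounded_on_D:
  fixes f :: "real^3 \<Rightarrow> real"
  assumes "smooth f"
  obtains B where "B > 0" "\<And>x. x \<in> D \<Longrightarrow> \<bar>f x\<bar> \<le> B"
proof -
  have "bounded (f ` closure D)"
    using compact_closure_D assms by (intro compact_imp_bounded compact_continuous_image smooth_continuous)
  then obtain B where "B > 0" "\<forall>y\<in>f ` closure D. norm y \<le> B" by (auto simp: bounded_pos)
  then show ?thesis using closure_subset[of D] by (intro that[of B]) auto
qed

lemma sq_integrable_smooth_on_D:
  assumes "smooth f" shows "sq_integrable (\<lambda>x. indicator D x * f x)"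
proof -
  obtain B where B: "B > 0" "\<And>x. x \<in> D \<Longrightarrow> \<bar>f x\<bar> \<le> B" using smooth_bounded_on_D[OF assms] by blast
  note [measurable] = smooth_measurable[OF assms]
  show ?thesis
  proof (rule sq_integrable_bounded_support[of _ B D])
    show "\<bar>indicator D x * f x\<bar> \<le> B" for x using B by (cases "x \<in> D") auto
  qed (use D(2) in auto)
qed

lemma sq_integrable_smooth_mult:
  assumes "smooth f" "sq_integrable g" "\<And>x. x \<notin> D \<Longrightarrow> g x = 0"
  shows "sq_integrable (\<lambda>x. f x * g x)"
proof -
  obtain B where B: "B > 0" "\<And>x. x \<in> D \<Longrightarrow> \<bar>f x\<bar> \<le> B" using smooth_bounded_on_D[OF assms(1)] by blast
  note [measurable] = smooth_measurable[OF assms(1)]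
  have "sq_integrable (\<lambda>x. (indicator D x * f x) * g x)"
  proof (rule sq_integrable_bounded_mult[OF assms(2), of _ B])
    show "\<bar>indicator D x * f x\<bar> \<le> B" for x using B by (cases "x \<in> D") auto
  qed measurable
  moreover have "(indicator D x * f x) * g x = f x * g x" for x using assms(3)[of x] by (cases "x \<in> D") auto
  ultimately show ?thesis by (simp only:)
qed

lemma integrable_on_D:
  assumes "sq_integrable g" "\<And>x. x \<notin> D \<Longrightarrow> g x = 0"
  shows "integrable lborel g"
  using assms D(2) by (intro sq_integrable_imp_integrable[of g D])

lemma integrable_smooth_mult:
  assumes "smooth f" "sq_integrable g" "\<And>x. x \<notin> D \<Longrightarrow> g x = 0"
  shows "integrable lborel (\<lambda>x. g x * f x)"
proof -
  have "integrable lborel (\<lambda>x. f x * g x)"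
    by (rule integrable_on_D[OF sq_integrable_smooth_mult[OF assms]]) (simp_all add: assms(3))
  then show ?thesis by (simp add: mult.commute)
qed

text \<open>Convergence in the \<open>L^2\<close> norm of \<open>D\<close> passes to the pairing
  with \<open>\<psi>\<close> by Cauchy-Schwarz, since \<open>\<psi>\<close> is square integrable on
  \<open>D\<close>.\<close>

lemma L2_limit_weak:
  assumes v: "\<And>n. smooth (v n)" and g: "sq_integrable g" "\<And>x. x \<notin> D \<Longrightarrow> g x = 0"
    and lim: "(\<lambda>n. \<integral>\<^sup>+x\<in>D. ennreal ((v n x - g x)\<^sup>2) \<partial>lborel) \<longlonglongrightarrow> 0" and \<psi>: "smooth \<psi>"
  shows "(\<lambda>n. \<integral>x. (indicator D x * v n x) * \<psi> x \<partial>lborel) \<longlonglongrightarrow> (\<integral>x. g x * \<psi> x \<partial>lborel)"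
proof -
  let ?d = "\<lambda>n x. indicator D x * v n x - g x"
  have ds: "sq_integrable (?d n)" for n by (intro sq_integrable_diff sq_integrable_smooth_on_D v g(1))
  have d0: "?d n x = 0" if "x \<notin> D" for n x using that g(2) by simp
  have "(\<integral>\<^sup>+x\<in>D. ennreal ((v n x - g x)\<^sup>2) \<partial>lborel) = ennreal (\<integral>x. (?d n x)\<^sup>2 \<partial>lborel)" for n
  proof -
    have "(\<integral>\<^sup>+x\<in>D. ennreal ((v n x - g x)\<^sup>2) \<partial>lborel) = (\<integral>\<^sup>+x. ennreal ((?d n x)\<^sup>2) \<partial>lborel)"
      using g(2) by (intro nn_integral_cong) (auto simp: indicator_def)
    also have "\<dots> = ennreal (\<integral>x. (?d n x)\<^sup>2 \<partial>lborel)"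
      using ds by (intro nn_integral_eq_integral) (auto simp: sq_integrable_def)
    finally show ?thesis .
  qed
  with lim have "(\<lambda>n. ennreal (\<integral>x. (?d n x)\<^sup>2 \<partial>lborel)) \<longlonglongrightarrow> ennreal 0" by simp
  then have e0: "(\<lambda>n. \<integral>x. (?d n x)\<^sup>2 \<partial>lborel) \<longlonglongrightarrow> 0" by (subst (asm) tendsto_ennreal_iff) auto
  define c where "c = (\<integral>x. (indicator D x * \<psi> x)\<^sup>2 \<partial>lborel)"
  have lim0: "(\<lambda>n. \<integral>x. ?d n x * (indicator D x * \<psi> x) \<partial>lborel) \<longlonglongrightarrow> 0"
  proof (rule tendsto_0_if_square_le)
    show "(\<integral>x. ?d n x * (indicator D x * \<psi> x) \<partial>lborel)\<^sup>2 \<le> (\<integral>x. (?d n x)\<^sup>2 \<partial>lborel) * c" for n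
      unfolding c_def by (rule Cauchy_Schwarz_integral[OF ds sq_integrable_smooth_on_D[OF \<psi>]])
    show "(\<lambda>n. (\<integral>x. (?d n x)\<^sup>2 \<partial>lborel) * c) \<longlonglongrightarrow> 0"
      using tendsto_mult_right[OF e0, of c] by simp
  qed
  have eq: "(\<integral>x. ?d n x * (indicator D x * \<psi> x) \<partial>lborel)
      = (\<integral>x. (indicator D x * v n x) * \<psi> x \<partial>lborel) - (\<integral>x. g x * \<psi> x \<partial>lborel)" for n
  proof -
    have "?d n x * (indicator D x * \<psi> x) = (indicator D x * v n x) * \<psi> x - g x * \<psi> x" for x
      using d0[of x n] g(2)[of x] by (cases "x \<in> D") (auto simp: left_diff_distrib)
    moreover have "integrable lborel (\<lambda>x. (indicator D x * v n x) * \<psi> x)"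
      by (intro integrable_smooth_mult \<psi> sq_integrable_smooth_on_D v) simp
    moreover have "integrable lborel (\<lambda>x. g x * \<psi> x)" by (intro integrable_smooth_mult \<psi> g)
    ultimately show ?thesis by (simp only: Bochner_Integration.integral_diff)
  qed
  show ?thesis by (rule LIM_zero_cancel) (rule lim0[unfolded eq])
qed

text \<open>The integral over \<open>D\<close> of the partial derivative of
  \<open>w n x * \<psi> x\<close> is evaluated twice. The boundary estimate and the vanishing trace
  send it to 0; the product rule and the convergence of \<open>w n\<close> send it to the sum of the
  integrals of \<open>U x * partial_deriv b \<psi> x\<close> and
  \<open>G b x * \<psi> x\<close>.\<close>

lemma zero_extension_local:
  assumes p: "p \<in> closure D" and b: "b \<in> Basis"
  shows "\<exists>r>0. \<forall>K \<psi>. compact K \<and> K \<subseteq> ball p r \<and> smooth \<psi> \<and> (\<forall>x. x \<notin> K \<longrightarrow> \<psi> x = 0) \<longrightarrow>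
    (\<integral>x. U x * partial_deriv b \<psi> x \<partial>lborel) = - (\<integral>x. G b x * \<psi> x \<partial>lborel)"
proof -
  define bounded_by where "bounded_by K C \<longleftrightarrow> (\<forall>h b. cont_diff 1 h \<and> (\<forall>x. x \<notin> K \<longrightarrow> h x = 0) \<and> b \<in> Basis \<longrightarrow>
    ennreal ((\<integral>x. indicator D x * partial_deriv b h x \<partial>lborel)\<^sup>2)
      \<le> ennreal C * (\<integral>\<^sup>+x\<in>frontier D. ennreal ((h x)\<^sup>2) \<partial>hausdorff2))" for K C
  have "\<exists>r>0. \<forall>K. compact K \<and> K \<subseteq> ball p r \<longrightarrow> (\<exists>C\<ge>0. bounded_by K C)"
    unfolding bounded_by_def by (rule boundary_estimate[OF D(1,3) p])
  then obtain r where r: "r > 0"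
    and est: "\<And>K. compact K \<Longrightarrow> K \<subseteq> ball p r \<Longrightarrow> \<exists>C\<ge>0. bounded_by K C"
    by blast
  have "(\<integral>x. U x * partial_deriv b \<psi> x \<partial>lborel) = - (\<integral>x. G b x * \<psi> x \<partial>lborel)"
    if K: "compact K" "K \<subseteq> ball p r" and \<psi>: "smooth \<psi>" "\<And>x. x \<notin> K \<Longrightarrow> \<psi> x = 0" for K \<psi>
  proof -
    obtain C where C: "C \<ge> 0" "bounded_by K C" using est[OF K] by blast
    obtain B where B: "B > 0" "\<And>x. \<bar>\<psi> x\<bar> \<le> B"
      using continuous_compact_support_bounded[OF smooth_continuous[OF \<psi>(1)] K(1) \<psi>(2)] by blast
    define a where "a n = (\<integral>x. indicator D x * partial_deriv b (\<lambda>x. w n x * \<psi> x) x \<partial>lborel)" for n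
    have "a \<longlonglongrightarrow> 0"
    proof -
      have le: "ennreal ((a n)\<^sup>2) \<le> ennreal (C * B\<^sup>2) * (\<integral>\<^sup>+x\<in>frontier D. ennreal ((w n x)\<^sup>2) \<partial>hausdorff2)" for n
      proof -
        have "cont_diff 1 (\<lambda>x. w n x * \<psi> x)" using smooth_mult[OF w \<psi>(1)] by (simp only: smooth_def)
        then have "ennreal ((a n)\<^sup>2) \<le> ennreal C * (\<integral>\<^sup>+x\<in>frontier D. ennreal ((w n x * \<psi> x)\<^sup>2) \<partial>hausdorff2)"
          unfolding a_def using \<psi>(2) b C(2)[unfolded bounded_by_def, rule_format, of "\<lambda>x. w n x * \<psi> x" b]
          by simp
        also have "(\<integral>\<^sup>+x\<in>frontier D. ennreal ((w n x * \<psi> x)\<^sup>2) \<partial>hausdorff2)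
            \<le> (\<integral>\<^sup>+x. ennreal (B\<^sup>2) * (ennreal ((w n x)\<^sup>2) * indicator (frontier D) x) \<partial>hausdorff2)"
        proof (rule nn_integral_mono)
          fix x
          have "(\<psi> x)\<^sup>2 \<le> B\<^sup>2" using power_mono[OF B(2)[of x], of 2] by simp
          then have "(w n x * \<psi> x)\<^sup>2 \<le> B\<^sup>2 * (w n x)\<^sup>2"
            by (simp add: power_mult_distrib mult.commute mult_right_mono)
          then have "ennreal ((w n x * \<psi> x)\<^sup>2) \<le> ennreal (B\<^sup>2) * ennreal ((w n x)\<^sup>2)"
            by (simp add: ennreal_mult[symmetric] ennreal_leI)
          then show "ennreal ((w n x * \<psi> x)\<^sup>2) * indicator (frontier D) x
              \<le> ennreal (B\<^sup>2) * (ennreal ((w n x)\<^sup>2) * indicator (frontier D) x)"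
            by (simp add: mult.assoc[symmetric] mult_right_mono)
        qed
        also have "\<dots> = ennreal (B\<^sup>2) * (\<integral>\<^sup>+x\<in>frontier D. ennreal ((w n x)\<^sup>2) \<partial>hausdorff2)"
        proof (rule nn_integral_cmult, rule borel_measurable_hausdorff2)
          have [measurable]: "w n \<in> borel_measurable borel" by (rule smooth_measurable[OF w])
          have [measurable]: "frontier D \<in> sets borel" by (intro borel_closed frontier_closed)
          show "(\<lambda>x. ennreal ((w n x)\<^sup>2) * indicator (frontier D) x) \<in> borel_measurable borel" by measurable
        qed
        finally have "ennreal ((a n)\<^sup>2) \<le> ennreal C * (ennreal (B\<^sup>2) * (\<integral>\<^sup>+x\<in>frontier D. ennreal ((w n x)\<^sup>2) \<partial>hausdorff2))"
          by (simp add: mult_left_mono)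
        then show ?thesis using C(1) by (simp add: ennreal_mult mult.assoc)
      qed
      have "(\<lambda>n. ennreal (C * B\<^sup>2) * (\<integral>\<^sup>+x\<in>frontier D. ennreal ((w n x)\<^sup>2) \<partial>hausdorff2)) \<longlonglongrightarrow> ennreal (C * B\<^sup>2) * 0"
        by (rule ennreal_tendsto_cmult[OF _ trace]) simp
      then have lim: "(\<lambda>n. ennreal (C * B\<^sup>2) * (\<integral>\<^sup>+x\<in>frontier D. ennreal ((w n x)\<^sup>2) \<partial>hausdorff2)) \<longlonglongrightarrow> 0" by simp
      have "(\<lambda>n. ennreal ((a n)\<^sup>2)) \<longlonglongrightarrow> 0"
        by (rule tendsto_sandwich[OF _ _ tendsto_const lim]) (use le in auto)
      then have "(\<lambda>n. ennreal ((a n)\<^sup>2)) \<longlonglongrightarrow> ennreal 0" by simp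
      then have "(\<lambda>n. (a n)\<^sup>2) \<longlonglongrightarrow> 0" by (subst (asm) tendsto_ennreal_iff) auto
      then show ?thesis by (rule tendsto_0_if_square_le[rotated]) simp
    qed
    moreover have "a \<longlonglongrightarrow> (\<integral>x. U x * partial_deriv b \<psi> x \<partial>lborel) + (\<integral>x. G b x * \<psi> x \<partial>lborel)"
    proof -
      have s: "smooth (partial_deriv b \<psi>)" "smooth (partial_deriv b (w n))" for n
        using smooth_partial_deriv[OF _ b] \<psi>(1) w by auto
      have "a n = (\<integral>x. (indicator D x * w n x) * partial_deriv b \<psi> x \<partial>lborel)
          + (\<integral>x. (indicator D x * partial_deriv b (w n) x) * \<psi> x \<partial>lborel)" for n
      proof -
        have "indicator D x * partial_deriv b (\<lambda>x. w n x * \<psi> x) x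
          = (indicator D x * w n x) * partial_deriv b \<psi> x + (indicator D x * partial_deriv b (w n) x) * \<psi> x" for x
          by (simp add: partial_deriv_mult[OF w \<psi>(1)] distrib_left)
        moreover have "integrable lborel (\<lambda>x. (indicator D x * w n x) * partial_deriv b \<psi> x)"
          by (intro integrable_smooth_mult s sq_integrable_smooth_on_D w) simp
        moreover have "integrable lborel (\<lambda>x. (indicator D x * partial_deriv b (w n) x) * \<psi> x)"
          by (intro integrable_smooth_mult \<psi>(1) sq_integrable_smooth_on_D s) simp
        ultimately show ?thesis by (simp only: a_def Bochner_Integration.integral_add)
      qed
      then show ?thesis
        using tendsto_add[OF L2_limit_weak[OF w U wU s(1)] L2_limit_weak[OF s(2) G[OF b] wG[OF b] \<psi>(1)]]
        by presburger
    qed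
    ultimately have "(\<integral>x. U x * partial_deriv b \<psi> x \<partial>lborel) + (\<integral>x. G b x * \<psi> x \<partial>lborel) = 0"
      by (rule LIMSEQ_unique[symmetric])
    then show ?thesis by simp
  qed
  then show ?thesis using r by blast
qed

lemma mult_partial_deriv_vanishing:
  assumes "smooth \<psi>" "\<And>x. x \<in> closure D \<Longrightarrow> \<psi> x = 0"
  shows "U x * partial_deriv b \<psi> x = 0"
proof (cases "x \<in> D")
  case True
  have "partial_deriv b \<psi> x = 0"
    by (rule partial_deriv_eq_0[OF D(1) True]) (use assms(2) closure_subset[of D] in blast)
  then show ?thesis by simp
qed (simp add: U(2))

text \<open>The test functions range over all smooth functions, which is meaningful because
  \<open>U\<close> and \<open>G b\<close> vanish off the bounded set \<open>D\<close>;
  \<open>partial_deriv_convol\<close> takes the statement in this form.\<close>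

lemma zero_extension:
  assumes "smooth \<psi>" and b: "b \<in> Basis"
  shows "(\<integral>x. U x * partial_deriv b \<psi> x \<partial>lborel) = - (\<integral>x. G b x * \<psi> x \<partial>lborel)"
proof (rule smooth_localization[OF compact_closure_D zero_extension_local[OF _ b] _ _ assms(1)])
  fix \<psi> :: "real^3 \<Rightarrow> real" assume \<psi>: "smooth \<psi>" "\<And>x. x \<in> closure D \<Longrightarrow> \<psi> x = 0"
  have "G b x * \<psi> x = 0" for x
    using \<psi>(2)[of x] G(2)[OF b, of x] closure_subset[of D] by (cases "x \<in> D") auto
  then show "(\<integral>x. U x * partial_deriv b \<psi> x \<partial>lborel) = - (\<integral>x. G b x * \<psi> x \<partial>lborel)"
    by (simp only: mult_partial_deriv_vanishing[OF \<psi>] Bochner_Integration.integral_zero minus_zero)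
next
  fix \<psi> \<psi>' :: "real^3 \<Rightarrow> real" assume s: "smooth \<psi>" "smooth \<psi>'"
    and "(\<integral>x. U x * partial_deriv b \<psi> x \<partial>lborel) = - (\<integral>x. G b x * \<psi> x \<partial>lborel)"
    and "(\<integral>x. U x * partial_deriv b \<psi>' x \<partial>lborel) = - (\<integral>x. G b x * \<psi>' x \<partial>lborel)"
  moreover have "integrable lborel (\<lambda>x. U x * partial_deriv b \<psi> x)" "integrable lborel (\<lambda>x. U x * partial_deriv b \<psi>' x)"
    using integrable_smooth_mult[OF smooth_partial_deriv[OF _ b] U] s by blast+
  moreover have "integrable lborel (\<lambda>x. G b x * \<psi> x)" "integrable lborel (\<lambda>x. G b x * \<psi>' x)"
    using integrable_smooth_mult[OF _ G[OF b]] s by blast+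
  ultimately show "(\<integral>x. U x * partial_deriv b (\<lambda>x. \<psi> x + \<psi>' x) x \<partial>lborel) = - (\<integral>x. G b x * (\<psi> x + \<psi>' x) \<partial>lborel)"
    by (simp add: partial_deriv_add[OF s] distrib_left)
qed

lemma sq_integrable_product_gradient:
  assumes "smooth \<xi>" "b \<in> Basis"
  shows "sq_integrable (\<lambda>x. \<xi> x * G b x + partial_deriv b \<xi> x * U x)"
  using assms by (intro sq_integrable_add sq_integrable_smooth_mult smooth_partial_deriv G U)

text \<open>The product rule for the cut-off extension, obtained from \<open>zero_extension\<close>
  with the test function \<open>\<xi> x * \<zeta> x\<close>.\<close>

lemma zero_extension_mult:
  assumes \<xi>: "smooth \<xi>" and b: "b \<in> Basis" and \<zeta>: "smooth \<zeta>"
  shows "(\<integral>x. (\<xi> x * U x) * partial_deriv b \<zeta> x \<partial>lborel)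
    = - (\<integral>x. (\<xi> x * G b x + partial_deriv b \<xi> x * U x) * \<zeta> x \<partial>lborel)"
proof -
  have s: "smooth (\<lambda>x. \<xi> x * \<zeta> x)" "smooth (\<lambda>x. partial_deriv b \<xi> x * \<zeta> x)"
    using smooth_mult[OF \<xi> \<zeta>] smooth_mult[OF smooth_partial_deriv[OF \<xi> b] \<zeta>] by auto
  have i1: "integrable lborel (\<lambda>x. U x * partial_deriv b (\<lambda>x. \<xi> x * \<zeta> x) x)"
    by (rule integrable_smooth_mult[OF smooth_partial_deriv[OF s(1) b] U])
  have i2: "integrable lborel (\<lambda>x. U x * (partial_deriv b \<xi> x * \<zeta> x))"
    by (rule integrable_smooth_mult[OF s(2) U])
  have i3: "integrable lborel (\<lambda>x. G b x * (\<xi> x * \<zeta> x))"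
    by (rule integrable_smooth_mult[OF s(1) G[OF b]])
  have "(\<integral>x. (\<xi> x * U x) * partial_deriv b \<zeta> x \<partial>lborel)
      = (\<integral>x. U x * partial_deriv b (\<lambda>x. \<xi> x * \<zeta> x) x - U x * (partial_deriv b \<xi> x * \<zeta> x) \<partial>lborel)"
    by (rule Bochner_Integration.integral_cong[OF refl])
      (simp add: partial_deriv_mult[OF \<xi> \<zeta>] algebra_simps)
  also have "\<dots> = - (\<integral>x. G b x * (\<xi> x * \<zeta> x) \<partial>lborel) - (\<integral>x. U x * (partial_deriv b \<xi> x * \<zeta> x) \<partial>lborel)"
    using i1 i2 zero_extension[OF s(1) b] by simp
  also have "\<dots> = - (\<integral>x. G b x * (\<xi> x * \<zeta> x) + U x * (partial_deriv b \<xi> x * \<zeta> x) \<partial>lborel)"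
    using i2 i3 by simp
  also have "(\<lambda>x. G b x * (\<xi> x * \<zeta> x) + U x * (partial_deriv b \<xi> x * \<zeta> x))
      = (\<lambda>x. (\<xi> x * G b x + partial_deriv b \<xi> x * U x) * \<zeta> x)"
    by (simp add: fun_eq_iff algebra_simps)
  finally show ?thesis .
qed

text \<open>The product of \<open>\<xi>\<close> and \<open>U\<close> need not be a test function of
  \<open>D\<close>, but its convolution with a kernel supported in inward shifts is, and harmonicity
  applies to it. The gradient passes through the convolution, so
  \<open>mollifier_weak_convergence\<close> recovers the identity as the kernels shrink to the
  origin.\<close>

lemma energy_local:
  assumes harmonic: "\<And>\<psi>. test_function D \<psi> \<Longrightarrow> (\<Sum>b\<in>Basis. \<integral>x. G b x * partial_deriv b \<psi> x \<partial>lborel) = 0"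
    and p: "p \<in> closure D"
  shows "\<exists>r>0. \<forall>K \<xi>. compact K \<and> K \<subseteq> ball p r \<and> smooth \<xi> \<and> (\<forall>x. x \<notin> K \<longrightarrow> \<xi> x = 0) \<longrightarrow>
    (\<Sum>b\<in>Basis. \<integral>x. G b x * (\<xi> x * G b x + partial_deriv b \<xi> x * U x) \<partial>lborel) = 0"
proof -
  define inward where "inward K \<delta> \<longleftrightarrow>
    (\<exists>c \<eta>. \<eta> > 0 \<and> cball c \<eta> \<subseteq> ball 0 \<delta> \<and> (\<forall>x\<in>K. \<forall>y\<in>cball c \<eta>. x + y \<in> D))" for K \<delta>
  have "\<exists>r>0. \<forall>K \<delta>. compact K \<and> K \<subseteq> closure D \<inter> ball p r \<and> \<delta> > 0 \<longrightarrow> inward K \<delta>"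
    unfolding inward_def by (rule inward_direction[OF D(1,3) p])
  then obtain r where r: "r > 0"
    and dir: "\<And>K \<delta>. compact K \<Longrightarrow> K \<subseteq> closure D \<inter> ball p r \<Longrightarrow> \<delta> > 0 \<Longrightarrow> inward K \<delta>"
    by blast
  have "(\<Sum>b\<in>Basis. \<integral>x. G b x * (\<xi> x * G b x + partial_deriv b \<xi> x * U x) \<partial>lborel) = 0"
    if K: "compact K" "K \<subseteq> ball p r" and \<xi>: "smooth \<xi>" "\<And>x. x \<notin> K \<Longrightarrow> \<xi> x = 0" for K \<xi>
  proof -
    define u where "u x = \<xi> x * U x" for x
    define g where "g b x = \<xi> x * G b x + partial_deriv b \<xi> x * U x" for b x
    have us: "sq_integrable u" unfolding u_def by (rule sq_integrable_smooth_mult[OF \<xi>(1) U])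
    have u0: "u x = 0" if "x \<notin> K \<inter> closure D" for x
      using that \<xi>(2)[of x] U(2)[of x] closure_subset[of D] by (auto simp: u_def)
    have ui: "integrable lborel u" by (rule integrable_on_D[OF us]) (simp add: u_def U(2))
    have gs: "sq_integrable (g b)" if "b \<in> Basis" for b
      unfolding g_def by (rule sq_integrable_product_gradient[OF \<xi>(1) that])
    have gi: "integrable lborel (g b)" if "b \<in> Basis" for b
      by (rule integrable_on_D[OF gs[OF that]]) (simp add: g_def U(2) G(2)[OF that])
    have Gi: "integrable lborel (G b)" if "b \<in> Basis" for b
      by (rule integrable_on_D[OF G(1)[OF that]]) (rule G(2)[OF that])
    have "\<bar>\<Sum>b\<in>Basis. \<integral>x. G b x * g b x \<partial>lborel\<bar> \<le> 0 + e" if e: "e > 0" for e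
    proof -
      \<comment> \<open>The error is shared equally among the coordinate directions.\<close>
      define e' where "e' = e / real DIM(real^3)"
      have e': "e' > 0" using e by (simp add: e'_def)
      define close where "close b d \<longleftrightarrow> (\<forall>c \<rho> k. mollifier c \<rho> k \<and> cball c \<rho> \<subseteq> ball 0 d \<longrightarrow>
        \<bar>(\<integral>z. G b z * convol (g b) k z \<partial>lborel) - (\<integral>z. G b z * g b z \<partial>lborel)\<bar> \<le> e')" for b d
      have "\<exists>d>0. close b d" if "b \<in> Basis" for b
        unfolding close_def by (rule mollifier_weak_convergence[OF G(1)[OF that] Gi[OF that] gs[OF that] gi[OF that] e'])
      then obtain d where d: "\<forall>b\<in>Basis. d b > 0 \<and> close b (d b)" by metis
      define \<delta> where "\<delta> = Min (d ` Basis)"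
      have \<delta>: "\<delta> > 0" "\<And>b. b \<in> Basis \<Longrightarrow> \<delta> \<le> d b" using d by (auto simp: \<delta>_def)
      \<comment> \<open>The product of \<open>\<xi>\<close> and \<open>U\<close> vanishes off this
        compact set, which is the one to be pushed into \<open>D\<close>.\<close>
      have Kc: "compact (K \<inter> closure D)" "K \<inter> closure D \<subseteq> closure D \<inter> ball p r" using K by auto
      obtain c \<eta> where \<eta>: "\<eta> > 0" "cball c \<eta> \<subseteq> ball 0 \<delta>"
        and into: "\<And>x y. x \<in> K \<inter> closure D \<Longrightarrow> y \<in> cball c \<eta> \<Longrightarrow> x + y \<in> D"
        using dir[OF Kc \<delta>(1)] unfolding inward_def by blast
      obtain k :: "real^3 \<Rightarrow> real" where k: "mollifier c \<eta> k" using mollifier_exists[OF \<eta>(1)] by blast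
      note kk = mollifierD[OF k]
      have "test_function D (convol u k)"
        unfolding test_function_def
      proof (intro conjI exI[of _ "{x + y | x y. x \<in> K \<inter> closure D \<and> y \<in> cball c \<eta>}"] allI impI)
        show "smooth (convol u k)" by (rule smooth_convol[OF ui kk(1) compact_cball kk(3)])
        show "compact {x + y |x y. x \<in> K \<inter> closure D \<and> y \<in> cball c \<eta>}" using Kc(1) by (intro compact_sums) auto
        show "{x + y |x y. x \<in> K \<inter> closure D \<and> y \<in> cball c \<eta>} \<subseteq> D" using into by blast
        show "convol u k z = 0" if "z \<notin> {x + y |x y. x \<in> K \<inter> closure D \<and> y \<in> cball c \<eta>}" for z
          by (rule convol_mollifier_support[OF k u0 that])
      qed
      from harmonic[OF this]
      have "(\<Sum>b\<in>Basis. \<integral>x. G b x * partial_deriv b (convol u k) x \<partial>lborel) = 0" .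
      moreover have "partial_deriv b (convol u k) z = convol (g b) k z" if "b \<in> Basis" for b z
        unfolding u_def g_def
        by (rule partial_deriv_convol[OF ui[unfolded u_def] k zero_extension_mult[OF \<xi>(1) that]])
      ultimately have sum0: "(\<Sum>b\<in>Basis. \<integral>x. G b x * convol (g b) k x \<partial>lborel) = 0" by simp
      have sub: "cball c \<eta> \<subseteq> ball 0 (d b)" if "b \<in> Basis" for b using \<eta>(2) \<delta>(2)[OF that] by force
      have "\<bar>\<Sum>b\<in>Basis. \<integral>x. G b x * g b x \<partial>lborel\<bar>
          = \<bar>\<Sum>b\<in>Basis. (\<integral>x. G b x * convol (g b) k x \<partial>lborel) - (\<integral>x. G b x * g b x \<partial>lborel)\<bar>"
        by (simp add: sum_subtractf sum0)
      also have "\<dots> \<le> (\<Sum>b\<in>(Basis :: (real^3) set). e')"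
      proof (intro sum_abs[THEN order_trans] sum_mono)
        fix b :: "real^3" assume b: "b \<in> Basis"
        then have "close b (d b)" using d by blast
        from this[unfolded close_def, rule_format, OF conjI[OF k sub[OF b]]]
        show "\<bar>(\<integral>x. G b x * convol (g b) k x \<partial>lborel) - (\<integral>x. G b x * g b x \<partial>lborel)\<bar> \<le> e'" .
      qed
      also have "\<dots> = 0 + e" by (simp add: e'_def)
      finally show ?thesis .
    qed
    then have "\<bar>\<Sum>b\<in>Basis. \<integral>x. G b x * g b x \<partial>lborel\<bar> \<le> 0" by (rule field_le_epsilon)
    then show ?thesis unfolding g_def by (simp only: abs_le_zero_iff)
  qed
  then show ?thesis using r by blast
qed

text \<open>\<open>smooth_localization\<close> removes the cutoff: for the constant function 1 the
  energy identity is the vanishing of the integral of the squared gradient.\<close>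

lemma gradient_eq_0:
  assumes harmonic: "\<And>\<psi>. test_function D \<psi> \<Longrightarrow> (\<Sum>b\<in>Basis. \<integral>x. G b x * partial_deriv b \<psi> x \<partial>lborel) = 0"
    and b: "b \<in> Basis"
  shows "AE x in lborel. G b x = 0"
proof -
  have "(\<Sum>b\<in>Basis. \<integral>x. G b x * (1 * G b x + partial_deriv b (\<lambda>_. 1) x * U x) \<partial>lborel) = 0"
  proof (rule smooth_localization[OF compact_closure_D energy_local[OF harmonic]])
    fix \<psi> :: "real^3 \<Rightarrow> real" assume \<psi>: "smooth \<psi>" "\<And>x. x \<in> closure D \<Longrightarrow> \<psi> x = 0"
    have "G b x * (\<psi> x * G b x + partial_deriv b \<psi> x * U x) = 0" if "b \<in> Basis" for b x
      using \<psi>(2)[of x] G(2)[OF that, of x] closure_subset[of D] mult_partial_deriv_vanishing[OF \<psi>, of x b]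
      by (cases "x \<in> D") (auto simp: mult.commute)
    then show "(\<Sum>b\<in>Basis. \<integral>x. G b x * (\<psi> x * G b x + partial_deriv b \<psi> x * U x) \<partial>lborel) = 0"
      by (intro sum.neutral ballI) (simp only: Bochner_Integration.integral_zero)
  next
    fix \<psi> \<psi>' :: "real^3 \<Rightarrow> real" assume s: "smooth \<psi>" "smooth \<psi>'"
      and 0: "(\<Sum>b\<in>Basis. \<integral>x. G b x * (\<psi> x * G b x + partial_deriv b \<psi> x * U x) \<partial>lborel) = 0"
        "(\<Sum>b\<in>Basis. \<integral>x. G b x * (\<psi>' x * G b x + partial_deriv b \<psi>' x * U x) \<partial>lborel) = 0"
    have "(\<integral>x. G b x * ((\<psi> x + \<psi>' x) * G b x + partial_deriv b (\<lambda>x. \<psi> x + \<psi>' x) x * U x) \<partial>lborel)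
      = (\<integral>x. G b x * (\<psi> x * G b x + partial_deriv b \<psi> x * U x) \<partial>lborel)
        + (\<integral>x. G b x * (\<psi>' x * G b x + partial_deriv b \<psi>' x * U x) \<partial>lborel)" if "b \<in> Basis" for b
    proof -
      have eq: "G b x * ((\<psi> x + \<psi>' x) * G b x + partial_deriv b (\<lambda>x. \<psi> x + \<psi>' x) x * U x)
        = G b x * (\<psi> x * G b x + partial_deriv b \<psi> x * U x)
          + G b x * (\<psi>' x * G b x + partial_deriv b \<psi>' x * U x)" for x
        unfolding partial_deriv_add[OF s] by (simp add: algebra_simps)
      have "integrable lborel (\<lambda>x. G b x * (\<psi> x * G b x + partial_deriv b \<psi> x * U x))"
        "integrable lborel (\<lambda>x. G b x * (\<psi>' x * G b x + partial_deriv b \<psi>' x * U x))"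
        using sq_integrable_mult[OF G(1) sq_integrable_product_gradient] s that by blast+
      from Bochner_Integration.integral_add[OF this] show ?thesis unfolding eq .
    qed
    then show "(\<Sum>b\<in>Basis. \<integral>x. G b x * ((\<psi> x + \<psi>' x) * G b x + partial_deriv b (\<lambda>x. \<psi> x + \<psi>' x) x * U x) \<partial>lborel) = 0"
      using 0 by (simp add: sum.distrib)
  qed simp_all
  moreover have "partial_deriv b (\<lambda>_. 1) x = 0" for b x :: "real^3"
    using partial_deriv_eq[OF has_derivative_const] .
  ultimately have "(\<Sum>b\<in>Basis. \<integral>x. (G b x)\<^sup>2 \<partial>lborel) = 0" by (simp add: power2_eq_square)
  then have "(\<integral>x. (G b x)\<^sup>2 \<partial>lborel) = 0"
    using b by (simp add: sum_nonneg_eq_0_iff)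
  then show ?thesis
    using integral_nonneg_eq_0_iff_AE[of lborel "\<lambda>x. (G b x)\<^sup>2"] G(1)[OF b] by (simp add: sq_integrable_def)
qed

lemma convol_eq_0:
  assumes G0: "\<And>b. b \<in> Basis \<Longrightarrow> AE x in lborel. G b x = 0" and k: "mollifier 0 r k"
  shows "convol U k z = 0"
proof -
  note kk = mollifierD[OF k]
  have k1: "cont_diff 1 k" using kk(1) by (simp add: smooth_def)
  have Ui: "integrable lborel U" by (rule integrable_on_D[OF U(1)]) (rule U(2))
  have G_int: "(\<integral>x. G b x * \<zeta> x \<partial>lborel) = 0" if "b \<in> Basis" "smooth \<zeta>" for b \<zeta>
  proof -
    have "AE x in lborel. G b x * \<zeta> x = 0" using G0[OF that(1)] by eventually_elim simp
    then show ?thesis by (rule integral_eq_zero_AE)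
  qed
  have pd: "partial_deriv b (convol U k) z = 0" if "b \<in> Basis" for b z
  proof -
    have "partial_deriv b (convol U k) z = convol (\<lambda>_. 0) k z"
      by (rule partial_deriv_convol[OF Ui k]) (simp add: zero_extension that G_int)
    then show ?thesis by (simp add: convol_def)
  qed
  have c1: "cont_diff 1 (convol U k)" by (rule cont_diff_convol[OF Ui k1 compact_cball kk(3)])
  have "(convol U k has_derivative (\<lambda>h. 0)) (at z)" for z
  proof -
    have "partial_deriv h (convol U k) z = 0" for h
      by (subst cont_diff_1D(4)[OF c1]) (simp add: pd)
    then show ?thesis using cont_diff_1D(1)[OF c1, of z] by (simp only:)
  qed
  then have const: "convol U k z = convol U k z'" for z'
    using has_derivative_zero_unique[of UNIV "convol U k" z z'] by simp
  \<comment> \<open>The convolution vanishes off a bounded set, so there is a point off that set,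
    where its constant value must be 0.\<close>
  have "bounded {x + y | x y. x \<in> closure D \<and> y \<in> cball 0 r}"
    by (intro compact_imp_bounded compact_sums compact_closure_D compact_cball)
  then have "{x + y | x y. x \<in> closure D \<and> y \<in> cball 0 r} \<noteq> UNIV" using not_bounded_UNIV by metis
  then obtain z' where "z' \<notin> {x + y | x y. x \<in> closure D \<and> y \<in> cball 0 r}" by blast
  moreover have "U x = 0" if "x \<notin> closure D" for x using that U(2) closure_subset by blast
  ultimately have "convol U k z' = 0" by (intro convol_mollifier_support[OF k, of "closure D"])
  then show ?thesis using const[of z'] by simp
qed

text \<open>The pairing of \<open>U\<close> with its mollifications tends to the integral of the
  square of \<open>U\<close>, and all these mollifications vanish.\<close>

lemma zero_trace_harmonic_eq_0:
  assumes harmonic: "\<And>\<psi>. test_function D \<psi> \<Longrightarrow> (\<Sum>b\<in>Basis. \<integral>x. G b x * partial_deriv b \<psi> x \<partial>lborel) = 0"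
  shows "AE x in lborel. U x = 0"
proof -
  have Ui: "integrable lborel U" by (rule integrable_on_D[OF U(1)]) (rule U(2))
  have "\<bar>\<integral>z. U z * U z \<partial>lborel\<bar> \<le> 0 + e" if e: "e > 0" for e
  proof -
    obtain d where d: "d > 0" "\<And>c r k. mollifier c r k \<and> cball c r \<subseteq> ball 0 d \<longrightarrow>
      \<bar>(\<integral>z. U z * convol U k z \<partial>lborel) - (\<integral>z. U z * U z \<partial>lborel)\<bar> \<le> e"
      using mollifier_weak_convergence[OF U(1) Ui U(1) Ui e] by (elim exE conjE) blast
    obtain k :: "real^3 \<Rightarrow> real" where k: "mollifier 0 (d / 2) k" using mollifier_exists[of "d / 2"] d(1) by auto
    have "cball 0 (d / 2) \<subseteq> ball (0 :: real^3) d" using d(1) by auto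
    then show ?thesis using d(2)[of 0 "d / 2" k] k
      using convol_eq_0[OF gradient_eq_0[OF harmonic] k] by simp
  qed
  then have "\<bar>\<integral>z. U z * U z \<partial>lborel\<bar> \<le> 0" by (rule field_le_epsilon)
  then have "(\<integral>z. (U z)\<^sup>2 \<partial>lborel) = 0" by (simp only: power2_eq_square abs_le_zero_iff)
  then show ?thesis
    using integral_nonneg_eq_0_iff_AE[of lborel "\<lambda>x. (U x)\<^sup>2"] U(1) by (simp add: sq_integrable_def)
qed

end

section \<open>The Dirichlet problem\<close>

text \<open>A measurable function for the completed measure has a Borel version, cut off outside
  \<open>D\<close>; finiteness carries over because nonnegative integrals agree for a measure and
  its completion.\<close>

lemma L2_on_borel:
  fixes v :: "'a::euclidean_space \<Rightarrow> real"
  assumes "L2_on D v" and D: "open D"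
  shows "\<exists>V. sq_integrable V \<and> (\<forall>x. x \<notin> D \<longrightarrow> V x = 0) \<and> (AE x in lborel. x \<in> D \<longrightarrow> V x = v x)"
proof -
  have Dl: "D \<in> sets lebesgue" using D by (rule lebesgue_open)
  have "(\<lambda>x. indicator D x *\<^sub>R v x) \<in> borel_measurable lebesgue"
    using assms(1) Dl by (simp add: L2_on_def borel_measurable_restrict_space_iff)
  then obtain V0 where V0: "V0 \<in> borel_measurable lborel" "AE x in lborel. indicator D x *\<^sub>R v x = V0 x"
    using completion_ex_borel_measurable_real[of _ lborel] by blast
  define V where "V x = indicator D x * V0 x" for x
  have "V0 \<in> borel_measurable borel" using V0(1) by simp
  then have Vm: "V \<in> borel_measurable borel"
    unfolding V_def using D by (intro borel_measurable_times borel_measurable_indicator) auto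
  have eq: "AE x in lborel. x \<in> D \<longrightarrow> V x = v x" using V0(2) by eventually_elim (auto simp: V_def)
  have "(\<integral>\<^sup>+x. ennreal ((V x)\<^sup>2) \<partial>lborel) = (\<integral>\<^sup>+x. ennreal ((v x)\<^sup>2) * indicator D x \<partial>lborel)"
    using eq by (intro nn_integral_cong_AE) (auto elim!: eventually_mono simp: V_def indicator_def)
  also have "\<dots> = (\<integral>\<^sup>+x. ennreal ((v x)\<^sup>2) \<partial>lebesgue_on D)"
    using Dl by (simp add: nn_integral_restrict_space nn_integral_completion)
  also have "\<dots> < \<infinity>" using assms(1) by (simp add: L2_on_def)
  finally have "integrable lborel (\<lambda>x. (V x)\<^sup>2)"
    using Vm by (intro integrableI_nonneg) auto
  then show ?thesis using Vm eq by (intro exI[of _ V]) (auto simp: sq_integrable_def V_def)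
qed

text \<open>Square integrability is known for the derivative supplied by \<open>sobolev\<close>;
  uniqueness up to null sets transfers it to the chosen \<open>weak_deriv\<close>.\<close>

lemma sobolev_weak_deriv_borel:
  assumes "sobolev (Suc k) D u" "open D" "b \<in> Basis"
  shows "\<exists>V. sq_integrable V \<and> (\<forall>x. x \<notin> D \<longrightarrow> V x = 0) \<and> (AE x in lborel. x \<in> D \<longrightarrow> V x = weak_deriv D b u x)"
proof -
  obtain v where v: "has_weak_deriv D b u v" "sobolev k D v" using assms(1,3) by auto
  have "L2_on D v" using v(2) by (cases k) auto
  then obtain V where V: "sq_integrable V" "\<forall>x. x \<notin> D \<longrightarrow> V x = 0" "AE x in lborel. x \<in> D \<longrightarrow> V x = v x"
    using L2_on_borel assms(2) by blast
  have "AE x in lborel. x \<in> D \<longrightarrow> weak_deriv D b u x = v x"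
    using weak_deriv_AE_eq[OF v(1) assms(2,3)] assms(2) by (simp add: AE_lebesgue_on_iff lebesgue_open)
  then have "AE x in lborel. x \<in> D \<longrightarrow> V x = weak_deriv D b u x"
    using V(3) by eventually_elim auto
  then show ?thesis using V by blast
qed

lemma nn_integral_lebesgue_on_eq:
  assumes "open D" "AE x in lborel. x \<in> D \<longrightarrow> V x = v x"
  shows "(\<integral>\<^sup>+x. h x (v x) \<partial>lebesgue_on D) = (\<integral>\<^sup>+x\<in>D. h x (V x) \<partial>lborel)"
proof -
  have "(\<integral>\<^sup>+x. h x (v x) \<partial>lebesgue_on D) = (\<integral>\<^sup>+x\<in>D. h x (v x) \<partial>lborel)"
    using lebesgue_open[OF assms(1)] by (simp add: nn_integral_restrict_space nn_integral_completion)
  also have "\<dots> = (\<integral>\<^sup>+x\<in>D. h x (V x) \<partial>lborel)"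
    using assms(2) by (intro nn_integral_cong_AE) (auto elim!: eventually_mono simp: indicator_def)
  finally show ?thesis .
qed

lemma integral_lebesgue_on_eq:
  fixes V v \<phi> :: "'a::euclidean_space \<Rightarrow> real"
  assumes D: "open D" and V: "V \<in> borel_measurable borel" "\<And>x. x \<notin> D \<Longrightarrow> V x = 0"
    and eq: "AE x in lborel. x \<in> D \<longrightarrow> V x = v x" and \<phi>: "\<phi> \<in> borel_measurable borel"
  shows "(LINT x|lebesgue_on D. v x * \<phi> x) = (\<integral>x. V x * \<phi> x \<partial>lborel)"
proof -
  have m: "(\<lambda>x. V x * \<phi> x) \<in> borel_measurable lebesgue"
    using V(1) \<phi> by (intro measurable_completion) simp
  have ae: "AE x in lebesgue. V x * \<phi> x = indicator D x *\<^sub>R (v x * \<phi> x)"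
    using AE_completion[OF eq] by eventually_elim (use V(2) in \<open>auto simp: indicator_def\<close>)
  have "(LINT x|lebesgue_on D. v x * \<phi> x) = (\<integral>x. indicator D x *\<^sub>R (v x * \<phi> x) \<partial>lebesgue)"
    using lebesgue_open[OF D] by (simp add: integral_restrict_space)
  also have "\<dots> = (\<integral>x. V x * \<phi> x \<partial>lebesgue)"
    using m borel_measurable_AE[OF m ae] ae by (intro integral_cong_AE) (auto intro: AE_symmetric)
  also have "\<dots> = (\<integral>x. V x * \<phi> x \<partial>lborel)"
    using V(1) \<phi> by (intro integral_completion) simp
  finally show ?thesis .
qed

lemma nn_integral_diff_square_tendsto_0:
  fixes f g :: "nat \<Rightarrow> 'a \<Rightarrow> real"
  assumes "\<And>n. f n \<in> borel_measurable M" "\<And>n. g n \<in> borel_measurable M"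
    and "(\<lambda>n. \<integral>\<^sup>+x. ennreal ((f n x)\<^sup>2) \<partial>M) \<longlonglongrightarrow> 0" "(\<lambda>n. \<integral>\<^sup>+x. ennreal ((g n x)\<^sup>2) \<partial>M) \<longlonglongrightarrow> 0"
  shows "(\<lambda>n. \<integral>\<^sup>+x. ennreal ((f n x - g n x)\<^sup>2) \<partial>M) \<longlonglongrightarrow> 0"
proof -
  note [measurable] = assms(1,2)
  have le: "(\<integral>\<^sup>+x. ennreal ((f n x - g n x)\<^sup>2) \<partial>M)
      \<le> 2 * (\<integral>\<^sup>+x. ennreal ((f n x)\<^sup>2) \<partial>M) + 2 * (\<integral>\<^sup>+x. ennreal ((g n x)\<^sup>2) \<partial>M)" for n
  proof -
    have "(\<integral>\<^sup>+x. ennreal ((f n x - g n x)\<^sup>2) \<partial>M) \<le> (\<integral>\<^sup>+x. 2 * ennreal ((f n x)\<^sup>2) + 2 * ennreal ((g n x)\<^sup>2) \<partial>M)"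
    proof (rule nn_integral_mono)
      fix x
      have "(f n x - g n x)\<^sup>2 \<le> 2 * (f n x)\<^sup>2 + 2 * (g n x)\<^sup>2"
        using zero_le_power2[of "f n x + g n x"] unfolding power2_sum power2_diff by linarith
      from ennreal_leI[OF this]
      show "ennreal ((f n x - g n x)\<^sup>2) \<le> 2 * ennreal ((f n x)\<^sup>2) + 2 * ennreal ((g n x)\<^sup>2)"
        by (simp add: ennreal_mult)
    qed
    also have "\<dots> = 2 * (\<integral>\<^sup>+x. ennreal ((f n x)\<^sup>2) \<partial>M) + 2 * (\<integral>\<^sup>+x. ennreal ((g n x)\<^sup>2) \<partial>M)"
      by (simp add: nn_integral_add nn_integral_cmult)
    finally show ?thesis .
  qed
  have "(\<lambda>n. 2 * (\<integral>\<^sup>+x. ennreal ((f n x)\<^sup>2) \<partial>M) + 2 * (\<integral>\<^sup>+x. ennreal ((g n x)\<^sup>2) \<partial>M)) \<longlonglongrightarrow> 2 * 0 + 2 * 0"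
    by (intro tendsto_add ennreal_tendsto_cmult assms) simp_all
  then have lim: "(\<lambda>n. 2 * (\<integral>\<^sup>+x. ennreal ((f n x)\<^sup>2) \<partial>M) + 2 * (\<integral>\<^sup>+x. ennreal ((g n x)\<^sup>2) \<partial>M)) \<longlonglongrightarrow> 0"
    by simp
  show ?thesis by (rule tendsto_sandwich[OF _ _ tendsto_const lim]) (use le in auto)
qed

lemma nn_integral_set_diff_square_tendsto_0:
  fixes f g :: "nat \<Rightarrow> 'a \<Rightarrow> real"
  assumes S: "S \<inter> space M \<in> sets M"
    and m: "\<And>n. f n \<in> borel_measurable (restrict_space M S)" "\<And>n. g n \<in> borel_measurable (restrict_space M S)"
    and lim: "(\<lambda>n. \<integral>\<^sup>+x\<in>S. ennreal ((f n x)\<^sup>2) \<partial>M) \<longlonglongrightarrow> 0" "(\<lambda>n. \<integral>\<^sup>+x\<in>S. ennreal ((g n x)\<^sup>2) \<partial>M) \<longlonglongrightarrow> 0"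
    and h: "\<And>n x. h n x = f n x - g n x"
  shows "(\<lambda>n. \<integral>\<^sup>+x\<in>S. ennreal ((h n x)\<^sup>2) \<partial>M) \<longlonglongrightarrow> 0"
  using nn_integral_diff_square_tendsto_0[OF m] lim by (simp add: nn_integral_restrict_space[OF S] h)

lemma sum_Basis_vec:
  "(\<Sum>b\<in>(Basis :: (real^'n) set). f b) = (\<Sum>i\<in>UNIV. f (axis i 1))"
  by (rule sum.reindex_bij_betw[OF bij_betw_axis, symmetric])

text \<open>Each second weak derivative hands one derivative to the test function. Integrability is
  recorded so that two such identities can be subtracted.\<close>

lemma weak_laplacian_test:
  fixes u :: "real^3 \<Rightarrow> real"
  assumes D: "open D" and u: "sobolev 2 D u" and \<psi>: "test_function D \<psi>"
  shows "(\<Sum>i\<in>UNIV. LINT x|lebesgue_on D. weak_partial D i u x * partial_deriv (axis i 1) \<psi> x)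
      = - (LINT x|lebesgue_on D. (\<Sum>i\<in>UNIV. weak_partial D i (weak_partial D i u) x) * \<psi> x)"
    and "integrable (lebesgue_on D) (\<lambda>x. (\<Sum>i\<in>UNIV. weak_partial D i (weak_partial D i u) x) * \<psi> x)"
proof -
  have W: "has_weak_deriv D (axis i 1) (weak_partial D i u) (weak_partial D i (weak_partial D i u))" for i
    using u D by (intro sobolev_has_weak_partial2[of 0]) (simp_all add: numeral_2_eq_2)
  have I: "integrable (lebesgue_on D) (\<lambda>x. weak_partial D i (weak_partial D i u) x * \<psi> x)" for i
    using W[of i] D \<psi> by (intro locally_integrable_test_integrable) (auto simp: has_weak_deriv_def)
  have "(LINT x|lebesgue_on D. weak_partial D i u x * partial_deriv (axis i 1) \<psi> x)
      = - (LINT x|lebesgue_on D. weak_partial D i (weak_partial D i u) x * \<psi> x)" for i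
    using W[of i] \<psi> by (simp add: has_weak_deriv_def)
  then show "(\<Sum>i\<in>UNIV. LINT x|lebesgue_on D. weak_partial D i u x * partial_deriv (axis i 1) \<psi> x)
      = - (LINT x|lebesgue_on D. (\<Sum>i\<in>UNIV. weak_partial D i (weak_partial D i u) x) * \<psi> x)"
    using I by (simp add: sum_distrib_right sum_negf)
  show "integrable (lebesgue_on D) (\<lambda>x. (\<Sum>i\<in>UNIV. weak_partial D i (weak_partial D i u) x) * \<psi> x)"
    using I by (simp add: sum_distrib_right)
qed

text \<open>Both functions are approximated by smooth sequences whose boundary values tend to the
  same \<open>g\<close>, so the differences of the sequences have boundary values tending to 0.
  Hence the difference of the Borel representatives satisfies \<open>zero_trace\<close>.\<close>

lemma dirichlet_unique:
  fixes D :: "(real^3) set" and v a g :: "real^3 \<Rightarrow> real"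
  assumes D: "bounded_domain D" "C2_boundary D"
    and s: "sobolev 2 D v" "sobolev 2 D a" and t: "has_trace D v g" "has_trace D a g"
    and lap: "AE x in lebesgue_on D.
      (\<Sum>i\<in>UNIV. weak_partial D i (weak_partial D i v) x) = (\<Sum>i\<in>UNIV. weak_partial D i (weak_partial D i a) x)"
  shows "AE x in lebesgue_on D. v x = a x"
proof -
  have Do: "open D" "bounded D" using D(1) by (auto simp: bounded_domain_def)
  have s': "sobolev (Suc 1) D v" "sobolev (Suc 1) D a" using s by (simp_all only: Suc_1)
  have L2: "L2_on D v" "L2_on D a" using s' by auto
  obtain V where V: "sq_integrable V" "\<forall>x. x \<notin> D \<longrightarrow> V x = 0" "AE x in lborel. x \<in> D \<longrightarrow> V x = v x"
    using L2_on_borel[OF L2(1) Do(1)] by blast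
  obtain A where A: "sq_integrable A" "\<forall>x. x \<notin> D \<longrightarrow> A x = 0" "AE x in lborel. x \<in> D \<longrightarrow> A x = a x"
    using L2_on_borel[OF L2(2) Do(1)] by blast
  have "\<forall>b\<in>Basis. \<exists>W. sq_integrable W \<and> (\<forall>x. x \<notin> D \<longrightarrow> W x = 0) \<and> (AE x in lborel. x \<in> D \<longrightarrow> W x = weak_deriv D b v x)"
    using sobolev_weak_deriv_borel[OF s'(1) Do(1)] by blast
  from bchoice[OF this] obtain dV where dV0: "\<forall>b\<in>Basis. sq_integrable (dV b) \<and> (\<forall>x. x \<notin> D \<longrightarrow> dV b x = 0) \<and>
      (AE x in lborel. x \<in> D \<longrightarrow> dV b x = weak_deriv D b v x)" by blast
  have "\<forall>b\<in>Basis. \<exists>W. sq_integrable W \<and> (\<forall>x. x \<notin> D \<longrightarrow> W x = 0) \<and> (AE x in lborel. x \<in> D \<longrightarrow> W x = weak_deriv D b a x)"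
    using sobolev_weak_deriv_borel[OF s'(2) Do(1)] by blast
  from bchoice[OF this] obtain dA where dA0: "\<forall>b\<in>Basis. sq_integrable (dA b) \<and> (\<forall>x. x \<notin> D \<longrightarrow> dA b x = 0) \<and>
      (AE x in lborel. x \<in> D \<longrightarrow> dA b x = weak_deriv D b a x)" by blast
  have dV: "sq_integrable (dV b)" "x \<notin> D \<Longrightarrow> dV b x = 0" "AE x in lborel. x \<in> D \<longrightarrow> dV b x = weak_deriv D b v x"
    and dA: "sq_integrable (dA b)" "x \<notin> D \<Longrightarrow> dA b x = 0" "AE x in lborel. x \<in> D \<longrightarrow> dA b x = weak_deriv D b a x"
    if "b \<in> Basis" for b x
    using dV0 dA0 that by auto
  have gm: "g \<in> borel_measurable (restrict_space hausdorff2 (frontier D))"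
    using t(1) by (simp add: has_trace_def)
  obtain wv where wv: "\<forall>n. smooth (wv n)"
      "(\<lambda>n. \<integral>\<^sup>+x. ennreal ((wv n x - v x)\<^sup>2) \<partial>lebesgue_on D) \<longlonglongrightarrow> 0"
      "\<forall>i. (\<lambda>n. \<integral>\<^sup>+x. ennreal ((partial_deriv (axis i 1) (wv n) x - weak_partial D i v x)\<^sup>2) \<partial>lebesgue_on D) \<longlonglongrightarrow> 0"
      "(\<lambda>n. \<integral>\<^sup>+x\<in>frontier D. ennreal ((wv n x - g x)\<^sup>2) \<partial>hausdorff2) \<longlonglongrightarrow> 0"
    using t(1) unfolding has_trace_def by blast
  obtain wa where wa: "\<forall>n. smooth (wa n)"
      "(\<lambda>n. \<integral>\<^sup>+x. ennreal ((wa n x - a x)\<^sup>2) \<partial>lebesgue_on D) \<longlonglongrightarrow> 0"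
      "\<forall>i. (\<lambda>n. \<integral>\<^sup>+x. ennreal ((partial_deriv (axis i 1) (wa n) x - weak_partial D i a x)\<^sup>2) \<partial>lebesgue_on D) \<longlonglongrightarrow> 0"
      "(\<lambda>n. \<integral>\<^sup>+x\<in>frontier D. ennreal ((wa n x - g x)\<^sup>2) \<partial>hausdorff2) \<longlonglongrightarrow> 0"
    using t(2) unfolding has_trace_def by blast
  have sm: "f \<in> borel_measurable (borel :: (real^3) measure)" if "smooth f" for f
    using that by (intro borel_measurable_continuous_onI smooth_continuous)
  have Ds: "D \<inter> space lborel \<in> sets lborel" using Do(1) by simp
  interpret zero_trace D "\<lambda>x. V x - A x" "\<lambda>b x. dV b x - dA b x" "\<lambda>n x. wv n x - wa n x"
  proof
    show "open D" "bounded D" "C2_boundary D" by (fact Do D)+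
    show "sq_integrable (\<lambda>x. V x - A x)" by (intro sq_integrable_diff V A)
    show "V x - A x = 0" if "x \<notin> D" for x using that V(2) A(2) by simp
    show "sq_integrable (\<lambda>x. dV b x - dA b x)" if "b \<in> Basis" for b
      by (intro sq_integrable_diff dV(1) dA(1) that)
    show "dV b x - dA b x = 0" if "b \<in> Basis" "x \<notin> D" for b x using dV(2) dA(2) that by simp
    show "smooth (\<lambda>x. wv n x - wa n x)" for n using wv(1) wa(1) by (intro smooth_diff) auto
    show "(\<lambda>n. \<integral>\<^sup>+x\<in>D. ennreal ((wv n x - wa n x - (V x - A x))\<^sup>2) \<partial>lborel) \<longlonglongrightarrow> 0"
    proof (rule nn_integral_set_diff_square_tendsto_0[OF Ds])
      show "(\<lambda>x. wv n x - V x) \<in> borel_measurable (restrict_space lborel D)"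
        "(\<lambda>x. wa n x - A x) \<in> borel_measurable (restrict_space lborel D)" for n
        using sm wv(1) wa(1) V(1) A(1)
        by (auto intro!: measurable_restrict_space1 borel_measurable_diff simp: sq_integrable_def)
      show "(\<lambda>n. \<integral>\<^sup>+x\<in>D. ennreal ((wv n x - V x)\<^sup>2) \<partial>lborel) \<longlonglongrightarrow> 0"
        using wv(2) nn_integral_lebesgue_on_eq[OF Do(1) V(3), of "\<lambda>x y. ennreal ((wv _ x - y)\<^sup>2)"] by simp
      show "(\<lambda>n. \<integral>\<^sup>+x\<in>D. ennreal ((wa n x - A x)\<^sup>2) \<partial>lborel) \<longlonglongrightarrow> 0"
        using wa(2) nn_integral_lebesgue_on_eq[OF Do(1) A(3), of "\<lambda>x y. ennreal ((wa _ x - y)\<^sup>2)"] by simp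
    qed simp
    show "(\<lambda>n. \<integral>\<^sup>+x\<in>D. ennreal ((partial_deriv b (\<lambda>x. wv n x - wa n x) x - (dV b x - dA b x))\<^sup>2) \<partial>lborel) \<longlonglongrightarrow> 0"
      if b: "b \<in> Basis" for b
    proof (rule nn_integral_set_diff_square_tendsto_0[OF Ds])
      obtain i where i: "b = axis i 1" using b by (auto simp: Basis_vec_def)
      show "(\<lambda>x. partial_deriv b (wv n) x - dV b x) \<in> borel_measurable (restrict_space lborel D)"
        "(\<lambda>x. partial_deriv b (wa n) x - dA b x) \<in> borel_measurable (restrict_space lborel D)" for n
        using sm[OF smooth_partial_deriv[OF _ b]] wv(1) wa(1) dV(1)[OF b] dA(1)[OF b]
        by (auto intro!: measurable_restrict_space1 borel_measurable_diff simp: sq_integrable_def)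
      show "(\<lambda>n. \<integral>\<^sup>+x\<in>D. ennreal ((partial_deriv b (wv n) x - dV b x)\<^sup>2) \<partial>lborel) \<longlonglongrightarrow> 0"
        using wv(3)[rule_format, of i]
          nn_integral_lebesgue_on_eq[OF Do(1) dV(3)[OF b], of "\<lambda>x y. ennreal ((partial_deriv b (wv _) x - y)\<^sup>2)"]
        by (simp add: i weak_partial_def)
      show "(\<lambda>n. \<integral>\<^sup>+x\<in>D. ennreal ((partial_deriv b (wa n) x - dA b x)\<^sup>2) \<partial>lborel) \<longlonglongrightarrow> 0"
        using wa(3)[rule_format, of i]
          nn_integral_lebesgue_on_eq[OF Do(1) dA(3)[OF b], of "\<lambda>x y. ennreal ((partial_deriv b (wa _) x - y)\<^sup>2)"]
        by (simp add: i weak_partial_def)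
    qed (use wv(1) wa(1) in \<open>simp add: partial_deriv_diff\<close>)
    show "(\<lambda>n. \<integral>\<^sup>+x\<in>frontier D. ennreal ((wv n x - wa n x)\<^sup>2) \<partial>hausdorff2) \<longlonglongrightarrow> 0"
    \<comment> \<open>The difference is written as \<open>(wv n x - g x) - (wa n x - g x)\<close>;
      measurability of \<open>g\<close> on the frontier lets the integral of its square be
      split.\<close>
    proof (rule nn_integral_set_diff_square_tendsto_0[OF _ _ _ wv(4) wa(4)])
      show "frontier D \<inter> space hausdorff2 \<in> sets hausdorff2"
        using closed_in_sets_hausdorff2[OF frontier_closed] by (simp add: space_hausdorff2)
      show "(\<lambda>x. wv n x - g x) \<in> borel_measurable (restrict_space hausdorff2 (frontier D))"
        "(\<lambda>x. wa n x - g x) \<in> borel_measurable (restrict_space hausdorff2 (frontier D))" for n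
        using measurable_restrict_space1[OF borel_measurable_hausdorff2[OF sm]] wv(1) wa(1) gm
        by (auto intro!: borel_measurable_diff)
    qed simp
  qed
  have "AE x in lborel. V x - A x = 0"
  proof (rule zero_trace_harmonic_eq_0)
    fix \<psi> assume \<psi>: "test_function D \<psi>"
    have pm: "partial_deriv b \<psi> \<in> borel_measurable borel" if "b \<in> Basis" for b
      using \<psi> that by (intro sm smooth_partial_deriv) (auto simp: test_function_def)
    have "(\<integral>x. (dV b x - dA b x) * partial_deriv b \<psi> x \<partial>lborel)
        = (LINT x|lebesgue_on D. weak_deriv D b v x * partial_deriv b \<psi> x)
          - (LINT x|lebesgue_on D. weak_deriv D b a x * partial_deriv b \<psi> x)" if b: "b \<in> Basis" for b
    proof -
      have ps: "smooth (partial_deriv b \<psi>)" using \<psi> b by (intro smooth_partial_deriv) (auto simp: test_function_def)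
      show ?thesis
        using integrable_smooth_mult[OF ps dV(1)[OF b] dV(2)[OF b]] integrable_smooth_mult[OF ps dA(1)[OF b] dA(2)[OF b]]
          integral_lebesgue_on_eq[OF Do(1) sq_integrable_measurable[OF dV(1)[OF b]] dV(2)[OF b] dV(3)[OF b] pm[OF b]]
          integral_lebesgue_on_eq[OF Do(1) sq_integrable_measurable[OF dA(1)[OF b]] dA(2)[OF b] dA(3)[OF b] pm[OF b]]
        by (simp add: left_diff_distrib)
    qed
    then have "(\<Sum>b\<in>Basis. \<integral>x. (dV b x - dA b x) * partial_deriv b \<psi> x \<partial>lborel)
      = (\<Sum>i\<in>UNIV. LINT x|lebesgue_on D. weak_partial D i v x * partial_deriv (axis i 1) \<psi> x)
        - (\<Sum>i\<in>UNIV. LINT x|lebesgue_on D. weak_partial D i a x * partial_deriv (axis i 1) \<psi> x)"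
      by (simp add: sum_Basis_vec sum_subtractf weak_partial_def)
    also have "\<dots> = - (LINT x|lebesgue_on D. (\<Sum>i\<in>UNIV. weak_partial D i (weak_partial D i v) x) * \<psi> x
        - (\<Sum>i\<in>UNIV. weak_partial D i (weak_partial D i a) x) * \<psi> x)"
      using weak_laplacian_test[OF Do(1) s(1) \<psi>] weak_laplacian_test[OF Do(1) s(2) \<psi>]
      by (simp add: Bochner_Integration.integral_diff)
    also have "\<dots> = 0"
    proof -
      have "AE x in lebesgue_on D. (\<Sum>i\<in>UNIV. weak_partial D i (weak_partial D i v) x) * \<psi> x
        - (\<Sum>i\<in>UNIV. weak_partial D i (weak_partial D i a) x) * \<psi> x = 0"
        using lap by eventually_elim simp
      from integral_eq_zero_AE[OF this] show ?thesis by simp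
    qed
    finally show "(\<Sum>b\<in>Basis. \<integral>x. (dV b x - dA b x) * partial_deriv b \<psi> x \<partial>lborel) = 0" .
  qed
  then have "AE x in lborel. x \<in> D \<longrightarrow> v x = a x"
    using V(3) A(3) by eventually_elim auto
  then show ?thesis using Do(1) by (simp add: AE_lebesgue_on_iff lebesgue_open)
qed

theorem theorem3p2:
  fixes D :: "(real^3) set"
    and A a \<phi> :: "real^3 \<Rightarrow> real^3"
    and f :: "real^3 \<Rightarrow> real"
  assumes "bounded_domain D"
    and "C2_boundary D"
    and "sobolev_vec 2 D A"
    and "AE x in lebesgue_on D. a x = weak_curl D A x"
    and "AE x in lebesgue_on D. f x = weak_div D A x"
    and "has_trace_vec D A \<phi>"
  shows "solves_dirichlet D (\<lambda>x. weak_curl D a x - weak_grad D f x) \<phi> A \<and>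
         (\<forall>V. solves_dirichlet D (\<lambda>x. weak_curl D a x - weak_grad D f x) \<phi> V \<longrightarrow>
              (AE x in lebesgue_on D. V x = A x))"
proof (intro conjI allI impI)
  have "open D" using assms(1) by (simp add: bounded_domain_def)
  \<comment> \<open>Regularity and boundary values of \<open>A\<close> are given, so for the first
    claim only the differential equation has to be verified.\<close>
  then have A: "AE x in lebesgue_on D. - weak_laplacian D A x = weak_curl D a x - weak_grad D f x"
    using assms by (intro weak_laplacian_eq_curl_curl)
  then show "solves_dirichlet D (\<lambda>x. weak_curl D a x - weak_grad D f x) \<phi> A"
    using assms by (simp add: solves_dirichlet_def)
  fix V assume V: "solves_dirichlet D (\<lambda>x. weak_curl D a x - weak_grad D f x) \<phi> V"
  then have "AE x in lebesgue_on D. - weak_laplacian D V x = weak_curl D a x - weak_grad D f x"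
    by (simp add: solves_dirichlet_def)
  then have eq: "AE x in lebesgue_on D. weak_laplacian D V x = weak_laplacian D A x"
    using A by eventually_elim (metis neg_equal_iff_equal)
  \<comment> \<open>\<open>weak_laplacian\<close> and the trace act on each component separately, so
    the scalar statement applies to every \<open>j\<close>.\<close>
  have "AE x in lebesgue_on D. V x $ j = A x $ j" for j
  proof (rule dirichlet_unique[OF assms(1,2)])
    show "sobolev 2 D (\<lambda>x. V x $ j)" "sobolev 2 D (\<lambda>x. A x $ j)"
      using V assms(3) by (auto simp: solves_dirichlet_def sobolev_vec_def)
    show "has_trace D (\<lambda>x. V x $ j) (\<lambda>x. \<phi> x $ j)" "has_trace D (\<lambda>x. A x $ j) (\<lambda>x. \<phi> x $ j)"
      using V assms(6) by (auto simp: solves_dirichlet_def has_trace_vec_def)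
    show "AE x in lebesgue_on D. (\<Sum>i\<in>UNIV. weak_partial D i (weak_partial D i (\<lambda>x. V x $ j)) x)
        = (\<Sum>i\<in>UNIV. weak_partial D i (weak_partial D i (\<lambda>x. A x $ j)) x)"
      using eq by eventually_elim (simp add: weak_laplacian_def vec_eq_iff)
  qed
  then show "AE x in lebesgue_on D. V x = A x"
    by (simp add: vec_eq_iff AE_all_countable)
qed

end
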